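(* Let $\Omega\subset\mathbb{R}^d$ be an open neighbourhood of $\mathbf{0}$, $k\ge1$, and $K\in\mathcal{C}^{(k+1,k+1)}(\Omega\times\Omega)$. Let $\mathbf{x}_1,\ldots,\mathbf{x}_n\in\mathbb{R}^d$ with $\#\mathbb{P}_{k-1}<n\le\#\mathbb{P}_k$, and $\mathbf{K}_\varepsilon=[K(\varepsilon\mathbf{x}_i,\varepsilon\mathbf{x}_j)]_{i,j=1}^n$. Then as $\varepsilon\to0$: 1. If $n=\#\mathbb{P}_k$, then $\det\mathbf{K}_\varepsilon=\varepsilon^{2M(k,d)}\big(\det\mathbf{W}_k\,(\det\mathbf{V}_{\le k})^2+\mathcal{O}(\varepsilon)\big)$. 2. If $n<\#\mathbb{P}_k$ and $\ell=\#\mathbb{P}_k-n$, then \[\det\mathbf{K}_\varepsilon=\varepsilon^{2(M(k,d)-k\ell)}\big(\det(\mathbf{Y}\mathbf{W}_k\mathbf{Y}^\top)\det(\mathbf{V}_{\le k-1}^\top\mathbf{V}_{\le k-1})+\mathcal{O}(\varepsilon)\big),\] where $\mathbf{Y}=\begin{bmatrix}\mathbf{I}_{\#\mathbb{P}_{k-1}} & \\ & \mathbf{Q}_\perp^\top\mathbf{V}_k\end{bmatrix}\in\mathbb{R}^{n\times\#\mathbb{P}_k}$ and $\mathbf{Q}_\perp\in\mathbb{R}^{n\times(n-\#\mathbb{P}_{k-1})}$ consists of the last $n-\#\mathbb{P}_{k-1}$ columns of the orthogonal factor $\mathbf{Q}_{\rm full}\in\mathbb{R}^{n\times n}$ of a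 full QR factorization of $\mathbf{V}_{\le k-1}$. 3. If for some $\varepsilon_0>0$, $\mathbf{K}_\varepsilon$ is positive semidefinite for $\varepsilon\in[0,\varepsilon_0]$, then its eigenvalues, listed in nonincreasing order, split into $k+1$ consecutive groups: one eigenvalue that is $\mathcal{O}(1)$, then $\#\mathbb{H}_1=d$ eigenvalues that are $\mathcal{O}(\varepsilon^2)$, …, then $\#\mathbb{H}_s$ eigenvalues that are $\mathcal{O}(\varepsilon^{2s})$ for each $s<k$, and finally $\#\mathbb{H}_k-\ell$ eigenvalues that are $\mathcal{O}(\varepsilon^{2k})$ (with $\ell=\#\mathbb{P}_k-n$).
   Context: Multi-indices $\boldsymbol\alpha\in\mathbb{Z}_+^d$: $|\boldsymbol\alpha|=\sum_i\alpha_i$, $\boldsymbol\alpha!=\prod_i\alpha_i!$, $\mathbf{x}^{\boldsymbol\alpha}=\prod_i x_i^{\alpha_i}$. $\mathbb{P}_k=\{\boldsymbol\alpha:|\boldsymbol\alpha|\le k\}$, $\mathbb{H}_k=\{\boldsymbol\alpha:|\boldsymbol\alpha|=k\}$, so $\#\mathbb{P}_k=\binom{k+d}{d}$, $\#\mathbb{H}_k=\binom{k+d-1}{d-1}$. A fixed graded total order on multi-indices is used ($|\boldsymbol\alpha|<|\boldsymbol\beta|\Rightarrow\boldsymbol\alpha\prec\boldsymbol\beta$). For a set $\mathcal{A}=\{\boldsymbol\alpha_1\prec\cdots\prec\boldsymbol\alpha_m\}$, $\mathbf{V}_{\mathcal{A}}=[\mathbf{x}_i^{\boldsymbol\alpha_j}]_{i\le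 n,j\le m}$; $\mathbf{V}_{\le k}=\mathbf{V}_{\mathbb{P}_k}$, $\mathbf{V}_k=\mathbf{V}_{\mathbb{H}_k}$, so $\mathbf{V}_{\le k}=[\mathbf{V}_0\ \mathbf{V}_1\cdots\mathbf{V}_k]$. $K\in\mathcal{C}^{(k,k)}(\Omega\times\Omega)$ means all partial derivatives $K^{(\boldsymbol\alpha,\boldsymbol\beta)}=\partial_{\mathbf{x}}^{\boldsymbol\alpha}\partial_{\mathbf{y}}^{\boldsymbol\beta}K$ with $\boldsymbol\alpha,\boldsymbol\beta\in\mathbb{P}_k$ exist and are continuous on $\Omega\times\Omega$. Wronskian: $\mathbf{W}_k=\Big[\frac{K^{(\boldsymbol\alpha,\boldsymbol\beta)}(\mathbf{0},\mathbf{0})}{\boldsymbol\alpha!\boldsymbol\beta!}\Big]_{\boldsymbol\alpha,\boldsymbol\beta\in\mathbb{P}_k}$ (rows/columns in the chosen order). $M(k,d)=\sum_{\boldsymbol\alpha\in\mathbb{P}_k}|\boldsymbol\alpha|=d\binom{k+d}{d+1}$. Full QR factorization of $\mathbf{V}\in\mathbb{R}^{n\times m}$: $\mathbf{V}=\mathbf{Q}_{\rm full}\begin{bmatrix}\mathbf{R}\\\mathbf{0}\end{bmatrix}$, $\mathbf{Q}_{\rm full}$ orthogonal, $\mathbf{R}$ upper triangular. *)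

theory Defs
  imports "HOL-Analysis.Analysis" "HOL-Library.Landau_Symbols"
    "Jordan_Normal_Form.Determinant" "Jordan_Normal_Form.Char_Poly"
begin

definition mi_deg :: "('d::finite \<Rightarrow> nat) \<Rightarrow> nat" where
  "mi_deg \<alpha> = (\<Sum>c\<in>UNIV. \<alpha> c)"

definition mi_fact :: "('d::finite \<Rightarrow> nat) \<Rightarrow> real" where
  "mi_fact \<alpha> = (\<Prod>c\<in>UNIV. fact (\<alpha> c))"

definition mono_pow :: "real^'d::finite \<Rightarrow> ('d \<Rightarrow> nat) \<Rightarrow> real" where
  "mono_pow x \<alpha> = (\<Prod>c\<in>UNIV. (x $ c) ^ (\<alpha> c))"

definition PP :: "nat \<Rightarrow> ('d::finite \<Rightarrow> nat) set" where
  "PP k = {\<alpha>. mi_deg \<alpha> \<le> k}"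

definition Mkd :: "nat \<Rightarrow> ('d::finite) itself \<Rightarrow> nat" where
  "Mkd k _ = (\<Sum>\<alpha>\<in>(PP k :: ('d \<Rightarrow> nat) set). mi_deg \<alpha>)"

definition partial_x :: "'d \<Rightarrow> (real^'d::finite \<Rightarrow> real^'d \<Rightarrow> real) \<Rightarrow> real^'d \<Rightarrow> real^'d \<Rightarrow> real" where
  "partial_x i f x y = deriv (\<lambda>t. f (x + t *\<^sub>R axis i 1) y) 0"

definition partial_y :: "'d \<Rightarrow> (real^'d::finite \<Rightarrow> real^'d \<Rightarrow> real) \<Rightarrow> real^'d \<Rightarrow> real^'d \<Rightarrow> real" where
  "partial_y i f x y = deriv (\<lambda>t. f x (y + t *\<^sub>R axis i 1)) 0"

fun dxs :: "'d list \<Rightarrow> (real^'d::finite \<Rightarrow> real^'d \<Rightarrow> real) \<Rightarrow> real^'d \<Rightarrow> real^'d \<Rightarrow> real" where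
  "dxs [] f = f"
| "dxs (i # L) f = partial_x i (dxs L f)"

fun dys :: "'d list \<Rightarrow> (real^'d::finite \<Rightarrow> real^'d \<Rightarrow> real) \<Rightarrow> real^'d \<Rightarrow> real^'d \<Rightarrow> real" where
  "dys [] f = f"
| "dys (i # L) f = partial_y i (dys L f)"

definition Dxy :: "'d list \<Rightarrow> 'd list \<Rightarrow> (real^'d::finite \<Rightarrow> real^'d \<Rightarrow> real) \<Rightarrow> real^'d \<Rightarrow> real^'d \<Rightarrow> real" where
  "Dxy Lx Ly K = dxs Lx (dys Ly K)"

text \<open>K in C^(m,m)(Omega x Omega): every partial derivative d_x^alpha d_y^beta K with
  |alpha|,|beta| <= m (computed along any ordering of the coordinate directions)
  exists on Omega x Omega and is continuous there.\<close>
definition Ckk :: "nat \<Rightarrow> (real^'d::finite) set \<Rightarrow> (real^'d \<Rightarrow> real^'d \<Rightarrow> real) \<Rightarrow> bool" where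
  "Ckk m \<Omega> K \<longleftrightarrow>
     (\<forall>Ly i. length Ly < m \<longrightarrow> (\<forall>x\<in>\<Omega>. \<forall>y\<in>\<Omega>.
         (\<lambda>t. dys Ly K x (y + t *\<^sub>R axis i 1)) differentiable (at 0))) \<and>
     (\<forall>Lx Ly i. length Lx < m \<and> length Ly \<le> m \<longrightarrow> (\<forall>x\<in>\<Omega>. \<forall>y\<in>\<Omega>.
         (\<lambda>t. Dxy Lx Ly K (x + t *\<^sub>R axis i 1) y) differentiable (at 0))) \<and>
     (\<forall>Lx Ly. length Lx \<le> m \<and> length Ly \<le> m \<longrightarrow>
         continuous_on (\<Omega> \<times> \<Omega>) (\<lambda>p. Dxy Lx Ly K (fst p) (snd p)))"

definition mi_list :: "('d::finite \<Rightarrow> nat) \<Rightarrow> 'd list" where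
  "mi_list \<alpha> = (SOME L. \<forall>c. count_list L c = \<alpha> c)"

definition Kderiv :: "(real^'d::finite \<Rightarrow> real^'d \<Rightarrow> real) \<Rightarrow> ('d \<Rightarrow> nat) \<Rightarrow> ('d \<Rightarrow> nat) \<Rightarrow> real^'d \<Rightarrow> real^'d \<Rightarrow> real" where
  "Kderiv K \<alpha> \<beta> = Dxy (mi_list \<alpha>) (mi_list \<beta>) K"

definition graded_enum :: "nat \<Rightarrow> (nat \<Rightarrow> ('d::finite \<Rightarrow> nat)) \<Rightarrow> bool" where
  "graded_enum k e \<longleftrightarrow> bij_betw e {..<card (PP k :: ('d \<Rightarrow> nat) set)} (PP k) \<and>
     (\<forall>i j. i < card (PP k :: ('d \<Rightarrow> nat) set) \<and> j < card (PP k :: ('d \<Rightarrow> nat) set) \<and>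
        mi_deg (e i) < mi_deg (e j) \<longrightarrow> i < j)"

definition Vmat :: "nat \<Rightarrow> (nat \<Rightarrow> real^'d::finite) \<Rightarrow> (nat \<Rightarrow> ('d \<Rightarrow> nat)) \<Rightarrow> nat \<Rightarrow> nat \<Rightarrow> real mat" where
  "Vmat n x e a b = mat n (b - a) (\<lambda>(i,j). mono_pow (x i) (e (a + j)))"

definition Wmat :: "(real^'d::finite \<Rightarrow> real^'d \<Rightarrow> real) \<Rightarrow> (nat \<Rightarrow> ('d \<Rightarrow> nat)) \<Rightarrow> nat \<Rightarrow> real mat" where
  "Wmat K e N = mat N N (\<lambda>(i,j). Kderiv K (e i) (e j) 0 0 / (mi_fact (e i) * mi_fact (e j)))"

definition Keps :: "(real^'d::finite \<Rightarrow> real^'d \<Rightarrow> real) \<Rightarrow> nat \<Rightarrow> (nat \<Rightarrow> real^'d) \<Rightarrow> real \<Rightarrow> real mat" where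
  "Keps K n x \<epsilon> = mat n n (\<lambda>(i,j). K (\<epsilon> *\<^sub>R x i) (\<epsilon> *\<^sub>R x j))"

definition psd_mat :: "real mat \<Rightarrow> bool" where
  "psd_mat A \<longleftrightarrow> A \<in> carrier_mat (dim_row A) (dim_row A) \<and> A\<^sup>T = A \<and>
     (\<forall>v \<in> carrier_vec (dim_row A). v \<bullet> (A *\<^sub>v v) \<ge> 0)"

definition eigs_desc :: "real mat \<Rightarrow> real list" where
  "eigs_desc A = rev (sorted_list_of_multiset (proots (char_poly A)))"

end

theory Submission
  imports Defs "HOL-Combinatorics.Multiset_Permutations"
begin

text \<open>
  Taylor expansion in both arguments writes the form \<open>v\<^sup>T K\<^sub>\<epsilon> w\<close> as a sum of terms
  \<open>\<epsilon>\<^bsup>|\<alpha>| + |\<beta>|\<^esup> (v\<^sup>T V)\<^sub>\<alpha> W\<^sub>\<alpha>\<^sub>\<beta> (V\<^sup>T w)\<^sub>\<beta>\<close>, plus remainders that gain a factor \<open>\<epsilon>\<^bsup>k+1\<^esup>\<close>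
  in at least one argument. Hence if \<open>v\<close> and \<open>w\<close> annihilate the monomials of degree below
  \<open>s\<close> and \<open>t\<close>, the form equals \<open>\<epsilon>\<^bsup>s+t\<^esup>\<close> times its part of bidegree \<open>(s, t)\<close>, up to a relative error
  \<open>O(\<epsilon>)\<close>. If a matrix \<open>T\<close> brings the Vandermonde matrix into staircase form, the rows of \<open>T\<close> annihilate
  monomials in this way, and every row and column of \<open>T K\<^sub>\<epsilon> T\<^sup>T\<close> can be rescaled by its own power of
  \<open>\<epsilon>\<close>; this gives the determinants, with no assumption on the rank of the Vandermonde matrix.
  The eigenvalue bounds follow from the same estimate on the diagonal
  \<open>v = w\<close> and the Courant-Fischer principle, because fewer than \<open>i + 1\<close> linear conditions
  force \<open>v\<close> to annihilate all monomials of degree below \<open>s\<close>.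
\<close>

text \<open>Both \<open>HOL-Analysis\<close> and \<open>Jordan_Normal_Form\<close> declare \<open>$\<close>; keeping only one reading at a time
  avoids an exponential number of parse trees.\<close>

no_notation Matrix.vec_index (infixl "$" 100)

section \<open>Iterated partial derivatives and Taylor expansion\<close>

text \<open>The hypothesis limits the order of differentiation separately in each argument, so
  Taylor polynomials are taken in one argument at a time. A remainder in one argument alone supplies
  \<epsilon>^(k+1), which beats \<open>t \<le> k\<close> but says nothing about \<open>s\<close>;
  the other argument has to keep its monomials, so that the moments of the vector there can still
  vanish. This is why the remainder is itself expanded a second time.

  Iterated derivatives come along words of directions. Words are kept as long as derivatives are
  taken, because a further derivative merely prefixes a letter; they are grouped into multi-indices
  only at the origin, where counting the words over \<alpha> produces the factor 1/\<alpha>! of the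
  Wronskian.

  In the rescaled limit, an entry of the transformed Vandermonde matrix survives only if the degree
  of its column equals the order assigned to its row. Deleting all others from a triangular matrix
  leaves the determinant unchanged, and so the full determinants of the Vandermonde matrix or of its
  triangular factor appear in the result, although only blocks on the diagonal contribute.\<close>

lemma mvt_from_0:
  fixes g g' :: "real \<Rightarrow> real"
  assumes "\<And>t. \<bar>t\<bar> \<le> \<bar>h\<bar> \<Longrightarrow> (g has_real_derivative g' t) (at t)"
  obtains \<eta> where "\<bar>\<eta>\<bar> \<le> \<bar>h\<bar>" "g h - g 0 = h * g' \<eta>"
proof -
  \<comment> \<open>Maclaurin's formula of order 1 treats both signs of \<open>h\<close>, and
    \<open>h = 0\<close>, in one statement.\<close>
  have "\<exists>t. \<bar>t\<bar> \<le> \<bar>h\<bar> \<and> g h = (\<Sum>m<1. (if m = (0::nat) then g else g') 0 / fact m * h ^ m)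
      + (if (1::nat) = 0 then g else g') t / fact 1 * h ^ 1"
    by (rule Maclaurin_bi_le) (use assms in auto)
  then show thesis using that by (auto simp: mult.commute)
qed

text \<open>Peano's form of Schwarz' theorem: only one mixed derivative is assumed to exist. This matters
  because \<open>Ckk\<close> only provides derivatives in which the \<open>y\<close>-directions come first.\<close>

lemma derivative_of_partial_derivative:
  fixes f fy c :: "real \<Rightarrow> real \<Rightarrow> real" and fx :: "real \<Rightarrow> real"
  assumes r: "r > 0"
    and fy: "\<And>s t. \<bar>s\<bar> < r \<Longrightarrow> \<bar>t\<bar> < r \<Longrightarrow> (f s has_real_derivative fy s t) (at t)"
    and fyx: "\<And>s t. \<bar>s\<bar> < r \<Longrightarrow> \<bar>t\<bar> < r \<Longrightarrow> ((\<lambda>s. fy s t) has_real_derivative c s t) (at s)"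
    and c: "isCont (\<lambda>p. c (fst p) (snd p)) (0, 0)"
    and fx: "\<And>t. \<bar>t\<bar> < r \<Longrightarrow> ((\<lambda>s. f s t) has_real_derivative fx t) (at 0)"
  shows "(fx has_real_derivative c 0 0) (at 0)"
proof -
  have "\<exists>d>0. \<forall>h. h \<noteq> 0 \<and> \<bar>h\<bar> < d \<longrightarrow> \<bar>(fx h - fx 0) / h - c 0 0\<bar> < e" if e: "e > 0" for e
  proof -
    from c have "\<forall>e>0. \<exists>d>0. \<forall>p. dist p (0, 0) < d \<longrightarrow> dist (c (fst p) (snd p)) (c 0 0) < e"
      by (simp add: continuous_at_eps_delta)
    with e obtain d0 where d0: "d0 > 0" "\<And>p. dist p (0, 0) < d0 \<Longrightarrow> dist (c (fst p) (snd p)) (c 0 0) < e / 2"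
      by (meson half_gt_zero)
    define d where "d = min r (d0 / 2)"
    have d: "d > 0" "d \<le> r" using r d0 by (auto simp: d_def)
    have cd: "\<bar>c s t - c 0 0\<bar> < e / 2" if "\<bar>s\<bar> < d" "\<bar>t\<bar> < d" for s t
    proof -
      have "dist (s, t) (0, 0) \<le> \<bar>s\<bar> + \<bar>t\<bar>"
        by (simp add: dist_Pair_Pair sqrt_sum_squares_le_sum_abs)
      also have "\<dots> < d0" using that by (auto simp: d_def)
      finally show ?thesis using d0(2)[of "(s, t)"] by (simp add: dist_real_def)
    qed
    have "\<bar>(fx h - fx 0) / h - c 0 0\<bar> < e" if h: "h \<noteq> 0" "\<bar>h\<bar> < d" for h
    proof -
      have hr: "\<bar>h\<bar> < r" using h d by simp
      \<comment> \<open>The second difference of \<open>f\<close> over the rectangle with corners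
        \<open>(0, 0)\<close> and \<open>(s, h)\<close> equals
        \<open>h * s * c \<xi> \<eta>\<close>, by the mean value theorem first in \<open>t\<close>
        and then in \<open>s\<close>. Only derivatives in this order occur, and the bound is uniform
        in \<open>s\<close>.\<close>
      have *: "\<bar>(f s h - f s 0 - (f 0 h - f 0 0)) / s - h * c 0 0\<bar> \<le> \<bar>h\<bar> * (e / 2)"
        if s: "s \<noteq> 0" "\<bar>s\<bar> < d" for s
      proof -
        have sr: "\<bar>s\<bar> < r" using s d by simp
        obtain \<eta> where \<eta>: "\<bar>\<eta>\<bar> \<le> \<bar>h\<bar>" "(f s h - f 0 h) - (f s 0 - f 0 0) = h * (fy s \<eta> - fy 0 \<eta>)"
          by (rule mvt_from_0[of h "\<lambda>u. f s u - f 0 u" "\<lambda>u. fy s u - fy 0 u"])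
            (use fy sr r hr in \<open>auto intro!: DERIV_diff\<close>)
        have \<eta>r: "\<bar>\<eta>\<bar> < r" using \<eta> hr by simp
        obtain \<xi> where \<xi>: "\<bar>\<xi>\<bar> \<le> \<bar>s\<bar>" "fy s \<eta> - fy 0 \<eta> = s * c \<xi> \<eta>"
          
          by (rule mvt_from_0[of s "\<lambda>s. fy s \<eta>" "\<lambda>s. c s \<eta>"]) (use fyx sr \<eta>r in auto)
        have "f s h - f s 0 - (f 0 h - f 0 0) = h * (s * c \<xi> \<eta>)" using \<eta>(2) \<xi>(2) by simp
        then have "(f s h - f s 0 - (f 0 h - f 0 0)) / s - h * c 0 0 = h * (c \<xi> \<eta> - c 0 0)"
          using s by (simp add: field_simps)
        then show ?thesis
          using cd[of \<xi> \<eta>] \<xi>(1) \<eta>(1) s h by (simp add: abs_mult mult_left_mono)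
      qed
      have "((\<lambda>s. f s h - f s 0) has_real_derivative (fx h - fx 0)) (at 0)"
        using fx[OF hr] fx[of 0] r by (intro DERIV_diff) auto
      then have "((\<lambda>s. (f s h - f s 0 - (f 0 h - f 0 0)) / s) \<longlongrightarrow> fx h - fx 0) (at 0)"
        by (simp add: DERIV_def)
      then have lim: "((\<lambda>s. \<bar>(f s h - f s 0 - (f 0 h - f 0 0)) / s - h * c 0 0\<bar>) \<longlongrightarrow> \<bar>fx h - fx 0 - h * c 0 0\<bar>) (at 0)"
        by (intro tendsto_intros)
      have ev: "\<forall>\<^sub>F s in at 0. \<bar>(f s h - f s 0 - (f 0 h - f 0 0)) / s - h * c 0 0\<bar> \<le> \<bar>h\<bar> * (e / 2)"
        unfolding eventually_at using * d by (auto intro!: exI[of _ d] simp: dist_real_def)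
      \<comment> \<open>\<open>s\<close> tends to 0 while \<open>h\<close> stays fixed: the
        quotients become values of \<open>fx\<close>, and the bound survives as a weak inequality.
        The half of \<open>e\<close> held in reserve makes it strict again.\<close>
      have "\<bar>fx h - fx 0 - h * c 0 0\<bar> \<le> \<bar>h\<bar> * (e / 2)"
        using tendsto_upperbound[OF lim ev] by simp
      moreover have "(fx h - fx 0) / h - c 0 0 = (fx h - fx 0 - h * c 0 0) / h"
        using h by (simp add: field_simps)
      ultimately have "\<bar>(fx h - fx 0) / h - c 0 0\<bar> \<le> e / 2"
        using h by (simp add: abs_divide field_simps)
      then show ?thesis using e by simp
    qed
    then show ?thesis using d by blast
  qed
  then show ?thesis by (simp add: DERIV_def LIM_eq)
qed

text \<open>\<open>D w\<close> stands for the iterated partial derivative along the word \<open>w\<close>, whose head is the derivative taken last.\<close>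

definition jet :: "nat \<Rightarrow> (real^'d::finite) set \<Rightarrow> ('d list \<Rightarrow> real^'d \<Rightarrow> real) \<Rightarrow> bool" where
  "jet m S D \<longleftrightarrow> (\<forall>w. length w \<le> m \<longrightarrow> continuous_on S (D w)) \<and>
    (\<forall>w i. \<forall>x\<in>S. length w < m \<longrightarrow>
       ((\<lambda>t. D w (x + t *\<^sub>R axis i 1)) has_real_derivative D (i # w) x) (at 0))"

section \<open>Jets: symmetry in the directions and directional derivatives\<close>

lemma derivative_along_line:
  fixes f f' :: "'a::real_normed_vector \<Rightarrow> real"
  assumes "\<And>x. x \<in> S \<Longrightarrow> ((\<lambda>t. f (x + t *\<^sub>R v)) has_real_derivative f' x) (at 0)"
    and "x + t *\<^sub>R v \<in> S"
  shows "((\<lambda>t. f (x + t *\<^sub>R v)) has_real_derivative f' (x + t *\<^sub>R v)) (at t)"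
  using assms(1)[OF assms(2)] DERIV_shift[of "\<lambda>t. f (x + t *\<^sub>R v)" _ 0 t]
  by (simp add: algebra_simps)

lemma jet_derivative:
  assumes "jet m S D" "length w < m" "x + t *\<^sub>R axis i 1 \<in> S"
  shows "((\<lambda>t. D w (x + t *\<^sub>R axis i 1)) has_real_derivative D (i # w) (x + t *\<^sub>R axis i 1)) (at t)"
  by (rule derivative_along_line[where S = S]) (use assms in \<open>auto simp: jet_def\<close>)

lemma open_contains_parallelogram:
  fixes x u v :: "'a::real_normed_vector"
  assumes "open S" "x \<in> S" "norm u \<le> 1" "norm v \<le> 1"
  obtains r where "r > 0" "\<And>s t. \<bar>s\<bar> < r \<Longrightarrow> \<bar>t\<bar> < r \<Longrightarrow> x + s *\<^sub>R u + t *\<^sub>R v \<in> S"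
proof -
  obtain e where e: "e > 0" "ball x e \<subseteq> S" using assms openE by blast
  have "x + s *\<^sub>R u + t *\<^sub>R v \<in> S" if "\<bar>s\<bar> < e/2" "\<bar>t\<bar> < e/2" for s t
  proof -
    have "dist x (x + s *\<^sub>R u + t *\<^sub>R v) = norm (s *\<^sub>R u + t *\<^sub>R v)"
      by (metis add.assoc add_diff_cancel_left' dist_commute dist_norm)
    also have "\<dots> \<le> \<bar>s\<bar> * norm u + \<bar>t\<bar> * norm v" by (metis norm_scaleR norm_triangle_ineq)
    also have "\<dots> \<le> \<bar>s\<bar> + \<bar>t\<bar>" using assms by (intro add_mono mult_left_le) auto
    also have "\<dots> < e" using that by simp
    finally show ?thesis using e by auto
  qed
  then show thesis using that[of "e/2"] e by simp
qed

text \<open>Peano's form of Schwarz' theorem shows that \<open>D (i # j # w)\<close> is the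
  derivative of \<open>D (i # w)\<close> in direction \<open>j\<close>; the jet property names the
  same derivative \<open>D (j # i # w)\<close>.\<close>

lemma jet_swap:
  assumes S: "open S" and D: "jet m S D" and w: "Suc (Suc (length w)) \<le> m" and x: "x \<in> S"
  shows "D (i # j # w) x = D (j # i # w) x"
proof -
  let ?p = "\<lambda>s t. x + s *\<^sub>R axis i 1 + t *\<^sub>R axis j (1::real)"
  obtain r where r: "r > 0" "\<And>s t. \<bar>s\<bar> < r \<Longrightarrow> \<bar>t\<bar> < r \<Longrightarrow> ?p s t \<in> S"
    using open_contains_parallelogram[OF S x, of "axis i 1" "axis j 1"] by auto
  have p_commute: "?p s t = x + t *\<^sub>R axis j 1 + s *\<^sub>R axis i 1" for s t by simp
  have "((\<lambda>t. D (i # w) (?p 0 t)) has_real_derivative D (i # j # w) (?p 0 0)) (at 0)"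
  proof (rule derivative_of_partial_derivative[OF r(1), where f = "\<lambda>s t. D w (?p s t)"
        and fy = "\<lambda>s t. D (j # w) (?p s t)" and c = "\<lambda>s t. D (i # j # w) (?p s t)"])
    fix s t :: real assume st: "\<bar>s\<bar> < r" "\<bar>t\<bar> < r"
    show "((\<lambda>t. D w (?p s t)) has_real_derivative D (j # w) (?p s t)) (at t)"
      using jet_derivative[OF D, of w "x + s *\<^sub>R axis i 1" t j] r(2)[OF st] w by simp
    show "((\<lambda>s. D (j # w) (?p s t)) has_real_derivative D (i # j # w) (?p s t)) (at s)"
      using jet_derivative[OF D, of "j # w" "x + t *\<^sub>R axis j 1" s i] r(2)[OF st] w
      unfolding p_commute by simp
  next
    fix t :: real assume t: "\<bar>t\<bar> < r"
    show "((\<lambda>s. D w (?p s t)) has_real_derivative D (i # w) (?p 0 t)) (at 0)"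
      using jet_derivative[OF D, of w "x + t *\<^sub>R axis j 1" 0 i] r(1) r(2)[of 0 t] t w
      unfolding p_commute by simp
  next
    have "continuous_on S (D (i # j # w))" using D w by (simp add: jet_def)
    then have "isCont (D (i # j # w)) x" using S x continuous_on_eq_continuous_at by blast
    then have "isCont (D (i # j # w)) (?p (fst (0::real, 0::real)) (snd (0::real, 0::real)))" by simp
    then show "isCont (\<lambda>q. D (i # j # w) (?p (fst q) (snd q))) (0, 0)"
      by (rule isCont_o2[rotated]) (intro continuous_intros)
  qed
  moreover have "((\<lambda>t. D (i # w) (?p 0 t)) has_real_derivative D (j # i # w) x) (at 0)"
    using jet_derivative[OF D, of "i # w" x 0 j] w x by simp
  ultimately show ?thesis using DERIV_unique by fastforce
qed

text \<open>A further derivative at \<open>x\<close> depends on values near \<open>x\<close>, so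
  equality must be known on all of the open set. For this reason the induction on permutations below
  leaves the point arbitrary.\<close>

lemma jet_Cons_cong:
  assumes S: "open S" and D: "jet m S D" and w: "length w < m" "length w' < m"
    and eq: "\<And>x. x \<in> S \<Longrightarrow> D w x = D w' x" and x: "x \<in> S"
  shows "D (i # w) x = D (i # w') x"
proof -
  obtain r where r: "r > 0" "\<And>s t. \<bar>s\<bar> < r \<Longrightarrow> \<bar>t\<bar> < r \<Longrightarrow> x + s *\<^sub>R axis i 1 + t *\<^sub>R axis i (1::real) \<in> S"
    using open_contains_parallelogram[OF S x, of "axis i 1" "axis i 1"] by auto
  have *: "((\<lambda>t. D w (x + t *\<^sub>R axis i 1)) has_real_derivative D (i # w) x) (at 0)"
    "((\<lambda>t. D w' (x + t *\<^sub>R axis i 1)) has_real_derivative D (i # w') x) (at 0)"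
    using D w x by (auto simp: jet_def)
  have "\<forall>\<^sub>F t in nhds (0::real). \<bar>t\<bar> < r"
    using r(1) eventually_nhds_metric[of "\<lambda>t. \<bar>t\<bar> < r" "0::real"] by (auto simp: dist_real_def)
  then have "\<forall>\<^sub>F t in nhds 0. D w (x + t *\<^sub>R axis i 1) = D w' (x + t *\<^sub>R axis i 1)"
  proof eventually_elim
    case (elim t)
    then show ?case using r(2)[of 0 t] r(1) eq by simp
  qed
  with *(1) have "((\<lambda>t. D w' (x + t *\<^sub>R axis i 1)) has_real_derivative D (i # w) x) (at 0)"
    by (subst (asm) DERIV_cong_ev[OF refl _ refl])
  with *(2) show ?thesis using DERIV_unique by blast
qed

text \<open>If the two heads differ, each tail contains the head of the other word. By induction on
  the length both tails can be rearranged to start with that letter and to continue with the same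
  \<open>u\<close>, which leaves a single swap.\<close>

lemma jet_perm:
  assumes S: "open S" and D: "jet m S D"
  shows "mset w = mset w' \<Longrightarrow> length w \<le> m \<Longrightarrow> x \<in> S \<Longrightarrow> D w x = D w' x"
proof (induction "length w" arbitrary: w w' x rule: less_induct)
  case less
  show ?case
  proof (cases w)
    case Nil
    then show ?thesis using less.prems by simp
  next
    case (Cons i v)
    from less.prems(1) have len: "length w = length w'" by (metis size_mset)
    then obtain j v' where w': "w' = j # v'" using Cons by (cases w') auto
    show ?thesis
    proof (cases "i = j")
      case True
      then have "mset v = mset v'" using less.prems w' Cons by simp
      then have "\<And>x. x \<in> S \<Longrightarrow> D v x = D v' x" using less.hyps[of v v'] less.prems Cons by simp
      then have "D (i # v) x = D (i # v') x"
        using jet_Cons_cong[OF S D, of v v'] less.prems len Cons w' by simp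
      then show ?thesis using Cons w' True by simp
    next
      case False
      from less.prems(1) have ms: "add_mset i (mset v) = add_mset j (mset v')" using Cons w' by simp
      then have "i \<in># mset v'" using False by (metis insert_noteq_member)
      then have i: "i \<in> set v'" by simp
      define u where "u = remove1 i v'"
      have v': "mset v' = mset (i # u)" using i by (simp add: u_def)
      then have v: "mset v = mset (j # u)" using ms by (simp add: add_mset_commute)
      have lu: "length v = Suc (length u)" "length v' = Suc (length u)"
        using v v' by (metis size_mset length_Cons)+
      have "D v y = D (j # u) y" if "y \<in> S" for y
        using less.hyps[of v "j # u" y] v less.prems Cons that by simp
      then have "D w x = D (i # j # u) x"
        using jet_Cons_cong[OF S D, of v "j # u"] less.prems lu Cons by simp
      also have "\<dots> = D (j # i # u) x"
        using jet_swap[OF S D] less.prems lu Cons by simp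
      also have "D v' y = D (i # u) y" if "y \<in> S" for y
        using less.hyps[of v' "i # u" y] v' less.prems len Cons w' that by simp
      then have "D (j # i # u) x = D w' x"
        using jet_Cons_cong[OF S D, of v' "i # u"] less.prems lu len Cons w' by simp
      finally show ?thesis .
    qed
  qed
qed

text \<open>The base point of the increment moves with \<open>t\<close>, so the derivative along
  \<open>v\<close> at \<open>z\<close> alone does not suffice. The mean value theorem expresses the
  increment by \<open>f'\<close> at a nearby point, and continuity of \<open>f'\<close> at
  \<open>z\<close> absorbs the displacement.\<close>

lemma derivative_of_increment_along_curve:
  fixes f f' :: "'a::real_normed_vector \<Rightarrow> real"
  assumes S: "open S" and z: "z \<in> S"
    and f: "\<And>x. x \<in> S \<Longrightarrow> ((\<lambda>t. f (x + t *\<^sub>R v)) has_real_derivative f' x) (at 0)"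
    and cont: "isCont f' z"
  shows "((\<lambda>t. f (z + t *\<^sub>R a + (t * c) *\<^sub>R v) - f (z + t *\<^sub>R a)) has_real_derivative c * f' z) (at 0)"
  unfolding DERIV_def LIM_eq
proof (intro allI impI)
  fix e :: real assume e: "e > 0"
  \<comment> \<open>Adding 1 here and in \<open>L\<close> keeps both divisors positive, also when
    \<open>c\<close>, \<open>a\<close> or \<open>v\<close> vanishes.\<close>
  define e' where "e' = e / (\<bar>c\<bar> + 1)"
  have e': "e' > 0" "(\<bar>c\<bar> + 1) * e' = e" using e by (simp_all add: e'_def)
  obtain d1 where d1: "d1 > 0" "ball z d1 \<subseteq> S" using S z openE by blast
  obtain d2 where d2: "d2 > 0" "\<And>y. dist y z < d2 \<Longrightarrow> \<bar>f' y - f' z\<bar> < e'"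
    using cont e' unfolding continuous_at_eps_delta dist_real_def by blast
  define L where "L = norm a + \<bar>c\<bar> * norm v + 1"
  have L: "L > 0" by (simp add: L_def add_nonneg_pos)
  define d where "d = min d1 d2 / L"
  have d: "d > 0" using d1 d2 L by (simp add: d_def)
  have "\<bar>(f (z + t *\<^sub>R a + (t * c) *\<^sub>R v) - f (z + t *\<^sub>R a)) / t - c * f' z\<bar> < e"
    if t: "t \<noteq> 0" "\<bar>t\<bar> < d" for t
  proof -
    have near: "dist (z + t *\<^sub>R a + \<theta> *\<^sub>R v) z < min d1 d2" if "\<bar>\<theta>\<bar> \<le> \<bar>t * c\<bar>" for \<theta>
    proof -
      have "dist (z + t *\<^sub>R a + \<theta> *\<^sub>R v) z = norm (t *\<^sub>R a + \<theta> *\<^sub>R v)"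
        by (metis add.assoc add_diff_cancel_left' dist_norm)
      also have "\<dots> \<le> \<bar>t\<bar> * norm a + \<bar>\<theta>\<bar> * norm v" by (metis norm_triangle_ineq norm_scaleR)
      also have "\<dots> \<le> \<bar>t\<bar> * norm a + \<bar>t * c\<bar> * norm v"
        using that by (intro add_left_mono mult_right_mono) auto
      also have "\<dots> \<le> \<bar>t\<bar> * L" by (simp add: L_def distrib_left abs_mult mult.assoc)
      also have "\<dots> < min d1 d2" using t(2) L unfolding d_def by (simp only: pos_less_divide_eq)
      finally show ?thesis .
    qed
    have der: "((\<lambda>\<theta>. f (z + t *\<^sub>R a + \<theta> *\<^sub>R v)) has_real_derivative f' (z + t *\<^sub>R a + \<theta> *\<^sub>R v)) (at \<theta>)"
      if "\<bar>\<theta>\<bar> \<le> \<bar>t * c\<bar>" for \<theta>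
    proof (rule derivative_along_line[OF f])
      show "z + t *\<^sub>R a + \<theta> *\<^sub>R v \<in> S"
        using near[OF that] d1(2) by (simp add: dist_commute subset_iff)
    qed
    obtain \<theta> where \<theta>: "\<bar>\<theta>\<bar> \<le> \<bar>t * c\<bar>"
      "f (z + t *\<^sub>R a + (t * c) *\<^sub>R v) - f (z + t *\<^sub>R a + 0 *\<^sub>R v) = t * c * f' (z + t *\<^sub>R a + \<theta> *\<^sub>R v)"
      using mvt_from_0[OF der] by metis
    let ?y = "z + t *\<^sub>R a + \<theta> *\<^sub>R v"
    have "(f (z + t *\<^sub>R a + (t * c) *\<^sub>R v) - f (z + t *\<^sub>R a)) / t - c * f' z = c * (f' ?y - f' z)"
      using \<theta>(2) t(1) by (simp add: right_diff_distrib)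
    then have "\<bar>(f (z + t *\<^sub>R a + (t * c) *\<^sub>R v) - f (z + t *\<^sub>R a)) / t - c * f' z\<bar> = \<bar>c\<bar> * \<bar>f' ?y - f' z\<bar>"
      by (simp only: abs_mult)
    also have "\<dots> \<le> \<bar>c\<bar> * e'" using d2(2)[of ?y] near[OF \<theta>(1)] by (intro mult_left_mono) auto
    also have "\<dots> < (\<bar>c\<bar> + 1) * e'" using e'(1) by simp
    also have "\<dots> = e" by (rule e')
    finally show ?thesis .
  qed
  then show "\<exists>s>0. \<forall>t. t \<noteq> 0 \<and> norm (t - 0) < s \<longrightarrow>
     norm ((f (z + (0 + t) *\<^sub>R a + ((0 + t) * c) *\<^sub>R v) - f (z + (0 + t) *\<^sub>R a) -
       (f (z + 0 *\<^sub>R a + (0 * c) *\<^sub>R v) - f (z + 0 *\<^sub>R a))) / t - c * f' z) < e"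
    using d by (intro exI[of _ d]) simp
qed

text \<open>The direction \<open>u\<close> is built up one coordinate at a time; each new coordinate
  contributes an increment whose base point already moves along the partial sum.\<close>

lemma jet_directional_derivative:
  assumes S: "open S" and D: "jet m S D" and w: "length w < m" and z: "z \<in> S"
  shows "((\<lambda>t. D w (z + t *\<^sub>R u)) has_real_derivative (\<Sum>i\<in>UNIV. u $ i * D (i # w) z)) (at 0)"
proof -
  have "((\<lambda>t. D w (z + t *\<^sub>R (\<Sum>i\<in>A. (u $ i) *\<^sub>R axis i 1))) has_real_derivative
      (\<Sum>i\<in>A. u $ i * D (i # w) z)) (at 0)" if "finite A" for A
    using that
  proof (induction A)
    case empty
    show ?case by simp
  next
    case (insert i A)
    let ?a = "\<Sum>i\<in>A. (u $ i) *\<^sub>R axis i (1::real)"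
    have cont: "isCont (D (i # w)) z"
      using D w continuous_on_eq_continuous_at[OF S, of "D (i # w)"] z by (simp add: jet_def)
    have "((\<lambda>t. D w (z + t *\<^sub>R ?a + (t * u $ i) *\<^sub>R axis i 1) - D w (z + t *\<^sub>R ?a))
        has_real_derivative u $ i * D (i # w) z) (at 0)"
      by (rule derivative_of_increment_along_curve[OF S z _ cont]) (use D w in \<open>simp add: jet_def\<close>)
    from DERIV_add[OF this insert.IH]
    have "((\<lambda>t. D w (z + t *\<^sub>R ?a + (t * u $ i) *\<^sub>R axis i 1)) has_real_derivative
        u $ i * D (i # w) z + (\<Sum>i\<in>A. u $ i * D (i # w) z)) (at 0)"
      by (simp only: diff_add_cancel)
    moreover have "z + t *\<^sub>R ?a + (t * u $ i) *\<^sub>R axis i 1 =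
        z + t *\<^sub>R (\<Sum>i\<in>insert i A. (u $ i) *\<^sub>R axis i 1)" for t
      using insert.hyps by (simp add: scaleR_add_right add.assoc add.commute add.left_commute)
    ultimately show ?case using insert.hyps by simp
  qed
  from this[of UNIV] show ?thesis
    using basis_expansion[of u] by (simp only: scalar_mult_eq_scaleR finite_class.finite_UNIV simp_thms)
qed

section \<open>Words, multi-indices and multinomial counting\<close>

lemma finite_words: "finite {w :: 'd::finite list. length w = m}"
  using finite_lists_length_eq[of "UNIV :: 'd set" m] by simp

lemma mi_deg_count_list: "mi_deg (count_list w) = length w"
  unfolding mi_deg_def by (rule sum_count_set) auto

lemma mono_pow_count_list: "mono_pow u (count_list w) = (\<Prod>i\<leftarrow>w. u $ i)"
proof (induction w)
  case Nil
  show ?case by (simp add: mono_pow_def)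
next
  case (Cons i w)
  have "mono_pow u (count_list (i # w)) = (\<Prod>c\<in>UNIV. (if c = i then u $ c else 1) * (u $ c) ^ count_list w c)"
    unfolding mono_pow_def by (intro prod.cong) auto
  then show ?case using Cons by (simp add: prod.distrib mono_pow_def)
qed

text \<open>On a finite type every function into the naturals is a multiplicity function, so the
  choice behind \<open>mi_list\<close> picks an actual word.\<close>

lemma count_list_mi_list: "count_list (mi_list \<alpha>) = \<alpha>"
proof -
  obtain w where "mset w = Abs_multiset \<alpha>" using ex_mset by blast
  then have "count (mset w) = \<alpha>" by (simp add: Abs_multiset_inverse)
  then have "\<forall>c. count_list w c = \<alpha> c" by (metis count_mset)
  then show ?thesis unfolding mi_list_def by (rule someI2) auto
qed

lemma length_mi_list: "length (mi_list \<alpha>) = mi_deg \<alpha>"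
  by (metis mi_deg_count_list count_list_mi_list)

lemma mi_fact_pos: "mi_fact \<alpha> > 0"
  unfolding mi_fact_def by (intro prod_pos) auto

lemma PP_eq_count_list: "PP k = count_list ` {w :: 'd::finite list. length w \<le> k}"
proof -
  have "\<alpha> \<in> count_list ` {w :: 'd list. length w \<le> k}" if "mi_deg \<alpha> \<le> k" for \<alpha> :: "'d \<Rightarrow> nat"
    using that by (intro image_eqI[of _ _ "mi_list \<alpha>"]) (simp_all add: count_list_mi_list length_mi_list)
  then show ?thesis by (auto simp: PP_def mi_deg_count_list)
qed

lemma finite_PP: "finite (PP k :: ('d::finite \<Rightarrow> nat) set)"
  unfolding PP_eq_count_list using finite_lists_length_le[of "UNIV :: 'd set" k] by simp

lemma mset_eq_iff_count_list: "mset w = mset w' \<longleftrightarrow> count_list w = count_list w'"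
  by (auto simp: multiset_eq_iff count_mset fun_eq_iff)

text \<open>The multinomial coefficient |\<alpha>|! / \<alpha>!, multiplied out so that the count of
  permutations of a multiset applies directly.\<close>

lemma card_words_of_content:
  "real (card {w. count_list w = \<alpha>}) * mi_fact \<alpha> = fact (mi_deg \<alpha>)"
proof -
  let ?A = "mset (mi_list \<alpha>)"
  have w: "{w. count_list w = \<alpha>} = permutations_of_multiset ?A"
    by (auto simp: permutations_of_multiset_def mset_eq_iff_count_list count_list_mi_list)
  have c: "count ?A x = \<alpha> x" for x by (metis count_mset count_list_mi_list)
  have "mi_fact \<alpha> = (\<Prod>x\<in>set_mset ?A. fact (\<alpha> x))"
    unfolding mi_fact_def
  proof (rule prod.mono_neutral_right)
    show "\<forall>x\<in>UNIV - set_mset ?A. fact (\<alpha> x) = 1"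
      using c by (metis DiffD2 not_in_iff fact_0)
  qed simp_all
  also have "\<dots> = real (\<Prod>x\<in>set_mset ?A. fact (count ?A x))" by (simp add: c del: set_mset_mset)
  finally show ?thesis
    using arg_cong[OF card_permutations_of_multiset_aux[of ?A], of real]
    by (simp add: w length_mi_list del: set_mset_mset)
qed

text \<open>Differentiation along a line yields a sum over words with weight 1/m!. The |\<alpha>|! /
  \<alpha>! words over each \<alpha> have equal terms, and collecting them turns 1/m! into
  1/\<alpha>!.\<close>

lemma sum_words_eq_sum_multi_indices:
  fixes D :: "'d::finite list \<Rightarrow> real"
  assumes "\<And>w w'. length w = m \<Longrightarrow> mset w = mset w' \<Longrightarrow> D w = D w'"
  shows "(\<Sum>w | length w = m. (\<Prod>i\<leftarrow>w. u $ i) * D w) / fact m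
    = (\<Sum>\<alpha> | mi_deg \<alpha> = m. mono_pow u \<alpha> / mi_fact \<alpha> * D (mi_list \<alpha>))"
proof -
  have fin: "finite {\<alpha> :: 'd \<Rightarrow> nat. mi_deg \<alpha> = m}"
    by (rule finite_subset[OF _ finite_PP[of m]]) (auto simp: PP_def)
  have "(\<Sum>w | length w = m. (\<Prod>i\<leftarrow>w. u $ i) * D w)
      = (\<Sum>\<alpha> | mi_deg \<alpha> = m. \<Sum>w | w \<in> {w. length w = m} \<and> count_list w = \<alpha>. (\<Prod>i\<leftarrow>w. u $ i) * D w)"
    by (rule sum.group[symmetric]) (auto simp: finite_words fin mi_deg_count_list)
  also have "\<dots> = (\<Sum>\<alpha> | mi_deg \<alpha> = m. fact m * (mono_pow u \<alpha> / mi_fact \<alpha> * D (mi_list \<alpha>)))"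
  proof (rule sum.cong[OF refl])
    fix \<alpha> :: "'d \<Rightarrow> nat" assume "\<alpha> \<in> {\<alpha>. mi_deg \<alpha> = m}"
    then have \<alpha>: "mi_deg \<alpha> = m" by simp
    have set: "{w. w \<in> {w. length w = m} \<and> count_list w = \<alpha>} = {w. count_list w = \<alpha>}"
      using \<alpha> by (auto simp flip: mi_deg_count_list)
    have "(\<Sum>w | w \<in> {w. length w = m} \<and> count_list w = \<alpha>. (\<Prod>i\<leftarrow>w. u $ i) * D w)
        = (\<Sum>w | count_list w = \<alpha>. mono_pow u \<alpha> * D (mi_list \<alpha>))"
      unfolding set
    proof (rule sum.cong[OF refl])
      fix w assume "w \<in> {w. count_list w = \<alpha>}"
      then have w: "count_list w = \<alpha>" by simp
      then have "length w = m" using \<alpha> by (metis mi_deg_count_list)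
      moreover have "mset w = mset (mi_list \<alpha>)" by (simp add: mset_eq_iff_count_list w count_list_mi_list)
      ultimately have "D w = D (mi_list \<alpha>)" by (rule assms)
      then show "(\<Prod>i\<leftarrow>w. u $ i) * D w = mono_pow u \<alpha> * D (mi_list \<alpha>)"
        using mono_pow_count_list[of u w] w by simp
    qed
    also have "\<dots> = real (card {w. count_list w = \<alpha>}) * (mono_pow u \<alpha> * D (mi_list \<alpha>))" by simp
    also have "real (card {w. count_list w = \<alpha>}) = fact m / mi_fact \<alpha>"
      using card_words_of_content[of \<alpha>] mi_fact_pos[of \<alpha>] \<alpha> by (simp add: field_simps)
    finally show "(\<Sum>w | w \<in> {w. length w = m} \<and> count_list w = \<alpha>. (\<Prod>i\<leftarrow>w. u $ i) * D w)
        = fact m * (mono_pow u \<alpha> / mi_fact \<alpha> * D (mi_list \<alpha>))"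
      by simp
  qed
  finally show ?thesis by (simp only: sum_distrib_left[symmetric] nonzero_mult_div_cancel_left[OF fact_nonzero])
qed

text \<open>Restriction to a segment through 0 reduces this to Maclaurin's formula in one variable.
  The bound \<open>B\<close> concerns the top derivatives on that segment only and may depend on
  \<epsilon>; this permits a later application to a jet that is itself of size
  \<epsilon>^(k+1).\<close>

lemma jet_Taylor:
  fixes D :: "'d::finite list \<Rightarrow> real^'d \<Rightarrow> real"
  assumes S: "open S" and D: "jet (Suc k) S D"
    and seg: "\<And>\<theta>. \<bar>\<theta>\<bar> \<le> \<bar>\<epsilon>\<bar> \<Longrightarrow> \<theta> *\<^sub>R u \<in> S"
    and B: "\<And>w \<theta>. length w = Suc k \<Longrightarrow> \<bar>\<theta>\<bar> \<le> \<bar>\<epsilon>\<bar> \<Longrightarrow> \<bar>D w (\<theta> *\<^sub>R u)\<bar> \<le> B"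
  shows "\<bar>D [] (\<epsilon> *\<^sub>R u) - (\<Sum>\<alpha>\<in>PP k. \<epsilon> ^ mi_deg \<alpha> * mono_pow u \<alpha> / mi_fact \<alpha> * D (mi_list \<alpha>) 0)\<bar>
    \<le> (\<Sum>w | length w = Suc k. \<bar>\<Prod>i\<leftarrow>w. u $ i\<bar>) * B * \<bar>\<epsilon>\<bar> ^ Suc k"
proof -
  \<comment> \<open>\<open>\<phi> m\<close> is the m-th derivative of
    \<open>\<lambda>s. D [] (s *\<^sub>R u)\<close>. As a sum over words it passes to the next order
    by prefixing one letter, without binomial coefficients.\<close>
  define \<phi> where "\<phi> m s = (\<Sum>w | length w = m. (\<Prod>i\<leftarrow>w. u $ i) * D w (s *\<^sub>R u))" for m s
  have \<phi>: "(\<phi> m has_real_derivative \<phi> (Suc m) s) (at s)" if m: "m < Suc k" and s: "\<bar>s\<bar> \<le> \<bar>\<epsilon>\<bar>" for m s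
  proof -
    have "((\<lambda>t. D w (0 + t *\<^sub>R u)) has_real_derivative (\<Sum>i\<in>UNIV. u $ i * D (i # w) (0 + s *\<^sub>R u))) (at s)"
      if "length w = m" for w
    proof (rule derivative_along_line[where f' = "\<lambda>x. \<Sum>i\<in>UNIV. u $ i * D (i # w) x"])
      show "0 + s *\<^sub>R u \<in> S" using seg[OF s] by simp
    qed (rule jet_directional_derivative[OF S D], use m that in auto)
    then have "((\<lambda>s. \<Sum>w | length w = m. (\<Prod>i\<leftarrow>w. u $ i) * D w (s *\<^sub>R u)) has_real_derivative
        (\<Sum>w | length w = m. (\<Prod>i\<leftarrow>w. u $ i) * (\<Sum>i\<in>UNIV. u $ i * D (i # w) (s *\<^sub>R u)))) (at s)"
      by (intro DERIV_sum DERIV_cmult) auto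
    moreover have "\<phi> (Suc m) s = (\<Sum>w | length w = m. (\<Prod>i\<leftarrow>w. u $ i) * (\<Sum>i\<in>UNIV. u $ i * D (i # w) (s *\<^sub>R u)))"
    proof -
      have "\<phi> (Suc m) s = (\<Sum>w\<in>(\<lambda>(w, i). i # w) ` ({w. length w = m} \<times> UNIV). (\<Prod>i\<leftarrow>w. u $ i) * D w (s *\<^sub>R u))"
        unfolding \<phi>_def by (rule sum.cong) (auto simp: length_Suc_conv image_iff)
      also have "\<dots> = (\<Sum>(w, i)\<in>{w. length w = m} \<times> UNIV. (\<Prod>i\<leftarrow>w. u $ i) * (u $ i * D (i # w) (s *\<^sub>R u)))"
        by (subst sum.reindex) (auto simp: inj_on_def case_prod_beta mult_ac intro!: sum.cong)
      also have "\<dots> = (\<Sum>w | length w = m. \<Sum>i\<in>UNIV. (\<Prod>i\<leftarrow>w. u $ i) * (u $ i * D (i # w) (s *\<^sub>R u)))"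
        by (simp add: sum.cartesian_product)
      finally show ?thesis by (simp add: sum_distrib_left)
    qed
    ultimately show ?thesis unfolding \<phi>_def by simp
  qed
  have "\<exists>t. \<bar>t\<bar> \<le> \<bar>\<epsilon>\<bar> \<and> \<phi> 0 \<epsilon> = (\<Sum>m<Suc k. \<phi> m 0 / fact m * \<epsilon> ^ m) + \<phi> (Suc k) t / fact (Suc k) * \<epsilon> ^ Suc k"
    using \<phi> by (intro Maclaurin_bi_le) auto
  then obtain t where t: "\<bar>t\<bar> \<le> \<bar>\<epsilon>\<bar>"
    "\<phi> 0 \<epsilon> = (\<Sum>m<Suc k. \<phi> m 0 / fact m * \<epsilon> ^ m) + \<phi> (Suc k) t / fact (Suc k) * \<epsilon> ^ Suc k" by blast
  have 0: "0 \<in> S" using seg[of 0] by simp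
  have "(\<Sum>m<Suc k. \<phi> m 0 / fact m * \<epsilon> ^ m)
      = (\<Sum>m<Suc k. \<Sum>\<alpha> | \<alpha> \<in> PP k \<and> mi_deg \<alpha> = m. \<epsilon> ^ mi_deg \<alpha> * mono_pow u \<alpha> / mi_fact \<alpha> * D (mi_list \<alpha>) 0)"
  proof (rule sum.cong[OF refl])
    fix m assume "m \<in> {..<Suc k}"
    then have m: "m \<le> k" by simp
    \<comment> \<open>Here symmetry of the derivatives enters, and only at the origin.\<close>
    have "\<phi> m 0 / fact m = (\<Sum>\<alpha> | mi_deg \<alpha> = m. mono_pow u \<alpha> / mi_fact \<alpha> * D (mi_list \<alpha>) 0)"
      unfolding \<phi>_def scaleR_zero_left
      by (rule sum_words_eq_sum_multi_indices) (rule jet_perm[OF S D], use m 0 in auto)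
    moreover have "{\<alpha> :: 'd \<Rightarrow> nat. mi_deg \<alpha> = m} = {\<alpha>. \<alpha> \<in> PP k \<and> mi_deg \<alpha> = m}" using m by (auto simp: PP_def)
    ultimately have "\<phi> m 0 / fact m * \<epsilon> ^ m
        = (\<Sum>\<alpha> | \<alpha> \<in> PP k \<and> mi_deg \<alpha> = m. mono_pow u \<alpha> / mi_fact \<alpha> * D (mi_list \<alpha>) 0 * \<epsilon> ^ m)"
      by (simp only: sum_distrib_right)
    also have "\<dots> = (\<Sum>\<alpha> | \<alpha> \<in> PP k \<and> mi_deg \<alpha> = m. \<epsilon> ^ mi_deg \<alpha> * mono_pow u \<alpha> / mi_fact \<alpha> * D (mi_list \<alpha>) 0)"
      by (rule sum.cong) auto
    finally show "\<phi> m 0 / fact m * \<epsilon> ^ m = \<dots>" .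
  qed
  also have "\<dots> = (\<Sum>\<alpha>\<in>PP k. \<epsilon> ^ mi_deg \<alpha> * mono_pow u \<alpha> / mi_fact \<alpha> * D (mi_list \<alpha>) 0)"
    by (rule sum.group) (auto simp: finite_PP[unfolded PP_def] PP_def)
  finally have sum: "(\<Sum>m<Suc k. \<phi> m 0 / fact m * \<epsilon> ^ m)
      = (\<Sum>\<alpha>\<in>PP k. \<epsilon> ^ mi_deg \<alpha> * mono_pow u \<alpha> / mi_fact \<alpha> * D (mi_list \<alpha>) 0)" .
  have "\<phi> 0 \<epsilon> = D [] (\<epsilon> *\<^sub>R u)" by (simp add: \<phi>_def)
  then have eq: "D [] (\<epsilon> *\<^sub>R u) - (\<Sum>\<alpha>\<in>PP k. \<epsilon> ^ mi_deg \<alpha> * mono_pow u \<alpha> / mi_fact \<alpha> * D (mi_list \<alpha>) 0)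
      = \<phi> (Suc k) t / fact (Suc k) * \<epsilon> ^ Suc k"
    using t(2) sum by linarith
  have "\<bar>\<phi> (Suc k) t\<bar> \<le> (\<Sum>w | length w = Suc k. \<bar>\<Prod>i\<leftarrow>w. u $ i\<bar> * B)"
    unfolding \<phi>_def by (rule sum_abs[THEN order_trans], rule sum_mono) (use B[OF _ t(1)] in \<open>simp add: abs_mult mult_left_mono\<close>)
  also have "\<dots> = (\<Sum>w | length w = Suc k. \<bar>\<Prod>i\<leftarrow>w. u $ i\<bar>) * B" by (simp add: sum_distrib_right)
  finally have bound: "\<bar>\<phi> (Suc k) t\<bar> \<le> (\<Sum>w | length w = Suc k. \<bar>\<Prod>i\<leftarrow>w. u $ i\<bar>) * B" .
  \<comment> \<open>The factor 1/(k+1)! of the remainder is given away to keep the bound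
    short.\<close>
  have "\<bar>\<phi> (Suc k) t\<bar> / fact (Suc k) \<le> \<bar>\<phi> (Suc k) t\<bar> / 1"
    by (rule divide_left_mono) (use fact_ge_1[of "Suc k"] in \<open>auto simp del: fact_Suc\<close>)
  with bound have "\<bar>\<phi> (Suc k) t\<bar> / fact (Suc k) \<le> (\<Sum>w | length w = Suc k. \<bar>\<Prod>i\<leftarrow>w. u $ i\<bar>) * B" by linarith
  then have "\<bar>\<phi> (Suc k) t\<bar> / fact (Suc k) * \<bar>\<epsilon>\<bar> ^ Suc k
      \<le> (\<Sum>w | length w = Suc k. \<bar>\<Prod>i\<leftarrow>w. u $ i\<bar>) * B * \<bar>\<epsilon>\<bar> ^ Suc k"
    by (rule mult_right_mono) simp
  then show ?thesis unfolding eq by (simp add: abs_mult power_abs del: fact_Suc power_Suc)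
qed

section \<open>Expansion of the kernel\<close>

lemma mi_fact_ge_1: "mi_fact \<alpha> \<ge> 1"
  unfolding mi_fact_def by (intro prod_ge_1) (simp add: fact_ge_1)

section \<open>Regularity of the kernel in each argument\<close>

lemma Ckk_continuous:
  assumes "Ckk m \<Omega> K" "length w \<le> m" "length w' \<le> m"
  shows "continuous_on (\<Omega> \<times> \<Omega>) (\<lambda>p. Dxy w w' K (fst p) (snd p))"
  using assms unfolding Ckk_def by blast

lemma Ckk_derivative_x:
  assumes "Ckk m \<Omega> K" "length w < m" "length w' \<le> m" "x \<in> \<Omega>" "y \<in> \<Omega>"
  shows "((\<lambda>t. Dxy w w' K (x + t *\<^sub>R axis i 1) y) has_real_derivative Dxy (i # w) w' K x y) (at 0)"
proof -
  have "(\<lambda>t. Dxy w w' K (x + t *\<^sub>R axis i 1) y) differentiable (at 0)"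
    using assms unfolding Ckk_def by blast
  then have "(\<lambda>t. Dxy w w' K (x + t *\<^sub>R axis i 1) y) field_differentiable (at 0)"
    by (simp add: real_differentiable_def field_differentiable_def)
  then show ?thesis
    using DERIV_deriv_iff_field_differentiable by (fastforce simp: Dxy_def partial_x_def)
qed

lemma open_times_isCont:
  fixes F :: "'a::real_normed_vector \<Rightarrow> 'b::real_normed_vector \<Rightarrow> real"
  assumes "open S" "continuous_on (S \<times> S') (\<lambda>p. F (fst p) (snd p))" "open S'" "x \<in> S" "y \<in> S'"
  shows "isCont (\<lambda>p. F (x + fst p *\<^sub>R u) (y + snd p *\<^sub>R v)) (0 :: real \<times> real)"
proof -
  let ?g = "\<lambda>p :: real \<times> real. (x + fst p *\<^sub>R u, y + snd p *\<^sub>R v)"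
  have "isCont (\<lambda>p. F (fst p) (snd p)) (?g 0)"
    using assms continuous_on_eq_continuous_at[OF open_Times[OF assms(1,3)]] by auto
  then have "isCont (\<lambda>q. (\<lambda>p. F (fst p) (snd p)) (?g q)) 0"
    by (rule isCont_o2[rotated]) (intro continuous_intros)
  then show ?thesis by simp
qed

lemma open_contains_segment:
  fixes x v :: "'a::real_normed_vector"
  assumes "open S" "x \<in> S"
  obtains r where "r > 0" "\<And>t. \<bar>t\<bar> < r \<Longrightarrow> x + t *\<^sub>R v \<in> S"
proof -
  have "((\<lambda>t. x + t *\<^sub>R v) \<longlongrightarrow> x + 0 *\<^sub>R v) (at (0::real))" by (intro tendsto_intros)
  then have "\<forall>\<^sub>F t in at (0::real). x + t *\<^sub>R v \<in> S"
    using assms by (auto dest: topological_tendstoD)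
  then obtain r where r: "r > 0" "\<And>t. t \<noteq> 0 \<Longrightarrow> \<bar>t\<bar> < r \<Longrightarrow> x + t *\<^sub>R v \<in> S"
    by (auto simp: eventually_at dist_real_def)
  have "x + t *\<^sub>R v \<in> S" if "\<bar>t\<bar> < r" for t using r(2)[of t] that assms by (cases "t = 0") auto
  with r(1) show thesis by (rule that)
qed

text \<open>\<open>Ckk\<close> places all x-derivatives outside the y-derivatives, so a y-derivative
  of \<open>Dxy w w' K\<close> is immediate only for \<open>w = []\<close>. Each letter prefixed to
  \<open>w\<close> carries the claim along by Peano's form of Schwarz' theorem, with y as the
  direction that is differentiated first.\<close>

lemma Ckk_derivative_y:
  assumes \<Omega>: "open \<Omega>" and K: "Ckk m \<Omega> K" and w': "length w' < m"
  shows "length w \<le> m \<Longrightarrow> x \<in> \<Omega> \<Longrightarrow> y \<in> \<Omega> \<Longrightarrow>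
    ((\<lambda>t. Dxy w w' K x (y + t *\<^sub>R axis i 1)) has_real_derivative Dxy w (i # w') K x y) (at 0)"
proof (induction w arbitrary: x y)
  case Nil
  have "(\<lambda>t. dys w' K x (y + t *\<^sub>R axis i 1)) differentiable (at 0)"
    using Nil K w' unfolding Ckk_def by blast
  then have "(\<lambda>t. dys w' K x (y + t *\<^sub>R axis i 1)) field_differentiable (at 0)"
    by (simp add: real_differentiable_def field_differentiable_def)
  then show ?case
    using DERIV_deriv_iff_field_differentiable by (fastforce simp: Dxy_def partial_y_def)
next
  case (Cons j w)
  obtain r1 where r1: "r1 > 0" "\<And>s. \<bar>s\<bar> < r1 \<Longrightarrow> x + s *\<^sub>R axis j 1 \<in> \<Omega>"
    using open_contains_segment[OF \<Omega> Cons.prems(2)] by blast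
  obtain r2 where r2: "r2 > 0" "\<And>t. \<bar>t\<bar> < r2 \<Longrightarrow> y + t *\<^sub>R axis i 1 \<in> \<Omega>"
    using open_contains_segment[OF \<Omega> Cons.prems(3)] by blast
  let ?r = "min r1 r2"
  have "((\<lambda>t. Dxy (j # w) w' K x (y + t *\<^sub>R axis i 1)) has_real_derivative
      Dxy (j # w) (i # w') K (x + 0 *\<^sub>R axis j 1) (y + 0 *\<^sub>R axis i 1)) (at 0)"
  proof (rule derivative_of_partial_derivative[where r = ?r
        and f = "\<lambda>s t. Dxy w w' K (x + s *\<^sub>R axis j 1) (y + t *\<^sub>R axis i 1)"
        and fy = "\<lambda>s t. Dxy w (i # w') K (x + s *\<^sub>R axis j 1) (y + t *\<^sub>R axis i 1)"
        and c = "\<lambda>s t. Dxy (j # w) (i # w') K (x + s *\<^sub>R axis j 1) (y + t *\<^sub>R axis i 1)"])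
    show "?r > 0" using r1 r2 by simp
  next
    fix s t :: real assume st: "\<bar>s\<bar> < ?r" "\<bar>t\<bar> < ?r"
    then have \<Omega>st: "x + s *\<^sub>R axis j 1 \<in> \<Omega>" "y + t *\<^sub>R axis i 1 \<in> \<Omega>" using r1 r2 by auto
    show "((\<lambda>t. Dxy w w' K (x + s *\<^sub>R axis j 1) (y + t *\<^sub>R axis i 1)) has_real_derivative
        Dxy w (i # w') K (x + s *\<^sub>R axis j 1) (y + t *\<^sub>R axis i 1)) (at t)"
      by (rule derivative_along_line[where S = \<Omega>]) (use Cons.IH Cons.prems \<Omega>st in auto)
    show "((\<lambda>s. Dxy w (i # w') K (x + s *\<^sub>R axis j 1) (y + t *\<^sub>R axis i 1)) has_real_derivative
        Dxy (j # w) (i # w') K (x + s *\<^sub>R axis j 1) (y + t *\<^sub>R axis i 1)) (at s)"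
      by (rule derivative_along_line[where S = \<Omega> and f = "\<lambda>x. Dxy w (i # w') K x (y + t *\<^sub>R axis i 1)"
            and f' = "\<lambda>x. Dxy (j # w) (i # w') K x (y + t *\<^sub>R axis i 1)"])
        (use Ckk_derivative_x[OF K, of w "i # w'"] Cons.prems w' \<Omega>st in auto)
  next
    fix t :: real assume "\<bar>t\<bar> < ?r"
    then have "y + t *\<^sub>R axis i 1 \<in> \<Omega>" using r2 by auto
    then show "((\<lambda>s. Dxy w w' K (x + s *\<^sub>R axis j 1) (y + t *\<^sub>R axis i 1)) has_real_derivative
        Dxy (j # w) w' K x (y + t *\<^sub>R axis i 1)) (at 0)"
      using Ckk_derivative_x[OF K, of w w'] Cons.prems w' by simp
  next
    have "continuous_on (\<Omega> \<times> \<Omega>) (\<lambda>p. Dxy (j # w) (i # w') K (fst p) (snd p))"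
      using Ckk_continuous[OF K, of "j # w" "i # w'"] Cons.prems w' by simp
    from open_times_isCont[OF \<Omega> this \<Omega> Cons.prems(2,3)]
    show "isCont (\<lambda>p. Dxy (j # w) (i # w') K (x + fst p *\<^sub>R axis j 1) (y + snd p *\<^sub>R axis i 1)) (0, 0)"
      by (simp add: zero_prod_def)
  qed
  then show ?case by simp
qed

lemma Ckk_jet_x:
  assumes "Ckk m \<Omega> K" "length w' \<le> m" "y \<in> \<Omega>"
  shows "jet m \<Omega> (\<lambda>w x. Dxy w w' K x y)"
  unfolding jet_def
proof (intro conjI allI ballI impI)
  fix w :: "'a list" assume "length w \<le> m"
  then have "continuous_on (\<Omega> \<times> \<Omega>) (\<lambda>p. Dxy w w' K (fst p) (snd p))"
    using Ckk_continuous assms by blast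
  then have "continuous_on \<Omega> (\<lambda>x. (\<lambda>p. Dxy w w' K (fst p) (snd p)) (x, y))"
    by (rule continuous_on_compose2) (use assms in \<open>auto intro!: continuous_intros\<close>)
  then show "continuous_on \<Omega> (\<lambda>x. Dxy w w' K x y)" by simp
qed (use Ckk_derivative_x assms in blast)

lemma Ckk_jet_y:
  assumes "open \<Omega>" "Ckk m \<Omega> K" "length w \<le> m" "x \<in> \<Omega>"
  shows "jet m \<Omega> (\<lambda>w' y. Dxy w w' K x y)"
  unfolding jet_def
proof (intro conjI allI ballI impI)
  fix w' :: "'a list" assume "length w' \<le> m"
  then have "continuous_on (\<Omega> \<times> \<Omega>) (\<lambda>p. Dxy w w' K (fst p) (snd p))"
    using Ckk_continuous assms by blast
  then have "continuous_on \<Omega> (\<lambda>y. (\<lambda>p. Dxy w w' K (fst p) (snd p)) (x, y))"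
    by (rule continuous_on_compose2) (use assms in \<open>auto intro!: continuous_intros\<close>)
  then show "continuous_on \<Omega> (\<lambda>y. Dxy w w' K x y)" by simp
qed (use Ckk_derivative_y assms in blast)

text \<open>Makes the Taylor remainder in one argument a jet in the other, so that it can be
  expanded again.\<close>

lemma jet_diff_sum:
  assumes "jet m S D" "\<And>a. a \<in> A \<Longrightarrow> jet m S (E a)"
  shows "jet m S (\<lambda>w x. D w x - (\<Sum>a\<in>A. c a * E a w x))"
  using assms unfolding jet_def
  by (auto intro!: continuous_intros DERIV_diff DERIV_sum DERIV_cmult)

section \<open>Taylor expansion in both arguments with uniform remainders\<close>

lemma Ckk_bounded:
  fixes K :: "real^'d::finite \<Rightarrow> real^'d \<Rightarrow> real"
  assumes K: "Ckk m \<Omega> K" and R: "cball 0 R \<subseteq> \<Omega>"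
  obtains B where "B \<ge> 0" "\<And>w w' x y. length w \<le> m \<Longrightarrow> length w' \<le> m \<Longrightarrow> norm x \<le> R \<Longrightarrow> norm y \<le> R \<Longrightarrow>
    \<bar>Dxy w w' K x y\<bar> \<le> B"
proof -
  let ?W = "{w :: 'd list. length w \<le> m}"
  have fin: "finite ?W" using finite_lists_length_le[of "UNIV :: 'd set" m] by simp
  have "\<exists>b. \<forall>x y. norm x \<le> R \<longrightarrow> norm y \<le> R \<longrightarrow> \<bar>Dxy w w' K x y\<bar> \<le> b"
    if "w \<in> ?W" "w' \<in> ?W" for w w'
  proof -
    have "continuous_on (\<Omega> \<times> \<Omega>) (\<lambda>p. Dxy w w' K (fst p) (snd p))"
      using Ckk_continuous[OF K] that by simp
    then have "continuous_on (cball 0 R \<times> cball 0 R) (\<lambda>p. Dxy w w' K (fst p) (snd p))"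
      by (rule continuous_on_subset) (use R in blast)
    then have "compact ((\<lambda>p. Dxy w w' K (fst p) (snd p)) ` (cball 0 R \<times> cball 0 R))"
      by (rule compact_continuous_image) (intro compact_Times compact_cball)
    then obtain b where "\<forall>z\<in>(\<lambda>p. Dxy w w' K (fst p) (snd p)) ` (cball 0 R \<times> cball 0 R). norm z \<le> b"
      using compact_imp_bounded bounded_iff by blast
    then show ?thesis by (intro exI[of _ b]) auto
  qed
  then obtain b where b: "\<And>w w' x y. w \<in> ?W \<Longrightarrow> w' \<in> ?W \<Longrightarrow> norm x \<le> R \<Longrightarrow> norm y \<le> R \<Longrightarrow> \<bar>Dxy w w' K x y\<bar> \<le> b w w'"
    by metis
  let ?B = "\<Sum>p\<in>?W \<times> ?W. \<bar>b (fst p) (snd p)\<bar>"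
  show thesis
  proof (rule that[of ?B])
    show "?B \<ge> 0" by (simp add: sum_nonneg)
    fix w w' :: "'d list" and x y :: "real^'d"
    assume *: "length w \<le> m" "length w' \<le> m" "norm x \<le> R" "norm y \<le> R"
    then have "\<bar>Dxy w w' K x y\<bar> \<le> \<bar>b (fst (w, w')) (snd (w, w'))\<bar>" using b[of w w' x y] by simp
    also have "\<dots> \<le> ?B" by (rule member_le_sum) (use * fin in auto)
    finally show "\<bar>Dxy w w' K x y\<bar> \<le> ?B" .
  qed
qed

text \<open>Only the size of \<open>g\<close>, \<open>h\<close> and \<open>r\<close> matters later,
  so they stay abstract; one \<open>C\<close> and one \<open>\<delta>\<close> serve all nodes and
  multi-indices. The bound \<open>\<delta> \<le> 1\<close> is recorded because powers of \<epsilon>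
  will be compared.\<close>

lemma kernel_expansion:
  fixes K :: "real^'d::finite \<Rightarrow> real^'d \<Rightarrow> real" and x :: "nat \<Rightarrow> real^'d"
  assumes \<Omega>: "open \<Omega>" "0 \<in> \<Omega>" and K: "Ckk (Suc k) \<Omega> K"
  obtains C \<delta> :: real and g h :: "('d \<Rightarrow> nat) \<Rightarrow> nat \<Rightarrow> real \<Rightarrow> real" and r :: "nat \<Rightarrow> nat \<Rightarrow> real \<Rightarrow> real"
  where "C \<ge> 0" "\<delta> > 0" "\<delta> \<le> 1"
    "\<And>\<epsilon> i j. \<bar>\<epsilon>\<bar> < \<delta> \<Longrightarrow> i < n \<Longrightarrow> j < n \<Longrightarrow> K (\<epsilon> *\<^sub>R x i) (\<epsilon> *\<^sub>R x j) =
      (\<Sum>\<alpha>\<in>PP k. \<Sum>\<beta>\<in>PP k. \<epsilon> ^ (mi_deg \<alpha> + mi_deg \<beta>) * mono_pow (x i) \<alpha> * mono_pow (x j) \<beta>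
        * (Kderiv K \<alpha> \<beta> 0 0 / (mi_fact \<alpha> * mi_fact \<beta>)))
      + (\<Sum>\<alpha>\<in>PP k. \<epsilon> ^ mi_deg \<alpha> * mono_pow (x i) \<alpha> * g \<alpha> j \<epsilon>)
      + (\<Sum>\<beta>\<in>PP k. \<epsilon> ^ mi_deg \<beta> * mono_pow (x j) \<beta> * h \<beta> i \<epsilon>) + r i j \<epsilon>"
    "\<And>\<epsilon> \<alpha> j. \<bar>\<epsilon>\<bar> < \<delta> \<Longrightarrow> \<alpha> \<in> PP k \<Longrightarrow> j < n \<Longrightarrow> \<bar>g \<alpha> j \<epsilon>\<bar> \<le> C * \<bar>\<epsilon>\<bar> ^ Suc k"
    "\<And>\<epsilon> \<beta> i. \<bar>\<epsilon>\<bar> < \<delta> \<Longrightarrow> \<beta> \<in> PP k \<Longrightarrow> i < n \<Longrightarrow> \<bar>h \<beta> i \<epsilon>\<bar> \<le> C * \<bar>\<epsilon>\<bar> ^ Suc k"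
    "\<And>\<epsilon> i j. \<bar>\<epsilon>\<bar> < \<delta> \<Longrightarrow> i < n \<Longrightarrow> j < n \<Longrightarrow> \<bar>r i j \<epsilon>\<bar> \<le> C * \<bar>\<epsilon>\<bar> ^ Suc k * \<bar>\<epsilon>\<bar> ^ Suc k"
proof -
  obtain R where R: "R > 0" "cball 0 R \<subseteq> \<Omega>" using \<Omega> open_contains_cball by blast
  obtain B where B: "B \<ge> 0" "\<And>w w' x y. length w \<le> Suc k \<Longrightarrow> length w' \<le> Suc k \<Longrightarrow>
      norm x \<le> R \<Longrightarrow> norm y \<le> R \<Longrightarrow> \<bar>Dxy w w' K x y\<bar> \<le> B"
    using Ckk_bounded[OF K R(2)] by blast
  \<comment> \<open>The summand 1 makes \<open>X\<close> a valid divisor even if all nodes are 0.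
    The radius \<open>R / X\<close> keeps the scaled nodes in the ball on which the derivatives are
    bounded by \<open>B\<close>.\<close>
  define X where "X = 1 + (\<Sum>i<n. norm (x i))"
  have X: "X \<ge> 1" by (simp add: X_def sum_nonneg)
  have xX: "norm (x i) \<le> X" if "i < n" for i
    using member_le_sum[of i "{..<n}" "\<lambda>i. norm (x i)"] that by (simp add: X_def)
  define \<delta> where "\<delta> = min 1 (R / X)"
  have \<delta>: "\<delta> > 0" "\<delta> \<le> 1" using R X by (auto simp: \<delta>_def)
  have near: "norm (\<theta> *\<^sub>R x i) \<le> R" if "\<bar>\<theta>\<bar> \<le> \<bar>\<epsilon>\<bar>" "\<bar>\<epsilon>\<bar> < \<delta>" "i < n" for \<theta> \<epsilon> i
  proof -
    have "norm (\<theta> *\<^sub>R x i) \<le> \<delta> * X" using that xX[of i] by (simp add: mult_mono)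
    also have "\<dots> \<le> R / X * X" using X by (intro mult_right_mono) (auto simp: \<delta>_def)
    finally show ?thesis using X by simp
  qed
  have in\<Omega>: "z \<in> \<Omega>" if "norm z \<le> R" for z using that R by auto
  \<comment> \<open>One bound for the factors that depend on the nodes in Taylor's formula, common
    to all \<open>n\<close> nodes.\<close>
  define T where "T = (\<Sum>i<n. \<Sum>w | length w = Suc k. \<bar>\<Prod>c\<leftarrow>w. x i $ c\<bar>)"
  have Ti: "(\<Sum>w | length w = Suc k. \<bar>\<Prod>c\<leftarrow>w. x i $ c\<bar>) \<le> T" if "i < n" for i
    unfolding T_def by (rule member_le_sum) (use that in \<open>auto simp: sum_nonneg\<close>)
  have T: "T \<ge> 0" by (simp add: T_def sum_nonneg)
  define L where "L w y i \<epsilon> = Dxy [] w K (\<epsilon> *\<^sub>R x i) y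
    - (\<Sum>\<alpha>\<in>PP k. \<epsilon> ^ mi_deg \<alpha> * mono_pow (x i) \<alpha> / mi_fact \<alpha> * Dxy (mi_list \<alpha>) w K 0 y)" for w y i \<epsilon>
  define G where "G w j \<epsilon> = Dxy w [] K 0 (\<epsilon> *\<^sub>R x j)
    - (\<Sum>\<beta>\<in>PP k. \<epsilon> ^ mi_deg \<beta> * mono_pow (x j) \<beta> / mi_fact \<beta> * Dxy w (mi_list \<beta>) K 0 0)" for w j \<epsilon>
  have Lbound: "\<bar>L w y i \<epsilon>\<bar> \<le> T * B * \<bar>\<epsilon>\<bar> ^ Suc k"
    if "length w \<le> Suc k" "norm y \<le> R" "\<bar>\<epsilon>\<bar> < \<delta>" "i < n" for w y i \<epsilon>
  proof -
    have "\<bar>L w y i \<epsilon>\<bar> \<le> (\<Sum>w | length w = Suc k. \<bar>\<Prod>c\<leftarrow>w. x i $ c\<bar>) * B * \<bar>\<epsilon>\<bar> ^ Suc k"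
      unfolding L_def
      by (rule jet_Taylor[OF \<Omega>(1) Ckk_jet_x[OF K that(1) in\<Omega>[OF that(2)]]])
        (use near in\<Omega> B(2) that in auto)
    also have "\<dots> \<le> T * B * \<bar>\<epsilon>\<bar> ^ Suc k"
      using Ti[OF that(4)] B(1) by (intro mult_right_mono) auto
    finally show ?thesis .
  qed
  have Gbound: "\<bar>G w j \<epsilon>\<bar> \<le> T * B * \<bar>\<epsilon>\<bar> ^ Suc k" if "length w \<le> Suc k" "\<bar>\<epsilon>\<bar> < \<delta>" "j < n" for w j \<epsilon>
  proof -
    have "\<bar>G w j \<epsilon>\<bar> \<le> (\<Sum>w | length w = Suc k. \<bar>\<Prod>c\<leftarrow>w. x j $ c\<bar>) * B * \<bar>\<epsilon>\<bar> ^ Suc k"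
      unfolding G_def
      by (rule jet_Taylor[OF \<Omega>(1) Ckk_jet_y[OF \<Omega>(1) K that(1) \<Omega>(2)]])
        (use near in\<Omega> B(2) that R in auto)
    also have "\<dots> \<le> T * B * \<bar>\<epsilon>\<bar> ^ Suc k"
      using Ti[OF that(3)] B(1) by (intro mult_right_mono) auto
    finally show ?thesis .
  qed
  \<comment> \<open>\<open>g\<close> comes from Taylor's formula in the second argument, applied to
    x-derivatives at 0; \<open>h\<close> comes from that in the first argument, applied to
    y-derivatives at 0.\<close>
  define g where "g \<alpha> j \<epsilon> = G (mi_list \<alpha>) j \<epsilon> / mi_fact \<alpha>" for \<alpha> j \<epsilon>
  define h where "h \<beta> i \<epsilon> = L (mi_list \<beta>) 0 i \<epsilon> / mi_fact \<beta>" for \<beta> i \<epsilon>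
  \<comment> \<open>\<open>L\<close> is the Taylor remainder in the first argument; \<open>r\<close> is the Taylor remainder of \<open>L\<close> in the second.\<close>
  define r where "r i j \<epsilon> = L [] (\<epsilon> *\<^sub>R x j) i \<epsilon>
    - (\<Sum>\<beta>\<in>PP k. \<epsilon> ^ mi_deg \<beta> * mono_pow (x j) \<beta> / mi_fact \<beta> * L (mi_list \<beta>) 0 i \<epsilon>)" for i j \<epsilon>
  have rbound: "\<bar>r i j \<epsilon>\<bar> \<le> T * (T * B) * \<bar>\<epsilon>\<bar> ^ Suc k * \<bar>\<epsilon>\<bar> ^ Suc k"
    if \<epsilon>: "\<bar>\<epsilon>\<bar> < \<delta>" and ij: "i < n" "j < n" for i j \<epsilon>
  proof -
    have jet: "jet (Suc k) \<Omega> (\<lambda>w y. L w y i \<epsilon>)"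
      unfolding L_def
      by (intro jet_diff_sum Ckk_jet_y[OF \<Omega>(1) K])
        (use near[OF order_refl \<epsilon> ij(1)] in\<Omega> \<Omega>(2) in \<open>auto simp: length_mi_list PP_def\<close>)
    have "\<bar>r i j \<epsilon>\<bar> \<le> (\<Sum>w | length w = Suc k. \<bar>\<Prod>c\<leftarrow>w. x j $ c\<bar>) * (T * B * \<bar>\<epsilon>\<bar> ^ Suc k) * \<bar>\<epsilon>\<bar> ^ Suc k"
      unfolding r_def
      by (rule jet_Taylor[OF \<Omega>(1) jet]) (use near in\<Omega> Lbound that in auto)
    also have "\<dots> \<le> T * (T * B * \<bar>\<epsilon>\<bar> ^ Suc k) * \<bar>\<epsilon>\<bar> ^ Suc k"
      using Ti[OF ij(2)] T B(1) by (intro mult_right_mono) auto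
    finally show ?thesis by (simp only: mult.assoc)
  qed
  let ?C = "T * B + T * (T * B)"
  show thesis
  proof (rule that[of ?C \<delta> g h r])
    show "?C \<ge> 0" using T B by simp
    show "\<delta> > 0" "\<delta> \<le> 1" using \<delta> by auto
  next
    fix \<epsilon> i j assume "\<bar>\<epsilon>\<bar> < \<delta>" "i < n" "j < n"
    let ?a = "\<lambda>\<alpha>. \<epsilon> ^ mi_deg \<alpha> * mono_pow (x i) \<alpha> / mi_fact \<alpha>"
    let ?b = "\<lambda>\<beta>. \<epsilon> ^ mi_deg \<beta> * mono_pow (x j) \<beta> / mi_fact \<beta>"
    \<comment> \<open>\<open>?S\<close> is the double Taylor polynomial. The sums with
      \<open>g\<close> and \<open>h\<close> are the one-sided Taylor polynomials minus
      \<open>?S\<close>, so the expansion becomes a linear relation between such sums.\<close>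
    let ?S = "\<Sum>\<alpha>\<in>PP k. \<Sum>\<beta>\<in>PP k. ?a \<alpha> * ?b \<beta> * Dxy (mi_list \<alpha>) (mi_list \<beta>) K 0 0"
    have S: "?S = (\<Sum>\<alpha>\<in>PP k. \<Sum>\<beta>\<in>PP k. \<epsilon> ^ (mi_deg \<alpha> + mi_deg \<beta>) * mono_pow (x i) \<alpha> * mono_pow (x j) \<beta>
        * (Kderiv K \<alpha> \<beta> 0 0 / (mi_fact \<alpha> * mi_fact \<beta>)))"
      by (intro sum.cong refl) (simp add: power_add Kderiv_def)
    have g: "(\<Sum>\<alpha>\<in>PP k. \<epsilon> ^ mi_deg \<alpha> * mono_pow (x i) \<alpha> * g \<alpha> j \<epsilon>)
        = (\<Sum>\<alpha>\<in>PP k. ?a \<alpha> * Dxy (mi_list \<alpha>) [] K 0 (\<epsilon> *\<^sub>R x j)) - ?S"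
      unfolding sum_subtractf[symmetric] g_def G_def
      by (intro sum.cong refl) (simp add: right_diff_distrib sum_distrib_left diff_divide_distrib sum_divide_distrib mult_ac)
    have S': "?S = (\<Sum>\<beta>\<in>PP k. \<Sum>\<alpha>\<in>PP k. ?a \<alpha> * ?b \<beta> * Dxy (mi_list \<alpha>) (mi_list \<beta>) K 0 0)"
      by (rule sum.swap)
    have h: "(\<Sum>\<beta>\<in>PP k. \<epsilon> ^ mi_deg \<beta> * mono_pow (x j) \<beta> * h \<beta> i \<epsilon>)
        = (\<Sum>\<beta>\<in>PP k. ?b \<beta> * Dxy [] (mi_list \<beta>) K (\<epsilon> *\<^sub>R x i) 0) - ?S"
      unfolding S' sum_subtractf[symmetric] h_def L_def
      by (intro sum.cong refl) (simp add: right_diff_distrib sum_distrib_left diff_divide_distrib sum_divide_distrib mult_ac)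
    have hr: "(\<Sum>\<beta>\<in>PP k. \<epsilon> ^ mi_deg \<beta> * mono_pow (x j) \<beta> * h \<beta> i \<epsilon>)
        = (\<Sum>\<beta>\<in>PP k. ?b \<beta> * L (mi_list \<beta>) 0 i \<epsilon>)"
      unfolding h_def by (intro sum.cong refl) simp
    have "r i j \<epsilon> = K (\<epsilon> *\<^sub>R x i) (\<epsilon> *\<^sub>R x j) - (\<Sum>\<alpha>\<in>PP k. ?a \<alpha> * Dxy (mi_list \<alpha>) [] K 0 (\<epsilon> *\<^sub>R x j))
        - (\<Sum>\<beta>\<in>PP k. \<epsilon> ^ mi_deg \<beta> * mono_pow (x j) \<beta> * h \<beta> i \<epsilon>)"
      unfolding r_def hr by (simp add: L_def Dxy_def)
    with g h S
    show "K (\<epsilon> *\<^sub>R x i) (\<epsilon> *\<^sub>R x j) =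
      (\<Sum>\<alpha>\<in>PP k. \<Sum>\<beta>\<in>PP k. \<epsilon> ^ (mi_deg \<alpha> + mi_deg \<beta>) * mono_pow (x i) \<alpha> * mono_pow (x j) \<beta>
        * (Kderiv K \<alpha> \<beta> 0 0 / (mi_fact \<alpha> * mi_fact \<beta>)))
      + (\<Sum>\<alpha>\<in>PP k. \<epsilon> ^ mi_deg \<alpha> * mono_pow (x i) \<alpha> * g \<alpha> j \<epsilon>)
      + (\<Sum>\<beta>\<in>PP k. \<epsilon> ^ mi_deg \<beta> * mono_pow (x j) \<beta> * h \<beta> i \<epsilon>) + r i j \<epsilon>"
      by linarith
  next
    have div: "\<bar>a / mi_fact \<alpha>\<bar> \<le> ?C * \<bar>\<epsilon>\<bar> ^ Suc k" if "\<bar>a\<bar> \<le> T * B * \<bar>\<epsilon>\<bar> ^ Suc k" for a \<epsilon> and \<alpha> :: "'d \<Rightarrow> nat"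
    proof -
      have "\<bar>a / mi_fact \<alpha>\<bar> \<le> \<bar>a\<bar> / 1"
        unfolding abs_divide by (rule divide_left_mono) (use mi_fact_ge_1[of \<alpha>] in auto)
      also have "\<dots> \<le> T * B * \<bar>\<epsilon>\<bar> ^ Suc k" using that by simp
      also have "\<dots> \<le> ?C * \<bar>\<epsilon>\<bar> ^ Suc k" using T B(1) by (intro mult_right_mono) auto
      finally show ?thesis .
    qed
    fix \<epsilon> i and \<alpha> :: "'d \<Rightarrow> nat" assume *: "\<bar>\<epsilon>\<bar> < \<delta>" "\<alpha> \<in> PP k" "i < n"
    then have "length (mi_list \<alpha>) \<le> Suc k" by (simp add: length_mi_list PP_def)
    then show "\<bar>g \<alpha> i \<epsilon>\<bar> \<le> ?C * \<bar>\<epsilon>\<bar> ^ Suc k" "\<bar>h \<alpha> i \<epsilon>\<bar> \<le> ?C * \<bar>\<epsilon>\<bar> ^ Suc k"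
      unfolding g_def h_def using * Gbound Lbound R by (intro div; simp)+
  next
    fix \<epsilon> i j assume "\<bar>\<epsilon>\<bar> < \<delta>" "i < n" "j < n"
    then have "\<bar>r i j \<epsilon>\<bar> \<le> T * (T * B) * \<bar>\<epsilon>\<bar> ^ Suc k * \<bar>\<epsilon>\<bar> ^ Suc k" by (rule rbound)
    also have "\<dots> \<le> ?C * \<bar>\<epsilon>\<bar> ^ Suc k * \<bar>\<epsilon>\<bar> ^ Suc k" using T B(1) by (intro mult_right_mono) auto
    finally show "\<bar>r i j \<epsilon>\<bar> \<le> ?C * \<bar>\<epsilon>\<bar> ^ Suc k * \<bar>\<epsilon>\<bar> ^ Suc k" .
  qed
qed

section \<open>The kernel as a bilinear form on coefficient vectors\<close>

lemma sum_swap_2_2: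
  "(\<Sum>i\<in>I. \<Sum>j\<in>J. \<Sum>a\<in>A. \<Sum>b\<in>B. f i j a b) = (\<Sum>a\<in>A. \<Sum>b\<in>B. \<Sum>i\<in>I. \<Sum>j\<in>J. f i j a b)"
proof -
  have "(\<Sum>i\<in>I. \<Sum>j\<in>J. \<Sum>a\<in>A. \<Sum>b\<in>B. f i j a b) = (\<Sum>i\<in>I. \<Sum>a\<in>A. \<Sum>b\<in>B. \<Sum>j\<in>J. f i j a b)"
    by (rule sum.cong[OF refl], subst sum.swap, rule sum.cong[OF refl], rule sum.swap)
  also have "\<dots> = (\<Sum>a\<in>A. \<Sum>b\<in>B. \<Sum>i\<in>I. \<Sum>j\<in>J. f i j a b)"
    by (subst sum.swap, rule sum.cong[OF refl], rule sum.swap)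
  finally show ?thesis .
qed

lemma abs_sum_mult_le:
  fixes v f :: "'b \<Rightarrow> real"
  assumes "finite I" "\<And>i. i \<in> I \<Longrightarrow> \<bar>f i\<bar> \<le> M"
  shows "\<bar>\<Sum>i\<in>I. v i * f i\<bar> \<le> (\<Sum>i\<in>I. \<bar>v i\<bar>) * M"
proof -
  have "\<bar>\<Sum>i\<in>I. v i * f i\<bar> \<le> (\<Sum>i\<in>I. \<bar>v i\<bar> * M)"
    by (rule sum_abs[THEN order_trans], rule sum_mono) (use assms in \<open>simp add: abs_mult mult_left_mono\<close>)
  then show ?thesis by (simp add: sum_distrib_right)
qed

text \<open>Coefficients are plain functions on indices, so that rows of a matrix and entries of a
  vector can both be inserted.\<close>

definition kernel_form :: "(real^'d::finite \<Rightarrow> real^'d \<Rightarrow> real) \<Rightarrow> nat \<Rightarrow> (nat \<Rightarrow> real^'d) \<Rightarrow> (nat \<Rightarrow> real) \<Rightarrow> (nat \<Rightarrow> real) \<Rightarrow> real \<Rightarrow> real" where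
  "kernel_form K n x v w \<epsilon> = (\<Sum>i<n. \<Sum>j<n. v i * w j * K (\<epsilon> *\<^sub>R x i) (\<epsilon> *\<^sub>R x j))"

definition leading_form :: "(real^'d::finite \<Rightarrow> real^'d \<Rightarrow> real) \<Rightarrow> nat \<Rightarrow> (nat \<Rightarrow> real^'d) \<Rightarrow> nat \<Rightarrow> nat \<Rightarrow> (nat \<Rightarrow> real) \<Rightarrow> (nat \<Rightarrow> real) \<Rightarrow> real" where
  "leading_form K n x s t v w = (\<Sum>\<alpha> | mi_deg \<alpha> = s. \<Sum>\<beta> | mi_deg \<beta> = t.
    (\<Sum>i<n. v i * mono_pow (x i) \<alpha>) * (\<Sum>j<n. w j * mono_pow (x j) \<beta>)
      * (Kderiv K \<alpha> \<beta> 0 0 / (mi_fact \<alpha> * mi_fact \<beta>)))"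

definition vanishing_moments :: "nat \<Rightarrow> (nat \<Rightarrow> real^'d::finite) \<Rightarrow> nat \<Rightarrow> (nat \<Rightarrow> real) \<Rightarrow> bool" where
  "vanishing_moments n x s v \<longleftrightarrow> (\<forall>\<alpha>. mi_deg \<alpha> < s \<longrightarrow> (\<Sum>i<n. v i * mono_pow (x i) \<alpha>) = 0)"

text \<open>\<open>C\<close> and \<open>\<delta>\<close> are uniform in \<open>v\<close>,
  \<open>w\<close>, \<open>s\<close> and \<open>t\<close>, because the eigenvalue bound inserts
  vectors that vary with \<epsilon>. The first estimate serves the determinants, the plain size
  bound the eigenvalues.\<close>

lemma kernel_form_expansion:
  fixes K :: "real^'d::finite \<Rightarrow> real^'d \<Rightarrow> real" and x :: "nat \<Rightarrow> real^'d"
  assumes \<Omega>: "open \<Omega>" "0 \<in> \<Omega>" and K: "Ckk (Suc k) \<Omega> K"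
  obtains C \<delta> :: real
  where "C \<ge> 0" "\<delta> > 0"
    "\<And>\<epsilon> v w s t. \<bar>\<epsilon>\<bar> < \<delta> \<Longrightarrow> s \<le> k \<Longrightarrow> t \<le> k \<Longrightarrow> vanishing_moments n x s v \<Longrightarrow> vanishing_moments n x t w \<Longrightarrow>
      \<bar>kernel_form K n x v w \<epsilon> - \<epsilon> ^ (s + t) * leading_form K n x s t v w\<bar>
      \<le> C * (\<Sum>i<n. \<bar>v i\<bar>) * (\<Sum>j<n. \<bar>w j\<bar>) * \<bar>\<epsilon>\<bar> ^ Suc (s + t)"
    "\<And>\<epsilon> v w s t. \<bar>\<epsilon>\<bar> < \<delta> \<Longrightarrow> s \<le> k \<Longrightarrow> t \<le> k \<Longrightarrow> vanishing_moments n x s v \<Longrightarrow> vanishing_moments n x t w \<Longrightarrow>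
      \<bar>kernel_form K n x v w \<epsilon>\<bar> \<le> C * (\<Sum>i<n. \<bar>v i\<bar>) * (\<Sum>j<n. \<bar>w j\<bar>) * \<bar>\<epsilon>\<bar> ^ (s + t)"
proof -
  obtain C0 \<delta> :: real and g h :: "('d \<Rightarrow> nat) \<Rightarrow> nat \<Rightarrow> real \<Rightarrow> real" and r :: "nat \<Rightarrow> nat \<Rightarrow> real \<Rightarrow> real"
    where C0: "C0 \<ge> 0" and \<delta>: "\<delta> > 0" "\<delta> \<le> 1"
    and exp: "\<And>\<epsilon> i j. \<bar>\<epsilon>\<bar> < \<delta> \<Longrightarrow> i < n \<Longrightarrow> j < n \<Longrightarrow> K (\<epsilon> *\<^sub>R x i) (\<epsilon> *\<^sub>R x j) =
      (\<Sum>\<alpha>\<in>PP k. \<Sum>\<beta>\<in>PP k. \<epsilon> ^ (mi_deg \<alpha> + mi_deg \<beta>) * mono_pow (x i) \<alpha> * mono_pow (x j) \<beta>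
        * (Kderiv K \<alpha> \<beta> 0 0 / (mi_fact \<alpha> * mi_fact \<beta>)))
      + (\<Sum>\<alpha>\<in>PP k. \<epsilon> ^ mi_deg \<alpha> * mono_pow (x i) \<alpha> * g \<alpha> j \<epsilon>)
      + (\<Sum>\<beta>\<in>PP k. \<epsilon> ^ mi_deg \<beta> * mono_pow (x j) \<beta> * h \<beta> i \<epsilon>) + r i j \<epsilon>"
    and g: "\<And>\<epsilon> \<alpha> j. \<bar>\<epsilon>\<bar> < \<delta> \<Longrightarrow> \<alpha> \<in> PP k \<Longrightarrow> j < n \<Longrightarrow> \<bar>g \<alpha> j \<epsilon>\<bar> \<le> C0 * \<bar>\<epsilon>\<bar> ^ Suc k"
    and h: "\<And>\<epsilon> \<beta> i. \<bar>\<epsilon>\<bar> < \<delta> \<Longrightarrow> \<beta> \<in> PP k \<Longrightarrow> i < n \<Longrightarrow> \<bar>h \<beta> i \<epsilon>\<bar> \<le> C0 * \<bar>\<epsilon>\<bar> ^ Suc k"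
    and r: "\<And>\<epsilon> i j. \<bar>\<epsilon>\<bar> < \<delta> \<Longrightarrow> i < n \<Longrightarrow> j < n \<Longrightarrow> \<bar>r i j \<epsilon>\<bar> \<le> C0 * \<bar>\<epsilon>\<bar> ^ Suc k * \<bar>\<epsilon>\<bar> ^ Suc k"
    using kernel_expansion[OF \<Omega> K, of n x] by blast
  define W where "W \<alpha> \<beta> = Kderiv K \<alpha> \<beta> 0 0 / (mi_fact \<alpha> * mi_fact \<beta>)" for \<alpha> \<beta>
  define SW where "SW = (\<Sum>\<alpha>\<in>PP k. \<Sum>\<beta>\<in>PP k. \<bar>W \<alpha> \<beta>\<bar>)"
  have SW: "SW \<ge> 0" by (simp add: SW_def sum_nonneg)
  define X where "X = (\<Sum>i<n. \<Sum>\<alpha>\<in>PP k. \<bar>mono_pow (x i) \<alpha>\<bar>)"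
  have X: "X \<ge> 0" by (simp add: X_def sum_nonneg)
  have mX: "\<bar>mono_pow (x i) \<alpha>\<bar> \<le> X" if "i < n" "\<alpha> \<in> PP k" for i \<alpha>
  proof -
    have "\<bar>mono_pow (x i) \<alpha>\<bar> \<le> (\<Sum>\<alpha>\<in>PP k. \<bar>mono_pow (x i) \<alpha>\<bar>)"
      by (rule member_le_sum) (use that finite_PP in auto)
    also have "\<dots> \<le> X" unfolding X_def by (rule member_le_sum) (use that in \<open>auto simp: sum_nonneg\<close>)
    finally show ?thesis .
  qed
  let ?N = "real (card (PP k :: ('d \<Rightarrow> nat) set))"
  \<comment> \<open>The summands bound, in this order, the double polynomial, the two one-sided
    remainders and the double remainder, after the sums of \<open>\<bar>v i\<bar>\<close> and
    \<open>\<bar>w j\<bar>\<close> have been factored out.\<close>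
  define C where "C = X * X * SW + ?N * X * C0 + ?N * X * C0 + C0"
  have C: "C \<ge> 0" using X SW C0 by (simp add: C_def)
  let ?P = "\<lambda>s v. \<forall>\<alpha> :: 'd \<Rightarrow> nat. mi_deg \<alpha> < s \<longrightarrow> (\<Sum>i<n. v i * mono_pow (x i) \<alpha>) = 0"
  let ?Q = "\<lambda>\<epsilon> v w. \<Sum>i<n. \<Sum>j<n. v i * w j * K (\<epsilon> *\<^sub>R x i) (\<epsilon> *\<^sub>R x j)"
  let ?L = "\<lambda>v w s t. \<Sum>\<alpha> | mi_deg \<alpha> = s. \<Sum>\<beta> | mi_deg \<beta> = t.
          (\<Sum>i<n. v i * mono_pow (x i) \<alpha>) * (\<Sum>j<n. w j * mono_pow (x j) \<beta>) * W \<alpha> \<beta>"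
  \<comment> \<open>The size of the leading form is carried along, since the plain bound needs it in
    addition to the error.\<close>
  have main: "\<bar>?Q \<epsilon> v w - \<epsilon> ^ (s + t) * ?L v w s t\<bar> \<le> C * (\<Sum>i<n. \<bar>v i\<bar>) * (\<Sum>j<n. \<bar>w j\<bar>) * \<bar>\<epsilon>\<bar> ^ Suc (s + t)
      \<and> \<bar>?L v w s t\<bar> \<le> C * (\<Sum>i<n. \<bar>v i\<bar>) * (\<Sum>j<n. \<bar>w j\<bar>)"
    if \<epsilon>: "\<bar>\<epsilon>\<bar> < \<delta>" and s: "s \<le> k" and t: "t \<le> k" and v: "?P s v" and w: "?P t w" for \<epsilon> v w s t
  proof -
    define A where "A \<alpha> = (\<Sum>i<n. v i * mono_pow (x i) \<alpha>)" for \<alpha>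
    define B where "B \<beta> = (\<Sum>j<n. w j * mono_pow (x j) \<beta>)" for \<beta>
    define V where "V = (\<Sum>i<n. \<bar>v i\<bar>)"
    define U where "U = (\<Sum>j<n. \<bar>w j\<bar>)"
    have VU: "V \<ge> 0" "U \<ge> 0" by (simp_all add: V_def U_def sum_nonneg)
    have A: "\<bar>A \<alpha>\<bar> \<le> V * X" if "\<alpha> \<in> PP k" for \<alpha>
      unfolding A_def V_def by (rule abs_sum_mult_le) (use mX that in auto)
    have B: "\<bar>B \<alpha>\<bar> \<le> U * X" if "\<alpha> \<in> PP k" for \<alpha>
      unfolding B_def U_def by (rule abs_sum_mult_le) (use mX that in auto)
    have A0: "A \<alpha> = 0" if "mi_deg \<alpha> < s" for \<alpha> using v that by (simp add: A_def)
    have B0: "B \<alpha> = 0" if "mi_deg \<alpha> < t" for \<alpha> using w that by (simp add: B_def)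
    have pow: "\<bar>\<epsilon>\<bar> ^ a \<le> \<bar>\<epsilon>\<bar> ^ b" if "b \<le> a" for a b
      using \<epsilon> \<delta> that by (intro power_decreasing) auto
    define G where "G \<alpha> = (\<Sum>j<n. w j * g \<alpha> j \<epsilon>)" for \<alpha>
    define H where "H \<beta> = (\<Sum>i<n. v i * h \<beta> i \<epsilon>)" for \<beta>
    define R where "R = (\<Sum>i<n. v i * (\<Sum>j<n. w j * r i j \<epsilon>))"
    define E where "E \<alpha> \<beta> = A \<alpha> * B \<beta> * W \<alpha> \<beta>" for \<alpha> \<beta>
    have G: "\<bar>G \<alpha>\<bar> \<le> U * (C0 * \<bar>\<epsilon>\<bar> ^ Suc k)" if "\<alpha> \<in> PP k" for \<alpha>
      unfolding G_def U_def by (rule abs_sum_mult_le) (use g[OF \<epsilon>] that in auto)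
    have H: "\<bar>H \<alpha>\<bar> \<le> V * (C0 * \<bar>\<epsilon>\<bar> ^ Suc k)" if "\<alpha> \<in> PP k" for \<alpha>
      unfolding H_def V_def by (rule abs_sum_mult_le) (use h[OF \<epsilon>] that in auto)
    have R: "\<bar>R\<bar> \<le> V * (U * (C0 * \<bar>\<epsilon>\<bar> ^ Suc k * \<bar>\<epsilon>\<bar> ^ Suc k))"
      unfolding R_def V_def U_def by (intro abs_sum_mult_le) (use r[OF \<epsilon>] in auto)
    have Q: "?Q \<epsilon> v w = (\<Sum>\<alpha>\<in>PP k. \<Sum>\<beta>\<in>PP k. \<epsilon> ^ (mi_deg \<alpha> + mi_deg \<beta>) * E \<alpha> \<beta>)
        + (\<Sum>\<alpha>\<in>PP k. \<epsilon> ^ mi_deg \<alpha> * A \<alpha> * G \<alpha>) + (\<Sum>\<beta>\<in>PP k. \<epsilon> ^ mi_deg \<beta> * B \<beta> * H \<beta>) + R"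
    proof -
      have "?Q \<epsilon> v w = (\<Sum>i<n. \<Sum>j<n.
          (\<Sum>\<alpha>\<in>PP k. \<Sum>\<beta>\<in>PP k. v i * w j * (\<epsilon> ^ (mi_deg \<alpha> + mi_deg \<beta>) * mono_pow (x i) \<alpha> * mono_pow (x j) \<beta> * W \<alpha> \<beta>))
          + (\<Sum>\<alpha>\<in>PP k. v i * w j * (\<epsilon> ^ mi_deg \<alpha> * mono_pow (x i) \<alpha> * g \<alpha> j \<epsilon>))
          + (\<Sum>\<beta>\<in>PP k. v i * w j * (\<epsilon> ^ mi_deg \<beta> * mono_pow (x j) \<beta> * h \<beta> i \<epsilon>)) + v i * w j * r i j \<epsilon>)"
        using \<epsilon> by (intro sum.cong refl)
          (simp only: lessThan_iff exp W_def[symmetric] distrib_left sum_distrib_left)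
      also have "\<dots> = (\<Sum>i<n. \<Sum>j<n. \<Sum>\<alpha>\<in>PP k. \<Sum>\<beta>\<in>PP k. v i * w j * (\<epsilon> ^ (mi_deg \<alpha> + mi_deg \<beta>) * mono_pow (x i) \<alpha> * mono_pow (x j) \<beta> * W \<alpha> \<beta>))
          + (\<Sum>i<n. \<Sum>j<n. \<Sum>\<alpha>\<in>PP k. v i * w j * (\<epsilon> ^ mi_deg \<alpha> * mono_pow (x i) \<alpha> * g \<alpha> j \<epsilon>))
          + (\<Sum>i<n. \<Sum>j<n. \<Sum>\<beta>\<in>PP k. v i * w j * (\<epsilon> ^ mi_deg \<beta> * mono_pow (x j) \<beta> * h \<beta> i \<epsilon>))
          + (\<Sum>i<n. \<Sum>j<n. v i * w j * r i j \<epsilon>)"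
        by (simp only: sum.distrib)
      also have "(\<Sum>i<n. \<Sum>j<n. \<Sum>\<alpha>\<in>PP k. \<Sum>\<beta>\<in>PP k. v i * w j * (\<epsilon> ^ (mi_deg \<alpha> + mi_deg \<beta>) * mono_pow (x i) \<alpha> * mono_pow (x j) \<beta> * W \<alpha> \<beta>))
          = (\<Sum>\<alpha>\<in>PP k. \<Sum>\<beta>\<in>PP k. \<epsilon> ^ (mi_deg \<alpha> + mi_deg \<beta>) * E \<alpha> \<beta>)"
        unfolding E_def A_def B_def sum_product
        by (subst sum_swap_2_2) (simp only: sum_distrib_left sum_distrib_right mult_ac)
      \<comment> \<open>The triple sum is treated as a quadruple one whose last index ranges over a
        single point.\<close>
      also have "(\<Sum>i<n. \<Sum>j<n. \<Sum>\<alpha>\<in>PP k. v i * w j * (\<epsilon> ^ mi_deg \<alpha> * mono_pow (x i) \<alpha> * g \<alpha> j \<epsilon>))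
          = (\<Sum>\<alpha>\<in>PP k. \<Sum>i<n. \<Sum>j<n. v i * w j * (\<epsilon> ^ mi_deg \<alpha> * mono_pow (x i) \<alpha> * g \<alpha> j \<epsilon>))"
        using sum_swap_2_2[of "\<lambda>i j \<alpha> b. v i * w j * (\<epsilon> ^ mi_deg \<alpha> * mono_pow (x i) \<alpha> * g \<alpha> j \<epsilon>)" "{()}"] by simp
      also have "\<dots> = (\<Sum>\<alpha>\<in>PP k. \<epsilon> ^ mi_deg \<alpha> * A \<alpha> * G \<alpha>)"
        unfolding A_def G_def mult.assoc sum_product by (simp only: sum_distrib_left mult_ac)
      also have "(\<Sum>i<n. \<Sum>j<n. \<Sum>\<beta>\<in>PP k. v i * w j * (\<epsilon> ^ mi_deg \<beta> * mono_pow (x j) \<beta> * h \<beta> i \<epsilon>))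
          = (\<Sum>\<beta>\<in>PP k. \<Sum>i<n. \<Sum>j<n. v i * w j * (\<epsilon> ^ mi_deg \<beta> * mono_pow (x j) \<beta> * h \<beta> i \<epsilon>))"
        using sum_swap_2_2[of "\<lambda>i j \<beta> b. v i * w j * (\<epsilon> ^ mi_deg \<beta> * mono_pow (x j) \<beta> * h \<beta> i \<epsilon>)" "{()}"] by simp
      also have "\<dots> = (\<Sum>\<beta>\<in>PP k. \<epsilon> ^ mi_deg \<beta> * (H \<beta> * B \<beta>))"
        unfolding B_def H_def sum_product by (simp only: sum_distrib_left mult_ac)
      also have "\<dots> = (\<Sum>\<beta>\<in>PP k. \<epsilon> ^ mi_deg \<beta> * B \<beta> * H \<beta>)"
        by (simp only: mult_ac)
      also have "(\<Sum>i<n. \<Sum>j<n. v i * w j * r i j \<epsilon>) = R"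
        unfolding R_def by (simp only: sum_distrib_left mult_ac)
      finally show ?thesis .
    qed
    have Lsum: "?L v w s t = (\<Sum>\<alpha>\<in>PP k. \<Sum>\<beta>\<in>PP k. if mi_deg \<alpha> = s \<and> mi_deg \<beta> = t then E \<alpha> \<beta> else 0)"
    proof -
      have "?L v w s t = (\<Sum>\<alpha> | mi_deg \<alpha> = s. \<Sum>\<beta> | mi_deg \<beta> = t. E \<alpha> \<beta>)"
        by (simp only: E_def A_def B_def)
      also have "\<dots> = (\<Sum>\<alpha>\<in>PP k. if mi_deg \<alpha> = s then \<Sum>\<beta>\<in>PP k. (if mi_deg \<beta> = t then E \<alpha> \<beta> else 0) else 0)"
      proof (rule sum.mono_neutral_cong_left)
        fix \<alpha> :: "'d \<Rightarrow> nat" assume "\<alpha> \<in> {\<alpha>. mi_deg \<alpha> = s}"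
        moreover have "(\<Sum>\<beta> | mi_deg \<beta> = t. E \<alpha> \<beta>) = (\<Sum>\<beta>\<in>PP k. (if mi_deg \<beta> = t then E \<alpha> \<beta> else 0))"
          by (rule sum.mono_neutral_cong_left) (use t finite_PP in \<open>auto simp: PP_def\<close>)
        ultimately show "(\<Sum>\<beta> | mi_deg \<beta> = t. E \<alpha> \<beta>)
            = (if mi_deg \<alpha> = s then \<Sum>\<beta>\<in>PP k. (if mi_deg \<beta> = t then E \<alpha> \<beta> else 0) else 0)"
          by simp
      qed (use s finite_PP in \<open>auto simp: PP_def\<close>)
      also have "\<dots> = (\<Sum>\<alpha>\<in>PP k. \<Sum>\<beta>\<in>PP k. if mi_deg \<alpha> = s \<and> mi_deg \<beta> = t then E \<alpha> \<beta> else 0)"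
        by (intro sum.cong refl) auto
      finally show ?thesis .
    qed
    have E: "\<bar>E \<alpha> \<beta>\<bar> \<le> X * X * (V * U) * \<bar>W \<alpha> \<beta>\<bar>" if "\<alpha> \<in> PP k" "\<beta> \<in> PP k" for \<alpha> \<beta>
    proof -
      have "\<bar>E \<alpha> \<beta>\<bar> \<le> (V * X) * (U * X) * \<bar>W \<alpha> \<beta>\<bar>"
        unfolding E_def abs_mult using A[OF that(1)] B[OF that(2)] VU X
        by (intro mult_right_mono mult_mono) auto
      then show ?thesis by (simp only: mult_ac)
    qed
    have SWsum: "(\<Sum>\<alpha>\<in>PP k. \<Sum>\<beta>\<in>PP k. X * X * (V * U) * \<bar>W \<alpha> \<beta>\<bar> * c) = X * X * SW * (V * U) * c" for c
      unfolding SW_def by (simp only: sum_distrib_left sum_distrib_right mult_ac)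
    have Lbound: "\<bar>?L v w s t\<bar> \<le> X * X * SW * (V * U)"
    proof -
      have "\<bar>?L v w s t\<bar> \<le> (\<Sum>\<alpha>\<in>PP k. \<Sum>\<beta>\<in>PP k. X * X * (V * U) * \<bar>W \<alpha> \<beta>\<bar> * 1)"
        unfolding Lsum
        by (intro order_trans[OF sum_abs] sum_mono) (use E X VU in \<open>auto\<close>)
      then show ?thesis unfolding SWsum by simp
    qed
    have 1: "\<bar>(\<Sum>\<alpha>\<in>PP k. \<Sum>\<beta>\<in>PP k. \<epsilon> ^ (mi_deg \<alpha> + mi_deg \<beta>) * E \<alpha> \<beta>) - \<epsilon> ^ (s + t) * ?L v w s t\<bar>
        \<le> X * X * SW * (V * U) * \<bar>\<epsilon>\<bar> ^ Suc (s + t)"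
    proof -
      have "(\<Sum>\<alpha>\<in>PP k. \<Sum>\<beta>\<in>PP k. \<epsilon> ^ (mi_deg \<alpha> + mi_deg \<beta>) * E \<alpha> \<beta>) - \<epsilon> ^ (s + t) * ?L v w s t
        = (\<Sum>\<alpha>\<in>PP k. \<Sum>\<beta>\<in>PP k. if mi_deg \<alpha> = s \<and> mi_deg \<beta> = t then 0 else \<epsilon> ^ (mi_deg \<alpha> + mi_deg \<beta>) * E \<alpha> \<beta>)"
        unfolding Lsum unfolding sum_distrib_left sum_subtractf[symmetric]
        by (intro sum.cong refl) auto
      also have "\<bar>\<dots>\<bar> \<le> (\<Sum>\<alpha>\<in>PP k. \<Sum>\<beta>\<in>PP k. X * X * (V * U) * \<bar>W \<alpha> \<beta>\<bar> * \<bar>\<epsilon>\<bar> ^ Suc (s + t))"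
      proof (intro order_trans[OF sum_abs] sum_mono)
        fix \<alpha> \<beta> :: "'d \<Rightarrow> nat" assume \<alpha>\<beta>: "\<alpha> \<in> PP k" "\<beta> \<in> PP k"
        have nn: "0 \<le> X * X * (V * U) * \<bar>W \<alpha> \<beta>\<bar> * \<bar>\<epsilon>\<bar> ^ Suc (s + t)" using X VU by simp
        \<comment> \<open>A pair of degrees other than \<open>(s, t)\<close> either has a component
          that is too small, and then a moment vanishes, or exceeds \<open>s + t\<close> in
          total.\<close>
        consider "mi_deg \<alpha> = s \<and> mi_deg \<beta> = t" | "mi_deg \<alpha> < s" | "mi_deg \<beta> < t" | "Suc (s + t) \<le> mi_deg \<alpha> + mi_deg \<beta>"
          by linarith
        then show "\<bar>if mi_deg \<alpha> = s \<and> mi_deg \<beta> = t then 0 else \<epsilon> ^ (mi_deg \<alpha> + mi_deg \<beta>) * E \<alpha> \<beta>\<bar>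
            \<le> X * X * (V * U) * \<bar>W \<alpha> \<beta>\<bar> * \<bar>\<epsilon>\<bar> ^ Suc (s + t)"
        proof cases
          case 4
          have "\<bar>\<epsilon> ^ (mi_deg \<alpha> + mi_deg \<beta>) * E \<alpha> \<beta>\<bar> \<le> \<bar>\<epsilon>\<bar> ^ Suc (s + t) * (X * X * (V * U) * \<bar>W \<alpha> \<beta>\<bar>)"
            unfolding abs_mult power_abs using pow[OF 4] E[OF \<alpha>\<beta>] by (intro mult_mono) auto
          then show ?thesis using nn by (simp add: mult.commute)
        qed (use nn A0 B0 in \<open>auto simp: E_def\<close>)
      qed
      finally show ?thesis unfolding SWsum .
    qed
    \<comment> \<open>Covers both one-sided remainders at once. \<open>s'\<close> is the order of
      vanishing in the argument that keeps its monomials; \<open>s + t \<le> s' + k\<close> holds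
      because the other order is at most \<open>k\<close>, and it brings \<open>s' + k + 1\<close>
      up to the required exponent.\<close>
    have 2: "\<bar>\<Sum>\<alpha>\<in>PP k. \<epsilon> ^ mi_deg \<alpha> * F \<alpha> * Z \<alpha>\<bar> \<le> ?N * X * C0 * (V * U) * \<bar>\<epsilon>\<bar> ^ Suc (s + t)"
      if F: "\<And>\<alpha>. \<alpha> \<in> PP k \<Longrightarrow> \<bar>F \<alpha>\<bar> \<le> V1 * X" and Z: "\<And>\<alpha>. \<alpha> \<in> PP k \<Longrightarrow> \<bar>Z \<alpha>\<bar> \<le> V2 * (C0 * \<bar>\<epsilon>\<bar> ^ Suc k)"
        and F0: "\<And>\<alpha>. mi_deg \<alpha> < s' \<Longrightarrow> F \<alpha> = 0" and s': "s + t \<le> s' + k" and V12: "V1 * V2 = V * U" "V1 \<ge> 0" "V2 \<ge> 0"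
      for F Z :: "('d \<Rightarrow> nat) \<Rightarrow> real" and V1 V2 s'
    proof -
      have "\<bar>\<Sum>\<alpha>\<in>PP k. \<epsilon> ^ mi_deg \<alpha> * F \<alpha> * Z \<alpha>\<bar> \<le> (\<Sum>\<alpha>\<in>(PP k :: ('d \<Rightarrow> nat) set). X * C0 * (V * U) * \<bar>\<epsilon>\<bar> ^ Suc (s + t))"
      proof (intro order_trans[OF sum_abs] sum_mono)
        fix \<alpha> :: "'d \<Rightarrow> nat" assume \<alpha>: "\<alpha> \<in> PP k"
        show "\<bar>\<epsilon> ^ mi_deg \<alpha> * F \<alpha> * Z \<alpha>\<bar> \<le> X * C0 * (V * U) * \<bar>\<epsilon>\<bar> ^ Suc (s + t)"
        proof (cases "mi_deg \<alpha> < s'")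
          case True
          then show ?thesis using F0 X C0 VU by simp
        next
          case False
          have "\<bar>\<epsilon> ^ mi_deg \<alpha> * F \<alpha> * Z \<alpha>\<bar> \<le> \<bar>\<epsilon>\<bar> ^ mi_deg \<alpha> * (V1 * X) * (V2 * (C0 * \<bar>\<epsilon>\<bar> ^ Suc k))"
            unfolding abs_mult power_abs using F[OF \<alpha>] Z[OF \<alpha>] V12 X by (intro mult_mono) auto
          also have "\<dots> = X * C0 * (V1 * V2) * \<bar>\<epsilon>\<bar> ^ (mi_deg \<alpha> + Suc k)" by (simp only: power_add mult_ac)
          also have "\<dots> \<le> X * C0 * (V * U) * \<bar>\<epsilon>\<bar> ^ Suc (s + t)"
            unfolding V12 using False s' X C0 VU by (intro mult_left_mono pow) auto
          finally show ?thesis .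
        qed
      qed
      then show ?thesis by (simp add: mult_ac)
    qed
    have 3: "\<bar>R\<bar> \<le> C0 * (V * U) * \<bar>\<epsilon>\<bar> ^ Suc (s + t)"
    proof -
      have "\<bar>R\<bar> \<le> C0 * (V * U) * \<bar>\<epsilon>\<bar> ^ (Suc k + Suc k)" using R by (simp only: power_add mult_ac)
      also have "\<dots> \<le> C0 * (V * U) * \<bar>\<epsilon>\<bar> ^ Suc (s + t)"
        using s t C0 VU by (intro mult_left_mono pow) auto
      finally show ?thesis .
    qed
    have 4: "\<bar>\<Sum>\<alpha>\<in>PP k. \<epsilon> ^ mi_deg \<alpha> * A \<alpha> * G \<alpha>\<bar> \<le> ?N * X * C0 * (V * U) * \<bar>\<epsilon>\<bar> ^ Suc (s + t)"
      using A G A0 t VU by (intro 2[where s' = s and ?V1.0 = V and ?V2.0 = U]) auto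
    have 5: "\<bar>\<Sum>\<beta>\<in>PP k. \<epsilon> ^ mi_deg \<beta> * B \<beta> * H \<beta>\<bar> \<le> ?N * X * C0 * (V * U) * \<bar>\<epsilon>\<bar> ^ Suc (s + t)"
      using B H B0 s VU by (intro 2[where s' = t and ?V1.0 = U and ?V2.0 = V]) auto
    have "\<bar>?Q \<epsilon> v w - \<epsilon> ^ (s + t) * ?L v w s t\<bar> \<le> X * X * SW * (V * U) * \<bar>\<epsilon>\<bar> ^ Suc (s + t)
        + ?N * X * C0 * (V * U) * \<bar>\<epsilon>\<bar> ^ Suc (s + t) + ?N * X * C0 * (V * U) * \<bar>\<epsilon>\<bar> ^ Suc (s + t)
        + C0 * (V * U) * \<bar>\<epsilon>\<bar> ^ Suc (s + t)"
      using 1 3 4 5 unfolding Q by linarith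
    also have "\<dots> = C * V * U * \<bar>\<epsilon>\<bar> ^ Suc (s + t)"
      unfolding C_def by (simp only: distrib_right mult.assoc)
    finally have *: "\<bar>?Q \<epsilon> v w - \<epsilon> ^ (s + t) * ?L v w s t\<bar> \<le> C * V * U * \<bar>\<epsilon>\<bar> ^ Suc (s + t)" .
    have "X * X * SW * (V * U) \<le> C * (V * U)" using X C0 VU by (intro mult_right_mono) (auto simp: C_def)
    with Lbound have "\<bar>?L v w s t\<bar> \<le> C * V * U" by (simp only: mult.assoc)
    with * show ?thesis unfolding V_def U_def by blast
  qed
  show thesis
  proof (rule that[of "2 * C" \<delta>])
    show "2 * C \<ge> 0" "\<delta> > 0" using C \<delta> by auto
  next
    fix \<epsilon> v w s t
    assume a: "\<bar>\<epsilon>\<bar> < \<delta>" "s \<le> k" "t \<le> k" "vanishing_moments n x s v" "vanishing_moments n x t w"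
    define Z where "Z = C * (\<Sum>i<n. \<bar>v i\<bar>) * (\<Sum>j<n. \<bar>w j\<bar>)"
    have Z: "Z \<ge> 0" unfolding Z_def using C by (intro mult_nonneg_nonneg sum_nonneg) auto
    have 1: "\<bar>?Q \<epsilon> v w - \<epsilon> ^ (s + t) * ?L v w s t\<bar> \<le> Z * \<bar>\<epsilon>\<bar> ^ Suc (s + t)" and 2: "\<bar>?L v w s t\<bar> \<le> Z"
      using main[OF a(1,2,3) a(4,5)[unfolded vanishing_moments_def]] unfolding Z_def by blast+
    have ZZ: "2 * C * (\<Sum>i<n. \<bar>v i\<bar>) * (\<Sum>j<n. \<bar>w j\<bar>) = 2 * Z" by (simp add: Z_def)
    have "\<bar>?Q \<epsilon> v w - \<epsilon> ^ (s + t) * ?L v w s t\<bar> \<le> 2 * Z * \<bar>\<epsilon>\<bar> ^ Suc (s + t)"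
      using 1 mult_nonneg_nonneg[OF Z, of "\<bar>\<epsilon>\<bar> ^ Suc (s + t)"] by simp
    then show "\<bar>kernel_form K n x v w \<epsilon> - \<epsilon> ^ (s + t) * leading_form K n x s t v w\<bar>
      \<le> 2 * C * (\<Sum>i<n. \<bar>v i\<bar>) * (\<Sum>j<n. \<bar>w j\<bar>) * \<bar>\<epsilon>\<bar> ^ Suc (s + t)"
      unfolding ZZ kernel_form_def leading_form_def W_def[symmetric] .
    \<comment> \<open>For the plain bound the leading part and the error are added, each at most
      \<open>Z * \<bar>\<epsilon>\<bar> ^ (s + t)\<close>; this is the origin of the factor 2 in the
      constant.\<close>
    have "\<bar>\<epsilon> ^ (s + t) * ?L v w s t\<bar> \<le> \<bar>\<epsilon>\<bar> ^ (s + t) * Z"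
      unfolding abs_mult power_abs using 2 by (intro mult_left_mono) auto
    moreover have "Z * \<bar>\<epsilon>\<bar> ^ Suc (s + t) \<le> Z * \<bar>\<epsilon>\<bar> ^ (s + t)"
      using Z a(1) \<delta> by (intro mult_left_mono power_decreasing) auto
    ultimately have "\<bar>?Q \<epsilon> v w\<bar> \<le> 2 * (Z * \<bar>\<epsilon>\<bar> ^ (s + t))" using 1 by (simp only: mult.commute[of Z])
    then show "\<bar>kernel_form K n x v w \<epsilon>\<bar> \<le> 2 * C * (\<Sum>i<n. \<bar>v i\<bar>) * (\<Sum>j<n. \<bar>w j\<bar>) * \<bar>\<epsilon>\<bar> ^ (s + t)"
      unfolding ZZ kernel_form_def by (simp only: mult.assoc)
  qed
qed

section \<open>Eigenvalues of real symmetric matrices\<close>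

no_notation vec_nth (infixl "$" 90)
no_notation inner (infix "\<bullet>" 70)
notation Matrix.vec_index (infixl "$" 100)

section \<open>The spectral theorem\<close>

lemma symmetric_mat_scalar_prod:
  assumes "(A :: real mat) \<in> carrier_mat n n" "A\<^sup>T = A" "p \<in> carrier_vec n" "q \<in> carrier_vec n"
  shows "p \<bullet> (A *\<^sub>v q) = q \<bullet> (A *\<^sub>v p)"
  using transpose_vec_mult_scalar[OF assms(1,4,3)] assms
  by (metis comm_scalar_prod mult_mat_vec_carrier)

lemma real_scalar_prod_self:
  assumes "(v :: real vec) \<in> carrier_vec n"
  shows "v \<bullet> v \<ge> 0" "v \<bullet> v = 0 \<longleftrightarrow> v = 0\<^sub>v n"
proof -
  have c: "conjugate v = v" by (intro eq_vecI) (auto simp: conjugate_real_def)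
  show "v \<bullet> v \<ge> 0" using conjugate_square_ge_0_vec[of v] by (simp add: c)
  show "v \<bullet> v = 0 \<longleftrightarrow> v = 0\<^sub>v n" using conjugate_square_eq_0_vec[OF assms] by (simp add: c)
qed

text \<open>With \<open>v = p + i q\<close>, the real and imaginary parts of the eigenvalue equation
  and the symmetry \<open>p \<bullet> A q = q \<bullet> A p\<close> leave
  \<open>Im a (p \<bullet> p + q \<bullet> q) = 0\<close>.\<close>

lemma complex_eigenvalue_of_symmetric_real:
  assumes A: "(A :: real mat) \<in> carrier_mat n n" and sym: "A\<^sup>T = A"
    and ev: "eigenvalue (map_mat complex_of_real A) a"
  shows "Im a = 0"
proof -
  let ?A = "map_mat complex_of_real A"
  obtain v where v: "v \<in> carrier_vec n" "v \<noteq> 0\<^sub>v n" "?A *\<^sub>v v = a \<cdot>\<^sub>v v"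
    using ev A unfolding eigenvalue_def eigenvector_def by auto
  define p where "p = map_vec Re v"
  define q where "q = map_vec Im v"
  have pq: "p \<in> carrier_vec n" "q \<in> carrier_vec n" using v by (auto simp: p_def q_def)
  have entry: "(\<Sum>j = 0..<n. complex_of_real (A $$ (i, j)) * (v $ j)) = a * (v $ i)" if "i < n" for i
    using arg_cong[OF v(3), of "\<lambda>u. u $ i"] that A v(1) by (simp add: scalar_prod_def)
  have Ap: "A *\<^sub>v p = Re a \<cdot>\<^sub>v p - Im a \<cdot>\<^sub>v q"
  proof (rule eq_vecI)
    fix i assume "i < dim_vec (Re a \<cdot>\<^sub>v p - Im a \<cdot>\<^sub>v q)"
    then have i: "i < n" using pq by simp
    show "(A *\<^sub>v p) $ i = (Re a \<cdot>\<^sub>v p - Im a \<cdot>\<^sub>v q) $ i"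
      using arg_cong[OF entry[OF i], of Re] i A v(1) by (simp add: scalar_prod_def p_def q_def)
  qed (use A pq in auto)
  have Aq: "A *\<^sub>v q = Re a \<cdot>\<^sub>v q + Im a \<cdot>\<^sub>v p"
  proof (rule eq_vecI)
    fix i assume "i < dim_vec (Re a \<cdot>\<^sub>v q + Im a \<cdot>\<^sub>v p)"
    then have i: "i < n" using pq by simp
    show "(A *\<^sub>v q) $ i = (Re a \<cdot>\<^sub>v q + Im a \<cdot>\<^sub>v p) $ i"
      using arg_cong[OF entry[OF i], of Im] i A v(1) by (simp add: scalar_prod_def p_def q_def)
  qed (use A pq in auto)
  have "p \<bullet> (A *\<^sub>v q) = q \<bullet> (A *\<^sub>v p)" by (rule symmetric_mat_scalar_prod[OF A sym pq])
  then have "Im a * (p \<bullet> p) = - Im a * (q \<bullet> q)"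
    unfolding Ap Aq using pq comm_scalar_prod[OF pq]
    by (simp add: scalar_prod_add_distrib[of _ n] scalar_prod_minus_distrib[of _ n])
  then have "Im a * (p \<bullet> p + q \<bullet> q) = 0" by (simp add: algebra_simps)
  moreover have "p \<bullet> p + q \<bullet> q \<noteq> 0"
  proof
    assume "p \<bullet> p + q \<bullet> q = 0"
    then have "p \<bullet> p = 0" "q \<bullet> q = 0" using real_scalar_prod_self(1)[OF pq(1)] real_scalar_prod_self(1)[OF pq(2)] by linarith+
    then have pq0: "p = 0\<^sub>v n" "q = 0\<^sub>v n" using real_scalar_prod_self(2) pq by blast+
    have "v = 0\<^sub>v n"
    proof (rule eq_vecI)
      fix i assume "i < dim_vec (0\<^sub>v n :: complex vec)"
      then show "v $ i = 0\<^sub>v n $ i"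
        using arg_cong[OF pq0(1), of "\<lambda>u. u $ i"] arg_cong[OF pq0(2), of "\<lambda>u. u $ i"] v(1)
        by (simp add: p_def q_def complex_eq_iff)
    qed (use v in auto)
    with v show False by simp
  qed
  ultimately show ?thesis by simp
qed

text \<open>The polynomial splits over the complex numbers, all its roots are real, and a real
  polynomial is determined by its complex image.\<close>

lemma char_poly_symmetric_real_splits:
  assumes A: "(A :: real mat) \<in> carrier_mat n n" and sym: "A\<^sup>T = A"
  shows "\<exists>es. char_poly A = (\<Prod>e\<leftarrow>es. [:- e, 1:]) \<and> length es = n"
proof -
  let ?A = "map_mat complex_of_real A"
  have cA: "?A \<in> carrier_mat n n" using A by simp
  obtain as where as: "char_poly ?A = (\<Prod>a\<leftarrow>as. [:- a, 1:])" "length as = n"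
    using char_poly_factorized[OF cA] by blast
  have im: "Im a = 0" if "a \<in> set as" for a
  proof -
    have "poly (char_poly ?A) a = 0" using that unfolding as(1) poly_prod_list by (auto simp: prod_list_zero_iff)
    then show ?thesis
      using complex_eigenvalue_of_symmetric_real[OF A sym] eigenvalue_root_char_poly[OF cA] by blast
  qed
  interpret ph: map_poly_comm_ring_hom complex_of_real ..
  have "map_poly complex_of_real (\<Prod>e\<leftarrow>map Re bs. [:- e, 1:]) = (\<Prod>a\<leftarrow>bs. [:- a, 1:])"
    if "set bs \<subseteq> set as" for bs
    using that
  proof (induction bs)
    case (Cons b bs)
    then have "complex_of_real (Re b) = b" using im[of b] by (simp add: complex_eq_iff)
    then have "map_poly complex_of_real [:- Re b, 1:] = [:- b, 1:]" by simp
    then show ?case using Cons by (simp only: list.map prod_list.Cons ph.hom_mult) simp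
  qed simp
  from this[of as] have "map_poly complex_of_real (\<Prod>e\<leftarrow>map Re as. [:- e, 1:]) = map_poly complex_of_real (char_poly A)"
    unfolding as(1)[symmetric] of_real_hom.char_poly_hom[OF A] by simp
  then have "char_poly A = (\<Prod>e\<leftarrow>map Re as. [:- e, 1:])"
    by (simp add: poly_eq_iff coeff_map_poly)
  then show ?thesis using as(2) by (intro exI[of _ "map Re as"]) simp
qed

text \<open>The reflection in the hyperplane orthogonal to \<open>v - e_0\<close> exchanges these
  two unit vectors; for \<open>v = e_0\<close> it is undefined and the identity takes its place.
  Symmetric and its own inverse, \<open>H\<close> serves both as a similarity and as a
  congruence.\<close>

lemma Householder_reflection:
  assumes v: "(v :: real vec) \<in> carrier_vec n" and n: "n > 0" and v1: "v \<bullet> v = 1"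
  shows "\<exists>H \<in> carrier_mat n n. H\<^sup>T = H \<and> H * H = 1\<^sub>m n \<and> H *\<^sub>v v = unit_vec n 0"
proof (cases "v = unit_vec n 0")
  case True
  then show ?thesis using v by (intro bexI[of _ "1\<^sub>m n"]) auto
next
  case False
  define w where "w = v - unit_vec n 0"
  have w: "w \<in> carrier_vec n" using v by (simp add: w_def)
  define s where "s = w \<bullet> w"
  have "w \<noteq> 0\<^sub>v n"
  proof
    assume w0: "w = 0\<^sub>v n"
    have "v = unit_vec n 0"
    proof (rule eq_vecI)
      fix i assume "i < dim_vec (unit_vec n 0 :: real vec)"
      then show "v $ i = unit_vec n 0 $ i"
        using arg_cong[OF w0, of "\<lambda>u. u $ i"] v by (simp add: w_def)
    qed (use v in auto)
    with False show False by simp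
  qed
  then have s0: "s \<noteq> 0" using real_scalar_prod_self(2)[OF w] by (simp add: s_def)
  have wv: "w \<bullet> v = 1 - v $ 0" and s: "s = 2 - 2 * v $ 0"
    using v v1 n unfolding s_def w_def
    by (simp_all add: minus_scalar_prod_distrib[of _ n] scalar_prod_minus_distrib[of _ n])
  define H where "H = mat n n (\<lambda>(i, j). (if i = j then 1 else 0) - 2 * w $ i * w $ j / s)"
  have H: "H \<in> carrier_mat n n" by (simp add: H_def)
  have ss: "(\<Sum>k = 0..<n. w $ k * w $ k) = s" using w by (simp add: s_def scalar_prod_def)
  have "H *\<^sub>v v = unit_vec n 0"
  proof (rule eq_vecI)
    fix i assume "i < dim_vec (unit_vec n 0 :: real vec)"
    then have i: "i < n" by simp
    have "(H *\<^sub>v v) $ i = (\<Sum>j = 0..<n. (if i = j then v $ j else 0) - 2 * w $ i / s * (w $ j * v $ j))"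
      using i v by (auto simp: H_def scalar_prod_def left_diff_distrib intro!: sum.cong)
    also have "\<dots> = v $ i - 2 * w $ i / s * (w \<bullet> v)"
      using i v by (simp add: sum_subtractf sum_distrib_left sum_divide_distrib scalar_prod_def mult.assoc)
    also have "\<dots> = v $ i - w $ i" using s0 s wv by (simp add: field_simps)
    also have "\<dots> = unit_vec n 0 $ i" using i v by (simp add: w_def)
    finally show "(H *\<^sub>v v) $ i = unit_vec n 0 $ i" .
  qed (use H in auto)
  moreover have "H * H = 1\<^sub>m n"
  proof (rule eq_matI)
    fix i j assume "i < dim_row (1\<^sub>m n :: real mat)" "j < dim_col (1\<^sub>m n :: real mat)"
    then have ij: "i < n" "j < n" by auto
    define c where "c i = 2 * w $ i / s" for i
    have "(H * H) $$ (i, j) = (\<Sum>k = 0..<n. ((if i = k then 1 else 0) - c i * w $ k) * ((if k = j then 1 else 0) - w $ k * c j))"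
      using ij by (simp add: H_def scalar_prod_def c_def mult_ac)
    also have "\<dots> = (\<Sum>k = 0..<n. (if i = k then (if k = j then 1 else 0) - w $ k * c j else 0)
        - (if k = j then c i * w $ k else 0) + c i * c j * (w $ k * w $ k))"
      by (intro sum.cong refl) (simp add: algebra_simps)
    also have "\<dots> = ((if i = j then 1 else 0) - w $ i * c j) - c i * w $ j + c i * c j * s"
      using ij by (simp add: sum.distrib sum_subtractf sum_distrib_left[symmetric] ss)
    also have "\<dots> = (if i = j then 1 else 0)" using s0 by (simp add: c_def field_simps)
    finally show "(H * H) $$ (i, j) = 1\<^sub>m n $$ (i, j)" using ij by simp
  qed (use H in auto)
  moreover have "H\<^sup>T = H" by (rule eq_matI) (auto simp: H_def)
  ultimately show ?thesis using H by blast
qed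

text \<open>Deflation: a reflection moves a unit eigenvector of the first root to
  \<open>e_0\<close>, and symmetry clears the first row along with the first column. The remaining
  block is symmetric and has the remaining roots. Induction on the list \<open>es\<close> puts the
  eigenvalues on the diagonal in the prescribed order, in particular in the decreasing one.\<close>

lemma symmetric_real_diagonalizable:
  assumes "(A :: real mat) \<in> carrier_mat n n" "A\<^sup>T = A" "char_poly A = (\<Prod>e\<leftarrow>es. [:- e, 1:])"
  shows "\<exists>Q \<in> carrier_mat n n. Q\<^sup>T * Q = 1\<^sub>m n \<and> Q\<^sup>T * A * Q = mat n n (\<lambda>(i, j). if i = j then es ! i else 0)"
  using assms
proof (induction es arbitrary: A n)
  case Nil
  have "n = 0" using degree_monic_char_poly[OF Nil(1)] Nil(3) by simp
  then show ?case using Nil by (intro bexI[of _ "1\<^sub>m n"] conjI eq_matI) auto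
next
  case (Cons e es)
  note A = Cons.prems(1) and sym = Cons.prems(2) and cp = Cons.prems(3)
  have "eigenvalue A e" using eigenvalue_root_char_poly[OF A] cp by simp
  then obtain v0 where v0: "v0 \<in> carrier_vec n" "v0 \<noteq> 0\<^sub>v n" "A *\<^sub>v v0 = e \<cdot>\<^sub>v v0"
    using A unfolding eigenvalue_def eigenvector_def by auto
  have "n \<noteq> 0" using v0(1,2) by auto
  then obtain m where n: "n = Suc m" using not0_implies_Suc by blast
  define v where "v = (1 / sqrt (v0 \<bullet> v0)) \<cdot>\<^sub>v v0"
  have v: "v \<in> carrier_vec n" using v0 by (simp add: v_def)
  have Av: "A *\<^sub>v v = e \<cdot>\<^sub>v v"
    using mult_mat_vec[OF A v0(1)] v0(3) unfolding v_def by (simp add: smult_smult_assoc mult.commute)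
  have pos: "v0 \<bullet> v0 > 0" using real_scalar_prod_self[OF v0(1)] v0(2) by linarith
  have vv: "v \<bullet> v = 1"
    using v0(1) pos by (simp add: v_def)
  obtain H where H: "H \<in> carrier_mat n n" "H\<^sup>T = H" "H * H = 1\<^sub>m n" "H *\<^sub>v v = unit_vec n 0"
    using Householder_reflection[OF v _ vv] n by blast
  define A' where "A' = H * A * H"
  have A': "A' \<in> carrier_mat n n" using H A by (simp add: A'_def)
  have symA': "A'\<^sup>T = A'"
    using H A sym by (simp add: A'_def transpose_mult[of _ n n _ n] assoc_mult_mat[of _ n n _ n _ n])
  have "H *\<^sub>v unit_vec n 0 = (H * H) *\<^sub>v v" using H v by (metis assoc_mult_mat_vec)
  then have Hu: "H *\<^sub>v unit_vec n 0 = v" using H v by simp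
  have "A' *\<^sub>v unit_vec n 0 = H *\<^sub>v (A *\<^sub>v (H *\<^sub>v unit_vec n 0))"
    unfolding A'_def using H A by (simp add: assoc_mult_mat_vec[of _ n n _ n])
  also have "\<dots> = e \<cdot>\<^sub>v unit_vec n 0" unfolding Hu Av using mult_mat_vec[OF H(1) v] H(4) by simp
  finally have A'u: "A' *\<^sub>v unit_vec n 0 = e \<cdot>\<^sub>v unit_vec n 0" .
  have col0: "A' $$ (i, 0) = (if i = 0 then e else 0)" if "i < n" for i
    using arg_cong[OF A'u, of "\<lambda>u. u $ i"] that A' n by simp
  have row0: "A' $$ (0, i) = (if i = 0 then e else 0)" if "i < n" for i
    using col0[OF that] arg_cong[OF symA', of "\<lambda>B. B $$ (i, 0)"] that A' n by simp
  define A3 where "A3 = mat m m (\<lambda>(i, j). A' $$ (Suc i, Suc j))"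
  have A3: "A3 \<in> carrier_mat m m" by (simp add: A3_def)
  let ?e = "mat 1 1 (\<lambda>_. e)"
  have blk: "A' = four_block_mat ?e (0\<^sub>m 1 m) (0\<^sub>m m 1) A3"
  proof (rule eq_matI)
    fix i j assume "i < dim_row (four_block_mat ?e (0\<^sub>m 1 m) (0\<^sub>m m 1) A3)"
      "j < dim_col (four_block_mat ?e (0\<^sub>m 1 m) (0\<^sub>m m 1) A3)"
    then have "i < n" "j < n" using n by (auto simp: A3_def)
    then show "A' $$ (i, j) = four_block_mat ?e (0\<^sub>m 1 m) (0\<^sub>m m 1) A3 $$ (i, j)"
      using col0[of i] row0[of j] n by (cases i; cases j) (auto simp: A3_def)
  qed (use A' n in \<open>auto simp: A3_def\<close>)
  have sym3: "A3\<^sup>T = A3"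
  proof (rule eq_matI)
    fix i j assume "i < dim_row A3" "j < dim_col A3"
    then have "i < m" "j < m" by (auto simp: A3_def)
    then show "A3\<^sup>T $$ (i, j) = A3 $$ (i, j)"
      using arg_cong[OF symA', of "\<lambda>B. B $$ (Suc i, Suc j)"] A' n by (simp add: A3_def)
  qed (auto simp: A3_def)
  have "similar_mat_wit A' A H H" by (rule similar_mat_witI[OF H(3,3) A'_def A' A H(1,1)])
  then have "similar_mat A' A" unfolding similar_mat_def by blast
  then have "char_poly A = char_poly A'" using char_poly_similar by metis
  also have "\<dots> = char_poly ?e * char_poly A3"
    unfolding blk by (rule char_poly_four_block_zeros_col) (use A3 in auto)
  also have "char_poly ?e = [:- e, 1:]"
    by (subst char_poly_upper_triangular[of _ 1]) (auto simp: diag_mat_def)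
  finally have "[:- e, 1:] * char_poly A3 = [:- e, 1:] * (\<Prod>e\<leftarrow>es. [:- e, 1:])" using cp by simp
  then have "char_poly A3 = (\<Prod>e\<leftarrow>es. [:- e, 1:])" by (subst (asm) mult_cancel_left) auto
  from Cons.IH[OF A3 sym3 this] obtain Q3 where Q3: "Q3 \<in> carrier_mat m m" "Q3\<^sup>T * Q3 = 1\<^sub>m m"
    "Q3\<^sup>T * A3 * Q3 = mat m m (\<lambda>(i, j). if i = j then es ! i else 0)" by blast
  define F where "F = four_block_mat (1\<^sub>m 1) (0\<^sub>m 1 m) (0\<^sub>m m 1) Q3"
  have F: "F \<in> carrier_mat n n" unfolding F_def n
    using four_block_carrier_mat[of "1\<^sub>m 1" 1 1 Q3 m m] Q3(1) by simp
  have FT: "F\<^sup>T = four_block_mat (1\<^sub>m 1) (0\<^sub>m 1 m) (0\<^sub>m m 1) Q3\<^sup>T"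
    unfolding F_def using Q3(1) by (subst transpose_four_block_mat[of _ 1 1 _ m _ m]) auto
  have FF: "F\<^sup>T * F = 1\<^sub>m n"
    unfolding FT unfolding F_def n
    by (subst mult_four_block_mat[of _ 1 1 _ m _ m _ _ 1 _ m]) (use Q3 in auto)
  have "F\<^sup>T * A' = four_block_mat ?e (0\<^sub>m 1 m) (0\<^sub>m m 1) (Q3\<^sup>T * A3)"
    unfolding FT blk
    by (subst mult_four_block_mat[of _ 1 1 _ m _ m _ _ 1 _ m]) (use Q3 A3 in auto)
  then have "F\<^sup>T * A' * F = four_block_mat ?e (0\<^sub>m 1 m) (0\<^sub>m m 1) (Q3\<^sup>T * A3) * F" by simp
  also have "\<dots> = four_block_mat ?e (0\<^sub>m 1 m) (0\<^sub>m m 1) (Q3\<^sup>T * A3 * Q3)"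
    unfolding F_def
    by (subst mult_four_block_mat[of _ 1 1 _ m _ m _ _ 1 _ m]) (use Q3(1) A3 in auto)
  also have "\<dots> = mat n n (\<lambda>(i, j). if i = j then (e # es) ! i else 0)"
    unfolding Q3(3) by (rule eq_matI) (auto simp: n nth_Cons')
  finally have FAF: "F\<^sup>T * A' * F = mat n n (\<lambda>(i, j). if i = j then (e # es) ! i else 0)" .
  have HF: "H * F \<in> carrier_mat n n" using H F by simp
  have T: "(H * F)\<^sup>T = F\<^sup>T * H" using transpose_mult[OF H(1) F] H(2) by simp
  have FT_carr: "F\<^sup>T \<in> carrier_mat n n" using F by simp
  have "(H * F)\<^sup>T * (H * F) = F\<^sup>T * (H * H) * F"
    unfolding T using H(1) F FT_carr by (simp add: assoc_mult_mat[of _ n n _ n _ n])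
  then have 1: "(H * F)\<^sup>T * (H * F) = 1\<^sub>m n" unfolding H(3) using FF FT_carr by simp
  have "(H * F)\<^sup>T * A * (H * F) = F\<^sup>T * A' * F"
    unfolding T A'_def using H A F FT_carr by (simp add: assoc_mult_mat[of _ n n _ n _ n])
  with FAF 1 HF show ?case by auto
qed

text \<open>\<open>proots\<close> counts real roots only; the splitting over the reals makes the
  list complete, with \<open>n\<close> entries.\<close>

lemma eigs_desc_symmetric:
  assumes A: "(A :: real mat) \<in> carrier_mat n n" and sym: "A\<^sup>T = A"
  shows "length (eigs_desc A) = n" "char_poly A = (\<Prod>e\<leftarrow>eigs_desc A. [:- e, 1:])"
    "\<And>i j. i \<le> j \<Longrightarrow> j < n \<Longrightarrow> eigs_desc A ! j \<le> eigs_desc A ! i"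
proof -
  obtain es where es: "char_poly A = (\<Prod>e\<leftarrow>es. [:- e, 1:])" "length es = n"
    using char_poly_symmetric_real_splits[OF A sym] by blast
  have "proots (\<Prod>e\<leftarrow>bs. [:- e, 1 :: real:]) = mset bs" for bs
  proof (induction bs)
    case (Cons b bs)
    have "(\<Prod>e\<leftarrow>bs. [:- e, 1 :: real:]) \<noteq> 0" by (auto simp: prod_list_zero_iff)
    then show ?case using Cons by (simp only: list.map prod_list.Cons, subst proots_mult) auto
  qed simp
  then have m: "mset (eigs_desc A) = mset es" by (simp add: eigs_desc_def es(1))
  then show len: "length (eigs_desc A) = n" using es(2) by (metis size_mset)
  have "mset (map (\<lambda>e. [:- e, 1:]) (eigs_desc A)) = mset (map (\<lambda>e. [:- e, 1:]) es)" using m by simp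
  then show "char_poly A = (\<Prod>e\<leftarrow>eigs_desc A. [:- e, 1:])"
    unfolding es(1) by (simp only: prod_mset_prod_list[symmetric])
  have "sorted (rev (eigs_desc A))" by (simp add: eigs_desc_def)
  from sorted_rev_nth_mono[OF this]
  show "\<And>i j. i \<le> j \<Longrightarrow> j < n \<Longrightarrow> eigs_desc A ! j \<le> eigs_desc A ! i" unfolding len .
qed

text \<open>Filled up with zero rows the system becomes square. Row \<open>P\<close> is among the
  zero rows, so the transpose kills the unit vector of index \<open>P\<close> and the determinant
  vanishes.\<close>

lemma homogeneous_system_nontrivial_solution:
  fixes G :: "nat \<Rightarrow> nat \<Rightarrow> real"
  assumes "P < m"
  obtains c where "c \<in> carrier_vec m" "c \<noteq> 0\<^sub>v m" "\<And>l. l < P \<Longrightarrow> (\<Sum>j = 0..<m. G l j * c $ j) = 0"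
proof -
  let ?G = "mat m m (\<lambda>(l, j). if l < P then G l j else 0)"
  have G: "?G \<in> carrier_mat m m" by simp
  have "?G\<^sup>T *\<^sub>v unit_vec m P = 0\<^sub>v m"
    using assms by (intro eq_vecI) auto
  moreover have "unit_vec m P \<noteq> (0\<^sub>v m :: real vec)"
    using arg_cong[of "unit_vec m P" "0\<^sub>v m :: real vec" "\<lambda>u. u $ P"] assms by auto
  ultimately have "\<exists>v. v \<in> carrier_vec m \<and> v \<noteq> 0\<^sub>v m \<and> ?G\<^sup>T *\<^sub>v v = 0\<^sub>v m"
    by (intro exI[of _ "unit_vec m P"]) simp
  then have "det ?G\<^sup>T = 0" using det_0_iff_vec_prod_zero[of "?G\<^sup>T" m] by simp
  then have "det ?G = 0" using det_transpose[OF G] by simp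
  then obtain c where c: "c \<in> carrier_vec m" "c \<noteq> 0\<^sub>v m" "?G *\<^sub>v c = 0\<^sub>v m"
    using det_0_iff_vec_prod_zero[OF G] by blast
  have "(\<Sum>j = 0..<m. G l j * c $ j) = 0" if "l < P" for l
    using arg_cong[OF c(3), of "\<lambda>u. u $ l"] that assms c(1) by (simp add: scalar_prod_def)
  with c that show thesis by blast
qed

section \<open>Quadratic forms in eigenvector coordinates and the min-max bound\<close>

lemma scalar_prod_diag:
  assumes "d \<in> carrier_vec n"
  shows "d \<bullet> (mat n n (\<lambda>(i, j). if i = j then f i else 0) *\<^sub>v d) = (\<Sum>i = 0..<n. f i * (d $ i * d $ i) :: real)"
proof -
  have "(mat n n (\<lambda>(i, j). if i = j then f i else 0) *\<^sub>v d) $ i = f i * d $ i" if "i < n" for i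
  proof -
    have "(mat n n (\<lambda>(i, j). if i = j then f i else 0) *\<^sub>v d) $ i = (\<Sum>j = 0..<n. (if i = j then f i else 0) * d $ j)"
      using that assms by (simp add: scalar_prod_def)
    also have "\<dots> = (\<Sum>j = 0..<n. if i = j then f i * d $ j else 0)" by (intro sum.cong refl) simp
    also have "\<dots> = f i * d $ i" using that by simp
    finally show ?thesis .
  qed
  then show ?thesis unfolding scalar_prod_def by (intro sum.cong) (auto simp del: index_mult_mat_vec)
qed

lemma orthogonal_change_of_basis:
  assumes A: "(A :: real mat) \<in> carrier_mat n n" and Q: "Q \<in> carrier_mat n n" "Q\<^sup>T * Q = 1\<^sub>m n"
    and d: "d \<in> carrier_vec n"
  shows "(Q *\<^sub>v d) \<bullet> (Q *\<^sub>v d) = d \<bullet> d" "(Q *\<^sub>v d) \<bullet> (A *\<^sub>v (Q *\<^sub>v d)) = d \<bullet> ((Q\<^sup>T * A * Q) *\<^sub>v d)"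
proof -
  have *: "(Q *\<^sub>v d) \<bullet> u = d \<bullet> (Q\<^sup>T *\<^sub>v u)" if "u \<in> carrier_vec n" for u
  proof -
    have "(Q *\<^sub>v d) \<bullet> u = u \<bullet> (Q *\<^sub>v d)" using Q d that by (intro comm_scalar_prod[of _ n]) auto
    also have "\<dots> = (Q\<^sup>T *\<^sub>v u) \<bullet> d" using transpose_vec_mult_scalar[OF Q(1) d that] by simp
    also have "\<dots> = d \<bullet> (Q\<^sup>T *\<^sub>v u)" using Q d that by (intro comm_scalar_prod[of _ n]) auto
    finally show ?thesis .
  qed
  have "(Q *\<^sub>v d) \<bullet> (Q *\<^sub>v d) = d \<bullet> ((Q\<^sup>T * Q) *\<^sub>v d)"
    using * Q(1) d by (simp add: assoc_mult_mat_vec[of _ n n _ n])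
  then show "(Q *\<^sub>v d) \<bullet> (Q *\<^sub>v d) = d \<bullet> d" using Q d by simp
  show "(Q *\<^sub>v d) \<bullet> (A *\<^sub>v (Q *\<^sub>v d)) = d \<bullet> ((Q\<^sup>T * A * Q) *\<^sub>v d)"
    using * A Q(1) d by (simp add: assoc_mult_mat_vec[of _ n n _ n])
qed

lemma eigs_desc_nonneg:
  assumes A: "A \<in> carrier_mat n n" and psd: "psd_mat A" and i: "i < n"
  shows "eigs_desc A ! i \<ge> 0"
proof -
  have sym: "A\<^sup>T = A" using psd by (simp add: psd_mat_def)
  obtain Q where Q: "Q \<in> carrier_mat n n" "Q\<^sup>T * Q = 1\<^sub>m n"
    "Q\<^sup>T * A * Q = mat n n (\<lambda>(i, j). if i = j then eigs_desc A ! i else 0)"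
    using symmetric_real_diagonalizable[OF A sym eigs_desc_symmetric(2)[OF A sym]] by blast
  let ?d = "unit_vec n i :: real vec"
  have "0 \<le> (Q *\<^sub>v ?d) \<bullet> (A *\<^sub>v (Q *\<^sub>v ?d))" using psd A Q(1) by (simp add: psd_mat_def)
  also have "\<dots> = (\<Sum>j = 0..<n. eigs_desc A ! j * (?d $ j * ?d $ j))"
    using orthogonal_change_of_basis(2)[OF A Q(1,2), of ?d] Q(3) scalar_prod_diag[of ?d n "\<lambda>j. eigs_desc A ! j"] by simp
  also have "\<dots> = (\<Sum>j = 0..<n. if j = i then eigs_desc A ! j else 0)"
    using i by (intro sum.cong) auto
  also have "\<dots> = eigs_desc A ! i" using i by simp
  finally show ?thesis .
qed

text \<open>One half of Courant-Fischer: the span of the first \<open>i + 1\<close> eigenvectors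
  meets any subspace cut out by \<open>P \<le> i\<close> linear conditions in a nonzero vector, and
  on that span the form is at least \<open>eigs_desc A ! i\<close> times the squared norm.\<close>

lemma eigs_desc_le_on_subspace:
  fixes A :: "real mat" and g :: "nat \<Rightarrow> nat \<Rightarrow> real"
  assumes A: "A \<in> carrier_mat n n" and sym: "A\<^sup>T = A" and i: "i < n" and P: "P \<le> i"
    and le: "\<And>v. v \<in> carrier_vec n \<Longrightarrow> (\<And>l. l < P \<Longrightarrow> (\<Sum>j = 0..<n. g l j * v $ j) = 0) \<Longrightarrow> v \<bullet> (A *\<^sub>v v) \<le> c * (v \<bullet> v)"
  shows "eigs_desc A ! i \<le> c"
proof -
  let ?es = "eigs_desc A"
  obtain Q where Q: "Q \<in> carrier_mat n n" "Q\<^sup>T * Q = 1\<^sub>m n"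
    "Q\<^sup>T * A * Q = mat n n (\<lambda>(i, j). if i = j then ?es ! i else 0)"
    using symmetric_real_diagonalizable[OF A sym eigs_desc_symmetric(2)[OF A sym]] by blast
  \<comment> \<open>The conditions are pulled back to eigenvector coordinates. There are
    \<open>i + 1\<close> unknowns, hence more than conditions.\<close>
  obtain b where b: "b \<in> carrier_vec (Suc i)" "b \<noteq> 0\<^sub>v (Suc i)"
    "\<And>l. l < P \<Longrightarrow> (\<Sum>j = 0..<Suc i. (\<Sum>k = 0..<n. g l k * Q $$ (k, j)) * b $ j) = 0"
    using homogeneous_system_nontrivial_solution[OF le_imp_less_Suc[OF P],
        of "\<lambda>l j. \<Sum>k = 0..<n. g l k * Q $$ (k, j)"] by blast
  define d where "d = vec n (\<lambda>j. if j < Suc i then b $ j else 0)"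
  have d: "d \<in> carrier_vec n" by (simp add: d_def)
  have "d \<noteq> 0\<^sub>v n"
  proof
    assume d0: "d = 0\<^sub>v n"
    have "b = 0\<^sub>v (Suc i)"
    proof (rule eq_vecI)
      fix j assume "j < dim_vec (0\<^sub>v (Suc i) :: real vec)"
      then show "b $ j = 0\<^sub>v (Suc i) $ j"
        using arg_cong[OF d0, of "\<lambda>u. u $ j"] i by (simp add: d_def)
    qed (use b in auto)
    with b(2) show False ..
  qed
  then have dd: "d \<bullet> d > 0" using real_scalar_prod_self[OF d] by linarith
  let ?v = "Q *\<^sub>v d"
  have v: "?v \<in> carrier_vec n" using Q d by simp
  have "?v \<bullet> (A *\<^sub>v ?v) \<le> c * (?v \<bullet> ?v)"
  proof (rule le[OF v])
    fix l assume l: "l < P"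
    have "(\<Sum>k = 0..<n. g l k * ?v $ k) = (\<Sum>k = 0..<n. \<Sum>j = 0..<n. g l k * (Q $$ (k, j) * d $ j))"
      using Q(1) d by (simp add: scalar_prod_def sum_distrib_left)
    also have "\<dots> = (\<Sum>j = 0..<n. \<Sum>k = 0..<n. g l k * (Q $$ (k, j) * d $ j))" by (rule sum.swap)
    also have "\<dots> = (\<Sum>j = 0..<n. (\<Sum>k = 0..<n. g l k * Q $$ (k, j)) * d $ j)"
      by (simp add: sum_distrib_right mult.assoc)
    also have "\<dots> = (\<Sum>j = 0..<Suc i. (\<Sum>k = 0..<n. g l k * Q $$ (k, j)) * b $ j)"
      using i by (intro sum.mono_neutral_cong_right) (auto simp: d_def)
    finally show "(\<Sum>k = 0..<n. g l k * ?v $ k) = 0" using b(3)[OF l] by simp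
  qed
  moreover have "?v \<bullet> (A *\<^sub>v ?v) = (\<Sum>j = 0..<n. ?es ! j * (d $ j * d $ j))"
    using orthogonal_change_of_basis(2)[OF A Q(1,2) d] Q(3) scalar_prod_diag[OF d, of "\<lambda>j. ?es ! j"] by simp
  moreover have "(\<Sum>j = 0..<n. ?es ! j * (d $ j * d $ j)) \<ge> (\<Sum>j = 0..<n. ?es ! i * (d $ j * d $ j))"
  proof (rule sum_mono)
    fix j assume j: "j \<in> {0..<n}"
    show "?es ! i * (d $ j * d $ j) \<le> ?es ! j * (d $ j * d $ j)"
    proof (cases "j < Suc i")
      case True
      then have "?es ! i \<le> ?es ! j" using eigs_desc_symmetric(3)[OF A sym] i by simp
      then show ?thesis by (rule mult_right_mono) simp
    next
      case False
      then show ?thesis using j by (simp add: d_def)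
    qed
  qed
  moreover have "(\<Sum>j = 0..<n. ?es ! i * (d $ j * d $ j)) = ?es ! i * (d \<bullet> d)"
    using d by (simp add: scalar_prod_def sum_distrib_left)
  ultimately have "?es ! i * (d \<bullet> d) \<le> c * (d \<bullet> d)"
    using orthogonal_change_of_basis(1)[OF A Q(1,2) d] by simp
  then show ?thesis using dd by simp
qed

section \<open>Determinants and eigenvalues of the kernel matrix\<close>

lemma bigo_at_0_mult_self: "(\<lambda>\<epsilon>::real. \<epsilon> * \<epsilon>) \<in> O[at 0](\<lambda>\<epsilon>. \<epsilon>)"
proof (rule bigoI[of _ 1])
  have "norm (\<epsilon> * \<epsilon>) \<le> 1 * norm \<epsilon>" if "\<bar>\<epsilon>\<bar> < 1" for \<epsilon> :: real
    unfolding norm_mult using that by (intro mult_right_mono) auto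
  then show "\<forall>\<^sub>F \<epsilon> in at 0. norm (\<epsilon> * \<epsilon>) \<le> 1 * norm (\<epsilon>::real)"
    unfolding eventually_at by (intro exI[of _ 1]) (simp add: dist_real_def)
qed

lemma prod_minus_const_bigo:
  fixes f :: "'b \<Rightarrow> real \<Rightarrow> real"
  assumes "finite I" "\<And>i. i \<in> I \<Longrightarrow> (\<lambda>\<epsilon>. f i \<epsilon> - c i) \<in> O[at 0](\<lambda>\<epsilon>. \<epsilon>)"
  shows "(\<lambda>\<epsilon>. (\<Prod>i\<in>I. f i \<epsilon>) - (\<Prod>i\<in>I. c i)) \<in> O[at 0](\<lambda>\<epsilon>. \<epsilon>)"
  using assms
proof (induction I)
  case (insert a I)
  let ?P = "\<lambda>\<epsilon>. \<Prod>i\<in>I. f i \<epsilon>" and ?C = "\<Prod>i\<in>I. c i"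
  have a: "(\<lambda>\<epsilon>. f a \<epsilon> - c a) \<in> O[at 0](\<lambda>\<epsilon>. \<epsilon>)" and I: "(\<lambda>\<epsilon>. ?P \<epsilon> - ?C) \<in> O[at 0](\<lambda>\<epsilon>. \<epsilon>)"
    using insert by auto
  have "(\<lambda>\<epsilon>. (f a \<epsilon> - c a) * (?P \<epsilon> - ?C)) \<in> O[at 0](\<lambda>\<epsilon>. \<epsilon>)"
    by (rule landau_o.big.trans[OF landau_o.big.mult[OF a I] bigo_at_0_mult_self])
  \<comment> \<open>The difference of products is the product of the two differences plus each
    difference times the limit of the other factor.\<close>
  then have "(\<lambda>\<epsilon>. (f a \<epsilon> - c a) * (?P \<epsilon> - ?C) + (?C * (f a \<epsilon> - c a) + c a * (?P \<epsilon> - ?C))) \<in> O[at 0](\<lambda>\<epsilon>. \<epsilon>)"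
    using a I by (intro sum_in_bigo landau_o.big.cmult_in_iff') (auto intro: sum_in_bigo)
  also have "(\<lambda>\<epsilon>. (f a \<epsilon> - c a) * (?P \<epsilon> - ?C) + (?C * (f a \<epsilon> - c a) + c a * (?P \<epsilon> - ?C)))
      = (\<lambda>\<epsilon>. (\<Prod>i\<in>insert a I. f i \<epsilon>) - (\<Prod>i\<in>insert a I. c i))"
    using insert.hyps by (simp add: algebra_simps)
  finally show ?case .
qed simp

lemma det_minus_const_bigo:
  fixes f :: "nat \<Rightarrow> nat \<Rightarrow> real \<Rightarrow> real"
  assumes "\<And>i j. i < n \<Longrightarrow> j < n \<Longrightarrow> (\<lambda>\<epsilon>. f i j \<epsilon> - C $$ (i, j)) \<in> O[at 0](\<lambda>\<epsilon>. \<epsilon>)"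
    and C: "C \<in> carrier_mat n n"
  shows "(\<lambda>\<epsilon>. det (mat n n (\<lambda>(i, j). f i j \<epsilon>)) - det C) \<in> O[at 0](\<lambda>\<epsilon>. \<epsilon>)"
proof -
  have "(\<lambda>\<epsilon>. (\<Prod>i = 0..<n. f i (p i) \<epsilon>) - (\<Prod>i = 0..<n. C $$ (i, p i))) \<in> O[at 0](\<lambda>\<epsilon>. \<epsilon>)"
    if p: "p permutes {0..<n}" for p
  proof (rule prod_minus_const_bigo)
    fix i assume i: "i \<in> {0..<n}"
    then have "p i \<in> {0..<n}" using permutes_in_image[OF p] by blast
    with i assms(1) show "(\<lambda>\<epsilon>. f i (p i) \<epsilon> - C $$ (i, p i)) \<in> O[at 0](\<lambda>\<epsilon>. \<epsilon>)" by simp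
  qed simp
  then have "(\<lambda>\<epsilon>. \<Sum>p | p permutes {0..<n}. signof p * ((\<Prod>i = 0..<n. f i (p i) \<epsilon>) - (\<Prod>i = 0..<n. C $$ (i, p i))))
      \<in> O[at 0](\<lambda>\<epsilon>. \<epsilon>)"
    by (intro big_sum_in_bigo) auto
  moreover have "det (mat n n (\<lambda>(i, j). f i j \<epsilon>)) - det C
      = (\<Sum>p | p permutes {0..<n}. signof p * ((\<Prod>i = 0..<n. f i (p i) \<epsilon>) - (\<Prod>i = 0..<n. C $$ (i, p i))))" for \<epsilon>
  proof -
    have "det (mat n n (\<lambda>(i, j). f i j \<epsilon>)) = (\<Sum>p | p permutes {0..<n}. signof p * (\<Prod>i = 0..<n. f i (p i) \<epsilon>))"
    proof (subst det_def'[of _ n], simp, intro sum.cong refl arg_cong2[where f = "(*)"] prod.cong)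
      fix p i assume p: "p \<in> {p. p permutes {0..<n}}" and i: "i \<in> {0..<n}"
      then have "p i \<in> {0..<n}" using permutes_in_image[of p] by blast
      with i show "mat n n (\<lambda>(i, j). f i j \<epsilon>) $$ (i, p i) = f i (p i) \<epsilon>" by simp
    qed
    then show ?thesis by (simp only: det_def'[OF C] sum_subtractf right_diff_distrib)
  qed
  ultimately show ?thesis by simp
qed

text \<open>A permutation meets every row and every column once, so each Leibniz term collects all
  weights \<open>d\<close> exactly twice.\<close>

lemma det_scaled_rows_cols:
  fixes f :: "nat \<Rightarrow> nat \<Rightarrow> real"
  shows "det (mat n n (\<lambda>(i, j). z ^ (d i + d j) * f i j)) = z ^ (2 * (\<Sum>i<n. d i)) * det (mat n n (\<lambda>(i, j). f i j))"
proof -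
  have "(\<Prod>i = 0..<n. mat n n (\<lambda>(i, j). z ^ (d i + d j) * f i j) $$ (i, p i))
      = z ^ (2 * (\<Sum>i<n. d i)) * (\<Prod>i = 0..<n. mat n n (\<lambda>(i, j). f i j) $$ (i, p i))"
    if p: "p permutes {0..<n}" for p
  proof -
    have pi: "p i < n" if "i < n" for i using permutes_in_image[OF p, of i] that by simp
    have "(\<Sum>i = 0..<n. d (p i)) = (\<Sum>i = 0..<n. d i)" using sum.permute[OF p, of d] by (simp add: o_def)
    then have d: "(\<Sum>i = 0..<n. d i + d (p i)) = 2 * (\<Sum>i<n. d i)"
      by (simp add: sum.distrib atLeast0LessThan)
    have "(\<Prod>i = 0..<n. mat n n (\<lambda>(i, j). z ^ (d i + d j) * f i j) $$ (i, p i)) = (\<Prod>i = 0..<n. z ^ (d i + d (p i)) * f i (p i))"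
      using pi by (intro prod.cong) auto
    also have "\<dots> = z ^ (2 * (\<Sum>i<n. d i)) * (\<Prod>i = 0..<n. f i (p i))"
      by (simp only: prod.distrib power_sum[symmetric] d)
    also have "(\<Prod>i = 0..<n. f i (p i)) = (\<Prod>i = 0..<n. mat n n (\<lambda>(i, j). f i j) $$ (i, p i))"
      using pi by (intro prod.cong) auto
    finally show ?thesis .
  qed
  then show ?thesis
    by (subst (1 2) det_def'[of _ n]) (auto simp: sum_distrib_left mult_ac intro!: sum.cong)
qed

section \<open>Congruence with a staircase matrix\<close>

lemma index_congruence_mat:
  fixes A M :: "real mat"
  assumes "A \<in> carrier_mat n m" "M \<in> carrier_mat m m" "p < n" "q < n"
  shows "(A * M * A\<^sup>T) $$ (p, q) = (\<Sum>a<m. \<Sum>b<m. A $$ (p, a) * A $$ (q, b) * M $$ (a, b))"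
proof -
  have "(A * M * A\<^sup>T) $$ (p, q) = (\<Sum>b = 0..<m. (\<Sum>a = 0..<m. A $$ (p, a) * M $$ (a, b)) * A $$ (q, b))"
    using assms by (simp add: scalar_prod_def del: assoc_mult_mat)
  also have "\<dots> = (\<Sum>b<m. \<Sum>a<m. A $$ (p, a) * A $$ (q, b) * M $$ (a, b))"
    by (simp only: sum_distrib_right atLeast0LessThan) (simp only: mult_ac)
  also have "\<dots> = (\<Sum>a<m. \<Sum>b<m. A $$ (p, a) * A $$ (q, b) * M $$ (a, b))" by (rule sum.swap)
  finally show ?thesis .
qed

lemma det_congruence:
  assumes "(A :: real mat) \<in> carrier_mat n n" "M \<in> carrier_mat n n"
  shows "det (A * M * A\<^sup>T) = (det A)\<^sup>2 * det M"
  using assms det_mult[of "A * M" n "A\<^sup>T"] det_mult[of A n M] det_transpose[of A n]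
  by (simp add: power2_eq_square)

text \<open>\<open>d p\<close> is the order to which row \<open>p\<close> of \<open>T\<close>
  annihilates monomials. After division of entry \<open>(p, q)\<close> by
  \<open>\<epsilon> ^ (d p + d q)\<close> only the part of row \<open>p\<close> with columns of
  degree exactly \<open>d p\<close> survives in the limit; it forms \<open>Y\<close>. The factor
  \<open>(det T)^2\<close> stays on the left, so that \<open>T\<close> can be chosen case by
  case.\<close>

lemma kernel_det_expansion:
  fixes K :: "real^'d::finite \<Rightarrow> real^'d \<Rightarrow> real" and x :: "nat \<Rightarrow> real^'d" and e :: "nat \<Rightarrow> 'd \<Rightarrow> nat"
  assumes \<Omega>: "open \<Omega>" "0 \<in> \<Omega>" and K: "Ckk (Suc k) \<Omega> K"
    and e: "bij_betw e {..<N} (PP k)" and T: "T \<in> carrier_mat n n"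
    and d: "\<And>p. p < n \<Longrightarrow> d p \<le> k"
    and stair: "\<And>p a. p < n \<Longrightarrow> a < N \<Longrightarrow> mi_deg (e a) < d p \<Longrightarrow> (\<Sum>i<n. T $$ (p, i) * mono_pow (x i) (e a)) = 0"
    and Y: "Y \<in> carrier_mat n N"
      "\<And>p a. p < n \<Longrightarrow> a < N \<Longrightarrow> Y $$ (p, a) = (if mi_deg (e a) = d p then \<Sum>i<n. T $$ (p, i) * mono_pow (x i) (e a) else 0)"
  shows "(\<lambda>\<epsilon>. (det T)\<^sup>2 * det (Keps K n x \<epsilon>) - \<epsilon> ^ (2 * (\<Sum>p<n. d p)) * det (Y * Wmat K e N * Y\<^sup>T))
    \<in> O[at 0](\<lambda>\<epsilon>. \<epsilon> ^ (2 * (\<Sum>p<n. d p) + 1))"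
proof -
  \<comment> \<open>Since \<open>d p \<le> k\<close>, every multi-index of degree below
    \<open>d p\<close> is listed by \<open>e\<close>.\<close>
  have stair': "(\<Sum>i<n. T $$ (p, i) * mono_pow (x i) \<alpha>) = 0" if "p < n" "mi_deg \<alpha> < d p" for p \<alpha>
  proof -
    have "\<alpha> \<in> PP k" using that d[of p] by (simp add: PP_def)
    then obtain a where "a < N" "\<alpha> = e a" using e by (auto simp: bij_betw_def)
    with stair that show ?thesis by simp
  qed
  let ?W = "Wmat K e N"
  let ?L = "Y * ?W * Y\<^sup>T"
  have W: "?W \<in> carrier_mat N N" by (simp add: Wmat_def)
  have L: "?L \<in> carrier_mat n n" using Y(1) W by simp
  obtain C \<delta> :: real where C: "C \<ge> 0" "\<delta> > 0" and exp:
    "\<And>\<epsilon> v w s t. \<bar>\<epsilon>\<bar> < \<delta> \<Longrightarrow> s \<le> k \<Longrightarrow> t \<le> k \<Longrightarrow> vanishing_moments n x s v \<Longrightarrow> vanishing_moments n x t w \<Longrightarrow>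
      \<bar>kernel_form K n x v w \<epsilon> - \<epsilon> ^ (s + t) * leading_form K n x s t v w\<bar>
      \<le> C * (\<Sum>i<n. \<bar>v i\<bar>) * (\<Sum>j<n. \<bar>w j\<bar>) * \<bar>\<epsilon>\<bar> ^ Suc (s + t)"
    using kernel_form_expansion[OF \<Omega> K, where n = n and x = x] by metis
  define B where "B \<epsilon> p q = kernel_form K n x (\<lambda>i. T $$ (p, i)) (\<lambda>j. T $$ (q, j)) \<epsilon>" for \<epsilon> p q
  have leading: "leading_form K n x (d p) (d q) (\<lambda>i. T $$ (p, i)) (\<lambda>j. T $$ (q, j)) = ?L $$ (p, q)"
    if pq: "p < n" "q < n" for p q
  proof -
    define A where "A p \<alpha> = (\<Sum>i<n. T $$ (p, i) * mono_pow (x i) \<alpha>)" for p \<alpha>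
    define Z where "Z p \<alpha> = (if mi_deg \<alpha> = d p then A p \<alpha> else 0)" for p \<alpha>
    define w where "w \<alpha> \<beta> = Kderiv K \<alpha> \<beta> 0 0 / (mi_fact \<alpha> * mi_fact \<beta>)" for \<alpha> \<beta>
    have "?L $$ (p, q) = (\<Sum>a<N. \<Sum>b<N. Z p (e a) * Z q (e b) * w (e a) (e b))"
      using pq by (subst index_congruence_mat[OF Y(1) W pq], intro sum.cong refl)
        (simp add: Y(2) Z_def A_def w_def Wmat_def)
    also have "\<dots> = (\<Sum>\<alpha>\<in>PP k. \<Sum>\<beta>\<in>PP k. Z p \<alpha> * Z q \<beta> * w \<alpha> \<beta>)"
    proof -
      have "(\<Sum>b<N. Z p \<alpha> * Z q (e b) * w \<alpha> (e b)) = (\<Sum>\<beta>\<in>PP k. Z p \<alpha> * Z q \<beta> * w \<alpha> \<beta>)" for \<alpha>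
        by (rule sum.reindex_bij_betw[OF e, of "\<lambda>\<beta>. Z p \<alpha> * Z q \<beta> * w \<alpha> \<beta>"])
      then show ?thesis
        using sum.reindex_bij_betw[OF e, of "\<lambda>\<alpha>. \<Sum>\<beta>\<in>PP k. Z p \<alpha> * Z q \<beta> * w \<alpha> \<beta>"] by simp
    qed
    also have "\<dots> = (\<Sum>\<alpha> | mi_deg \<alpha> = d p. \<Sum>\<beta> | mi_deg \<beta> = d q. A p \<alpha> * A q \<beta> * w \<alpha> \<beta>)"
    proof (rule sum.mono_neutral_cong_right)
      fix \<alpha> :: "'d \<Rightarrow> nat" assume "\<alpha> \<in> {\<alpha>. mi_deg \<alpha> = d p}"
      then show "(\<Sum>\<beta>\<in>PP k. Z p \<alpha> * Z q \<beta> * w \<alpha> \<beta>) = (\<Sum>\<beta> | mi_deg \<beta> = d q. A p \<alpha> * A q \<beta> * w \<alpha> \<beta>)"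
        by (intro sum.mono_neutral_cong_right) (use d[OF pq(2)] finite_PP in \<open>auto simp: PP_def Z_def\<close>)
    qed (use d[OF pq(1)] finite_PP in \<open>auto simp: PP_def Z_def\<close>)
    finally show ?thesis by (simp only: A_def w_def leading_form_def)
  qed
  have entry: "(\<lambda>\<epsilon>. B \<epsilon> p q / \<epsilon> ^ (d p + d q) - ?L $$ (p, q)) \<in> O[at 0](\<lambda>\<epsilon>. \<epsilon>)" if pq: "p < n" "q < n" for p q
  proof -
    let ?c = "C * (\<Sum>i<n. \<bar>T $$ (p, i)\<bar>) * (\<Sum>j<n. \<bar>T $$ (q, j)\<bar>)"
    have *: "\<bar>B \<epsilon> p q / \<epsilon> ^ (d p + d q) - ?L $$ (p, q)\<bar> \<le> ?c * \<bar>\<epsilon>\<bar>" if \<epsilon>: "\<epsilon> \<noteq> 0" "\<bar>\<epsilon>\<bar> < \<delta>" for \<epsilon>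
    proof -
      have "\<bar>B \<epsilon> p q - \<epsilon> ^ (d p + d q) * ?L $$ (p, q)\<bar> \<le> ?c * \<bar>\<epsilon>\<bar> ^ Suc (d p + d q)"
        unfolding B_def leading[OF pq, symmetric]
        by (rule exp[OF \<epsilon>(2) d[OF pq(1)] d[OF pq(2)]]) (use stair' pq in \<open>auto simp: vanishing_moments_def\<close>)
      then have "\<bar>B \<epsilon> p q - \<epsilon> ^ (d p + d q) * ?L $$ (p, q)\<bar> / \<bar>\<epsilon>\<bar> ^ (d p + d q) \<le> ?c * \<bar>\<epsilon>\<bar>"
        using \<epsilon>(1) by (subst pos_divide_le_eq) (simp_all add: mult_ac)
      moreover have "B \<epsilon> p q / \<epsilon> ^ (d p + d q) - ?L $$ (p, q) = (B \<epsilon> p q - \<epsilon> ^ (d p + d q) * ?L $$ (p, q)) / \<epsilon> ^ (d p + d q)"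
        using \<epsilon>(1) by (simp add: diff_divide_distrib)
      ultimately show ?thesis by (simp only: abs_divide power_abs)
    qed
    have "\<forall>\<^sub>F \<epsilon> in at 0. norm (B \<epsilon> p q / \<epsilon> ^ (d p + d q) - ?L $$ (p, q)) \<le> ?c * norm \<epsilon>"
      unfolding eventually_at using * C(2) by (intro exI[of _ \<delta>]) (simp add: dist_real_def)
    then show ?thesis by (rule bigoI)
  qed
  define E where "E \<epsilon> = det (mat n n (\<lambda>(p, q). B \<epsilon> p q / \<epsilon> ^ (d p + d q)))" for \<epsilon>
  let ?M = "2 * (\<Sum>p<n. d p)"
  have "(\<lambda>\<epsilon>. E \<epsilon> - det ?L) \<in> O[at 0](\<lambda>\<epsilon>. \<epsilon>)"
    unfolding E_def by (rule det_minus_const_bigo[OF entry L])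
  then have "(\<lambda>\<epsilon>. \<epsilon> ^ ?M * (E \<epsilon> - det ?L)) \<in> O[at 0](\<lambda>\<epsilon>. \<epsilon> ^ ?M * \<epsilon>)"
    by (rule landau_o.big.mult_left)
  also have "(\<lambda>\<epsilon>::real. \<epsilon> ^ ?M * \<epsilon>) = (\<lambda>\<epsilon>. \<epsilon> ^ (?M + 1))" by (simp add: mult.commute)
  \<comment> \<open>Division by powers of \<epsilon> is exact only for
    \<open>\<epsilon> \<noteq> 0\<close>, and the filter \<open>at 0\<close> leaves out the
    origin.\<close>
  also have "(\<lambda>\<epsilon>. \<epsilon> ^ ?M * (E \<epsilon> - det ?L)) \<in> O[at 0](\<lambda>\<epsilon>. \<epsilon> ^ (?M + 1)) \<longleftrightarrow>
      (\<lambda>\<epsilon>. (det T)\<^sup>2 * det (Keps K n x \<epsilon>) - \<epsilon> ^ ?M * det ?L) \<in> O[at 0](\<lambda>\<epsilon>. \<epsilon> ^ (?M + 1))"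
  proof (rule landau_o.big.in_cong, unfold eventually_at, intro exI[of _ 1] conjI ballI impI)
    fix \<epsilon> :: real assume "\<epsilon> \<noteq> 0 \<and> dist \<epsilon> 0 < 1"
    then have \<epsilon>: "\<epsilon> \<noteq> 0" by simp
    have Keps: "Keps K n x \<epsilon> \<in> carrier_mat n n" by (simp add: Keps_def)
    have TKT: "T * Keps K n x \<epsilon> * T\<^sup>T = mat n n (\<lambda>(p, q). \<epsilon> ^ (d p + d q) * (B \<epsilon> p q / \<epsilon> ^ (d p + d q)))"
    proof (rule eq_matI)
      fix p q assume "p < dim_row (mat n n (\<lambda>(p, q). \<epsilon> ^ (d p + d q) * (B \<epsilon> p q / \<epsilon> ^ (d p + d q))))"
        "q < dim_col (mat n n (\<lambda>(p, q). \<epsilon> ^ (d p + d q) * (B \<epsilon> p q / \<epsilon> ^ (d p + d q))))"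
      then have pq: "p < n" "q < n" by auto
      have "(T * Keps K n x \<epsilon> * T\<^sup>T) $$ (p, q) = B \<epsilon> p q"
        unfolding index_congruence_mat[OF T Keps pq] B_def kernel_form_def by (intro sum.cong refl) (simp add: Keps_def)
      with pq \<epsilon> show "(T * Keps K n x \<epsilon> * T\<^sup>T) $$ (p, q) =
          mat n n (\<lambda>(p, q). \<epsilon> ^ (d p + d q) * (B \<epsilon> p q / \<epsilon> ^ (d p + d q))) $$ (p, q)" by simp
    qed (use T Keps in auto)
    have "(det T)\<^sup>2 * det (Keps K n x \<epsilon>) = det (T * Keps K n x \<epsilon> * T\<^sup>T)"
      by (rule det_congruence[OF T Keps, symmetric])
    also note TKT
    also have "det (mat n n (\<lambda>(p, q). \<epsilon> ^ (d p + d q) * (B \<epsilon> p q / \<epsilon> ^ (d p + d q)))) = \<epsilon> ^ ?M * E \<epsilon>"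
      unfolding E_def by (rule det_scaled_rows_cols)
    finally have "(det T)\<^sup>2 * det (Keps K n x \<epsilon>) = \<epsilon> ^ ?M * E \<epsilon>" .
    then show "\<epsilon> ^ ?M * (E \<epsilon> - det ?L) = (det T)\<^sup>2 * det (Keps K n x \<epsilon>) - \<epsilon> ^ ?M * det ?L"
      by (simp only: right_diff_distrib)
  qed simp
  finally show ?thesis .
qed

section \<open>Graded enumerations\<close>

lemma downward_closed_eq_lessThan_card:
  fixes S :: "nat set"
  assumes "finite S" "\<And>a b. a \<in> S \<Longrightarrow> b \<le> a \<Longrightarrow> b \<in> S"
  shows "S = {..<card S}"
proof -
  have "a < card S" if "a \<in> S" for a
  proof -
    have "{..a} \<subseteq> S" using assms(2)[OF that] by auto
    from card_mono[OF assms(1) this] show ?thesis by simp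
  qed
  then have "S \<subseteq> {..<card S}" by blast
  then show ?thesis by (intro card_subset_eq) auto
qed

lemma graded_enum_bij:
  assumes "graded_enum k (e :: nat \<Rightarrow> 'd::finite \<Rightarrow> nat)"
  shows "bij_betw e {..<card (PP k :: ('d \<Rightarrow> nat) set)} (PP k)"
  using assms by (simp add: graded_enum_def)

lemma graded_enum_deg_mono:
  fixes e :: "nat \<Rightarrow> 'd::finite \<Rightarrow> nat"
  assumes "graded_enum k e" "a < card (PP k :: ('d \<Rightarrow> nat) set)" "b < card (PP k :: ('d \<Rightarrow> nat) set)"
    "mi_deg (e a) < mi_deg (e b)"
  shows "a < b"
  using assms unfolding graded_enum_def by blast

text \<open>By the grading, the indices of degree at most \<open>j\<close> form an initial segment;
  \<open>e\<close> maps it bijectively onto \<open>PP j\<close>, which determines its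
  length.\<close>

lemma graded_enum_less_card_iff:
  fixes e :: "nat \<Rightarrow> 'd::finite \<Rightarrow> nat"
  assumes e: "graded_enum k e" and j: "j \<le> k" and a: "a < card (PP k :: ('d \<Rightarrow> nat) set)"
  shows "a < card (PP j :: ('d \<Rightarrow> nat) set) \<longleftrightarrow> mi_deg (e a) \<le> j"
proof -
  let ?N = "card (PP k :: ('d \<Rightarrow> nat) set)"
  note bij = graded_enum_bij[OF e]
  define S where "S = {a. a < ?N \<and> mi_deg (e a) \<le> j}"
  have down: "b \<in> S" if "a \<in> S" "b \<le> a" for a b
  proof -
    have "\<not> mi_deg (e a) < mi_deg (e b)"
      using graded_enum_deg_mono[OF e, of a b] that by (auto simp: S_def)
    then show ?thesis using that by (auto simp: S_def)
  qed
  have "finite S" by (simp add: S_def)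
  then have S: "S = {..<card S}" using down by (rule downward_closed_eq_lessThan_card)
  have "PP j \<subseteq> e ` S"
  proof
    fix \<alpha> :: "'d \<Rightarrow> nat" assume \<alpha>: "\<alpha> \<in> PP j"
    then have "\<alpha> \<in> PP k" using j by (simp add: PP_def)
    then have "\<alpha> \<in> e ` {..<?N}" using bij by (simp add: bij_betw_def)
    with \<alpha> show "\<alpha> \<in> e ` S" by (auto simp: S_def PP_def)
  qed
  moreover have "e ` S \<subseteq> PP j" by (auto simp: S_def PP_def)
  ultimately have "e ` S = PP j" by simp
  moreover have "inj_on e S"
    by (rule inj_on_subset[of e "{..<?N}"]) (use bij in \<open>auto simp: bij_betw_def S_def\<close>)
  ultimately have "card S = card (PP j :: ('d \<Rightarrow> nat) set)" using card_image[of e S] by simp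
  moreover have "a \<in> S \<longleftrightarrow> a < card S" using arg_cong[OF S, of "\<lambda>X. a \<in> X"] by (simp only: lessThan_iff)
  ultimately show ?thesis using a by (simp add: S_def)
qed

lemma graded_enum_deg_le:
  assumes "graded_enum k (e :: nat \<Rightarrow> 'd::finite \<Rightarrow> nat)" "a < card (PP k :: ('d \<Rightarrow> nat) set)"
  shows "mi_deg (e a) \<le> k"
  using graded_enum_less_card_iff[OF assms(1) order_refl assms(2)] assms(2) by simp

lemma sum_deg_graded_enum:
  assumes "graded_enum k (e :: nat \<Rightarrow> 'd::finite \<Rightarrow> nat)"
  shows "(\<Sum>a<card (PP k :: ('d \<Rightarrow> nat) set). mi_deg (e a)) = Mkd k TYPE('d)"
  unfolding Mkd_def by (rule sum.reindex_bij_betw[OF graded_enum_bij[OF assms]])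

section \<open>The determinant for as many nodes as monomials\<close>

lemma exists_upper_triangular_multiple:
  fixes V :: "'a::field mat"
  assumes V: "V \<in> carrier_mat n n"
  obtains T where "T \<in> carrier_mat n n" "det T \<noteq> 0" "upper_triangular (T * V)"
proof -
  let ?U = "gauss_jordan_single V"
  obtain T Q where T: "?U = T * V" "T \<in> carrier_mat n n" "Q \<in> carrier_mat n n" "T * Q = 1\<^sub>m n"
    using gauss_jordan_single(4)[OF V refl] by blast
  have U: "?U \<in> carrier_mat n n" using gauss_jordan_single(2)[OF V refl] .
  obtain f where f: "pivot_fun ?U f n"
    using gauss_jordan_single(3)[OF V refl] U by (auto simp: row_echelon_form_def)
  \<comment> \<open>In row echelon form the pivot of row \<open>i\<close> lies in column
    \<open>i\<close> or later, or the row is zero; this includes singular \<open>V\<close>.\<close>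
  have "?U $$ (i, j) = 0" if "i < n" "j < i" for i j
  proof -
    have "j < f i" using pivot_bound[OF _ f, of n 0 i] U that by auto
    then show ?thesis using pivot_funD(2)[OF _ f, of n i j] U that by simp
  qed
  then have "upper_triangular (T * V)" using T(1) U by (auto simp: upper_triangular_def)
  moreover have "det T * det Q = 1" using det_mult[OF T(2,3)] T(4) by simp
  then have "det T \<noteq> 0" by auto
  ultimately show thesis using that T(2) by blast
qed

text \<open>All deleted entries lie off the diagonal, and the diagonal alone determines the
  determinant of a triangular matrix.\<close>

lemma det_diagonal_part_upper_triangular:
  fixes U Y :: "'a::comm_ring_1 mat"
  assumes "U \<in> carrier_mat n n" "upper_triangular U" "Y \<in> carrier_mat n n"
    "\<And>i j. i < n \<Longrightarrow> j < n \<Longrightarrow> Y $$ (i, j) = (if d j = d i then U $$ (i, j) else 0)"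
  shows "det Y = det U"
proof -
  have "upper_triangular Y" using assms by (auto simp: upper_triangular_def)
  moreover have "diag_mat Y = diag_mat U" using assms by (auto simp: diag_mat_def)
  ultimately show ?thesis using det_upper_triangular[of U n] det_upper_triangular[of Y n] assms(1-3) by simp
qed

text \<open>Row reduction supplies an invertible \<open>T\<close>, and the order of row
  \<open>p\<close> is the degree of the p-th monomial. Then \<open>det Y = det T * det V\<close>, so
  \<open>(det T)^2\<close> cancels, for singular \<open>V\<close> as well.\<close>

lemma det_expansion_square:
  fixes K :: "real^'d::finite \<Rightarrow> real^'d \<Rightarrow> real" and x :: "nat \<Rightarrow> real^'d" and e :: "nat \<Rightarrow> 'd \<Rightarrow> nat"
  assumes \<Omega>: "open \<Omega>" "0 \<in> \<Omega>" and K: "Ckk (Suc k) \<Omega> K" and e: "graded_enum k e"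
  defines "N \<equiv> card (PP k :: ('d \<Rightarrow> nat) set)" and "M \<equiv> Mkd k TYPE('d)"
  shows "(\<lambda>\<epsilon>. det (Keps K N x \<epsilon>) - \<epsilon> ^ (2 * M) * (det (Wmat K e N) * (det (Vmat N x e 0 N))\<^sup>2))
    \<in> O[at 0](\<lambda>\<epsilon>. \<epsilon> ^ (2 * M + 1))"
proof -
  let ?V = "Vmat N x e 0 N"
  have V: "?V \<in> carrier_mat N N" by (simp add: Vmat_def)
  have W: "Wmat K e N \<in> carrier_mat N N" by (simp add: Wmat_def)
  obtain T where T: "T \<in> carrier_mat N N" "det T \<noteq> 0" "upper_triangular (T * ?V)"
    using exists_upper_triangular_multiple[OF V] .
  have TV: "(T * ?V) $$ (p, a) = (\<Sum>i<N. T $$ (p, i) * mono_pow (x i) (e a))" if "p < N" "a < N" for p a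
    using that T(1) V by (simp add: scalar_prod_def Vmat_def atLeast0LessThan)
  define Y where "Y = mat N N (\<lambda>(p, a). if mi_deg (e a) = mi_deg (e p) then (T * ?V) $$ (p, a) else 0)"
  have Y: "Y \<in> carrier_mat N N" by (simp add: Y_def)
  have "det Y = det (T * ?V)"
    by (rule det_diagonal_part_upper_triangular[where d = "\<lambda>a. mi_deg (e a)" and n = N]) (use T V in \<open>auto simp: Y_def\<close>)
  then have detY: "det Y = det T * det ?V" using det_mult[OF T(1) V] by simp
  have "(\<lambda>\<epsilon>. (det T)\<^sup>2 * det (Keps K N x \<epsilon>) - \<epsilon> ^ (2 * (\<Sum>p<N. mi_deg (e p))) * det (Y * Wmat K e N * Y\<^sup>T))
    \<in> O[at 0](\<lambda>\<epsilon>. \<epsilon> ^ (2 * (\<Sum>p<N. mi_deg (e p)) + 1))"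
  proof (rule kernel_det_expansion[OF \<Omega> K _ T(1)])
    show "bij_betw e {..<N} (PP k)" unfolding N_def by (rule graded_enum_bij[OF e])
    show "mi_deg (e p) \<le> k" if "p < N" for p using graded_enum_deg_le[OF e] that by (simp add: N_def)
    fix p a assume pa: "p < N" "a < N"
    show "Y $$ (p, a) = (if mi_deg (e a) = mi_deg (e p) then \<Sum>i<N. T $$ (p, i) * mono_pow (x i) (e a) else 0)"
      using pa TV[OF pa] by (simp add: Y_def)
    assume "mi_deg (e a) < mi_deg (e p)"
    then have "a < p" using graded_enum_deg_mono[OF e] pa by (simp add: N_def)
    then have "(T * ?V) $$ (p, a) = 0" using T pa by (simp add: upper_triangular_def)
    then show "(\<Sum>i<N. T $$ (p, i) * mono_pow (x i) (e a)) = 0" using TV[OF pa] by simp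
  qed (rule Y)
  also have "(\<Sum>p<N. mi_deg (e p)) = M" unfolding N_def M_def by (rule sum_deg_graded_enum[OF e])
  finally have "(\<lambda>\<epsilon>. inverse ((det T)\<^sup>2) * ((det T)\<^sup>2 * det (Keps K N x \<epsilon>) - \<epsilon> ^ (2 * M) * det (Y * Wmat K e N * Y\<^sup>T)))
    \<in> O[at 0](\<lambda>\<epsilon>. \<epsilon> ^ (2 * M + 1))"
    by (subst landau_o.big.cmult_in_iff) (use T(2) in auto)
  moreover have "inverse ((det T)\<^sup>2) * ((det T)\<^sup>2 * D - c * det (Y * Wmat K e N * Y\<^sup>T))
      = D - c * (det (Wmat K e N) * (det ?V)\<^sup>2)" for D c
    unfolding det_congruence[OF Y W] detY using T(2) by (simp add: power_mult_distrib field_simps)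
  ultimately show ?thesis by (simp only:)
qed

section \<open>The determinant for fewer nodes than monomials\<close>

lemma transpose_append_zero_rows_mult:
  fixes R :: "'a::comm_semiring_0 mat"
  assumes "R \<in> carrier_mat P P"
  shows "(R @\<^sub>r 0\<^sub>m m P)\<^sup>T * (R @\<^sub>r 0\<^sub>m m P) = R\<^sup>T * R"
proof -
  have "(R @\<^sub>r 0\<^sub>m m P)\<^sup>T = four_block_mat R\<^sup>T (0\<^sub>m P m) (0\<^sub>m 0 P) (0\<^sub>m 0 m)"
    using assms by (intro eq_matI) (auto simp: append_rows_def)
  then show ?thesis
    using assms unfolding append_rows_def
    by (simp, subst mult_four_block_mat[of _ P P _ m _ 0 _ _ P _ 0]) (auto intro!: eq_matI)
qed

text \<open>Here \<open>T\<close> is the transpose of \<open>Q\<close>, which maps the low-degree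
  Vandermonde matrix to \<open>R\<close> above zero rows. The limit matrix factors as
  \<open>L * Y\<close>, and \<open>(det L)^2 = (det R)^2\<close> is the Gram determinant of the
  low-degree columns; \<open>R\<close> is never inverted.\<close>

lemma det_expansion_rectangular:
  fixes K :: "real^'d::finite \<Rightarrow> real^'d \<Rightarrow> real" and x :: "nat \<Rightarrow> real^'d" and e :: "nat \<Rightarrow> 'd \<Rightarrow> nat"
  assumes \<Omega>: "open \<Omega>" "0 \<in> \<Omega>" and k: "k \<ge> 1" and K: "Ckk (Suc k) \<Omega> K" and e: "graded_enum k e"
  defines "N \<equiv> card (PP k :: ('d \<Rightarrow> nat) set)" and "P \<equiv> card (PP (k - 1) :: ('d \<Rightarrow> nat) set)"
    and "M \<equiv> Mkd k TYPE('d)"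
  assumes n: "P < n" "n \<le> N"
    and Q: "Q \<in> carrier_mat n n" "Q\<^sup>T * Q = 1\<^sub>m n" and R: "R \<in> carrier_mat P P" "upper_triangular R"
    and QR: "Vmat n x e 0 P = Q * (R @\<^sub>r 0\<^sub>m (n - P) P)"
  defines "Y \<equiv> four_block_mat (1\<^sub>m P) (0\<^sub>m P (N - P)) (0\<^sub>m (n - P) P)
      ((mat n (n - P) (\<lambda>(i, j). Q $$ (i, P + j)))\<^sup>T * Vmat n x e P N)"
  shows "(\<lambda>\<epsilon>. det (Keps K n x \<epsilon>) - \<epsilon> ^ (2 * (M - k * (N - n)))
      * (det (Y * Wmat K e N * Y\<^sup>T) * det ((Vmat n x e 0 P)\<^sup>T * Vmat n x e 0 P)))
    \<in> O[at 0](\<lambda>\<epsilon>. \<epsilon> ^ (2 * (M - k * (N - n)) + 1))"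
proof -
  let ?T = "Q\<^sup>T"
  let ?V1 = "Vmat n x e 0 P" and ?V2 = "Vmat n x e P N"
  let ?Qp = "mat n (n - P) (\<lambda>(i, j). Q $$ (i, P + j))"
  let ?Z = "R @\<^sub>r 0\<^sub>m (n - P) P"
  have PN: "P \<le> N" using n by simp
  have Z: "?Z \<in> carrier_mat n P" using carrier_append_rows[OF R(1) zero_carrier_mat[of "n - P" P]] n by simp
  have T: "?T \<in> carrier_mat n n" using Q by simp
  have W: "Wmat K e N \<in> carrier_mat N N" by (simp add: Wmat_def)
  have V1: "?V1 \<in> carrier_mat n P" and V2: "?V2 \<in> carrier_mat n (N - P)" by (simp_all add: Vmat_def)
  have less_P: "a < P \<longleftrightarrow> mi_deg (e a) < k" if "a < N" for a
    using graded_enum_less_card_iff[OF e, of "k - 1" a] that k by (auto simp: N_def P_def)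
  have deg_k: "mi_deg (e a) = k" if "a < N" "P \<le> a" for a
    using less_P[OF that(1)] graded_enum_deg_le[OF e, of a] that by (simp add: N_def)
  have detT: "(det ?T)\<^sup>2 = 1"
    using det_mult[OF T Q(1)] Q(2) det_transpose[OF Q(1)] by (simp add: power2_eq_square)
  have TV1: "?T * ?V1 = ?Z"
    unfolding QR using assoc_mult_mat[OF T Q(1) Z] Q(2) Z by simp
  have low: "(\<Sum>i<n. ?T $$ (p, i) * mono_pow (x i) (e a)) = (if p < P then R $$ (p, a) else 0)" if "p < n" "a < P" for p a
  proof -
    have "(\<Sum>i<n. ?T $$ (p, i) * mono_pow (x i) (e a)) = (?T * ?V1) $$ (p, a)"
      using that Q(1) by (simp add: scalar_prod_def Vmat_def atLeast0LessThan)
    then show ?thesis unfolding TV1 using that R(1) by (simp add: append_rows_def)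
  qed
  have high: "(\<Sum>i<n. ?T $$ (p, i) * mono_pow (x i) (e a)) = (?Qp\<^sup>T * ?V2) $$ (p - P, a - P)"
    if "p < n" "P \<le> p" "a < N" "P \<le> a" for p a
    using that Q(1) by (simp add: scalar_prod_def Vmat_def atLeast0LessThan)
  define S where "S = mat P P (\<lambda>(i, j). if mi_deg (e j) = mi_deg (e i) then R $$ (i, j) else 0)"
  have S: "S \<in> carrier_mat P P" by (simp add: S_def)
  have detS: "det S = det R"
    by (rule det_diagonal_part_upper_triangular[OF R S, of "\<lambda>a. mi_deg (e a)"]) (simp add: S_def)
  \<comment> \<open>\<open>L\<close> isolates the contribution of \<open>R\<close>:
    \<open>L * Y\<close> is the surviving part of the transformed Vandermonde matrix, and its other
    factor \<open>Y\<close> involves only the columns of degree \<open>k\<close>.\<close>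
  define L where "L = four_block_mat S (0\<^sub>m P (n - P)) (0\<^sub>m (n - P) P) (1\<^sub>m (n - P))"
  have L: "L \<in> carrier_mat n n"
    using four_block_carrier_mat[OF S one_carrier_mat[of "n - P"]] n by (simp add: L_def)
  have detL: "det L = det R"
    unfolding L_def by (subst det_four_block_mat_upper_right_zero[OF S refl]) (auto simp: detS)
  have QV: "?Qp\<^sup>T * ?V2 \<in> carrier_mat (n - P) (N - P)" using V2 by auto
  have Y: "Y \<in> carrier_mat n N"
    using four_block_carrier_mat[OF one_carrier_mat[of P] QV] n PN by (simp add: Y_def)
  have LY: "L * Y = four_block_mat S (0\<^sub>m P (N - P)) (0\<^sub>m (n - P) P) (?Qp\<^sup>T * ?V2)"
    unfolding L_def Y_def
    by (subst mult_four_block_mat[OF S zero_carrier_mat zero_carrier_mat one_carrier_mat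
          one_carrier_mat zero_carrier_mat zero_carrier_mat QV])
      (use S QV in auto)
  have "(\<lambda>\<epsilon>. (det ?T)\<^sup>2 * det (Keps K n x \<epsilon>) - \<epsilon> ^ (2 * (\<Sum>p<n. mi_deg (e p))) * det ((L * Y) * Wmat K e N * (L * Y)\<^sup>T))
    \<in> O[at 0](\<lambda>\<epsilon>. \<epsilon> ^ (2 * (\<Sum>p<n. mi_deg (e p)) + 1))"
  proof (rule kernel_det_expansion[OF \<Omega> K _ T])
    show "bij_betw e {..<N} (PP k)" unfolding N_def by (rule graded_enum_bij[OF e])
    show deg: "mi_deg (e p) \<le> k" if "p < n" for p using graded_enum_deg_le[OF e, of p] that n by (simp add: N_def)
    show "L * Y \<in> carrier_mat n N" using L Y by simp
    fix p a assume pa: "p < n" "a < N"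
    then have pN: "p < N" using n by simp
    show "(L * Y) $$ (p, a) = (if mi_deg (e a) = mi_deg (e p) then \<Sum>i<n. ?T $$ (p, i) * mono_pow (x i) (e a) else 0)"
    proof (cases "a < P")
      case a: True
      show ?thesis
      proof (cases "p < P")
        case True
        then show ?thesis using a pa low[OF pa(1) a] QV S unfolding LY by (simp add: S_def)
      next
        case False
        then show ?thesis using a pa low[OF pa(1) a] QV S unfolding LY by simp
      qed
    next
      case a: False
      show ?thesis
      proof (cases "p < P")
        case True
        \<comment> \<open>The upper right block of the transformed matrix need not vanish. It drops
          out because its columns have degree \<open>k\<close>, above the order of its rows.\<close>
        then have "mi_deg (e p) < k" using less_P[OF pN] by simp
        moreover have "(L * Y) $$ (p, a) = 0"
          unfolding LY using True a pa n QV S by (subst index_mat_four_block(1)) auto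
        ultimately show ?thesis using a deg_k[OF pa(2)] by simp
      next
        case False
        then have "mi_deg (e a) = mi_deg (e p)" using a deg_k[OF pa(2)] deg_k[OF pN] by simp
        moreover have "(L * Y) $$ (p, a) = (?Qp\<^sup>T * ?V2) $$ (p - P, a - P)"
          unfolding LY using False a pa QV S by (subst index_mat_four_block(1)) auto
        ultimately show ?thesis using high[OF pa(1) _ pa(2)] False a by simp
      qed
    qed
    assume lt: "mi_deg (e a) < mi_deg (e p)"
    then have ap: "a < p" using graded_enum_deg_mono[OF e] pa pN by (simp add: N_def)
    have "a < P" using lt deg[OF pa(1)] less_P[OF pa(2)] by simp
    then show "(\<Sum>i<n. ?T $$ (p, i) * mono_pow (x i) (e a)) = 0"
      using low[OF pa(1)] ap R by (simp add: upper_triangular_def)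
  qed
  moreover have "(\<Sum>p<n. mi_deg (e p)) = M - k * (N - n)"
  proof -
    \<comment> \<open>All indices from \<open>n\<close> on have degree \<open>k\<close>, because
      \<open>P < n\<close>; so the natural-number subtraction \<open>M - k * (N - n)\<close> is
      exact.\<close>
    have "M = (\<Sum>p<N. mi_deg (e p))" unfolding N_def M_def by (rule sum_deg_graded_enum[OF e, symmetric])
    also have "\<dots> = (\<Sum>p<n. mi_deg (e p)) + (\<Sum>p = n..<N. mi_deg (e p))"
      using sum.atLeastLessThan_concat[of 0 n N "\<lambda>p. mi_deg (e p)"] n(2) by (simp add: atLeast0LessThan)
    also have "(\<Sum>p = n..<N. mi_deg (e p)) = (\<Sum>p = n..<N. k)"
      by (intro sum.cong refl deg_k) (use n in auto)
    finally show ?thesis by simp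
  qed
  moreover have "det ((L * Y) * Wmat K e N * (L * Y)\<^sup>T) = det (Y * Wmat K e N * Y\<^sup>T) * det (?V1\<^sup>T * ?V1)"
  proof -
    have YT: "Y\<^sup>T \<in> carrier_mat N n" and LT: "L\<^sup>T \<in> carrier_mat n n" using Y L by auto
    have YW: "Y * Wmat K e N \<in> carrier_mat n N" using Y W by simp
    have YWY: "Y * Wmat K e N * Y\<^sup>T \<in> carrier_mat n n" using YW YT by simp
    have "(L * Y) * Wmat K e N * (L * Y)\<^sup>T = L * (Y * Wmat K e N * Y\<^sup>T) * L\<^sup>T"
      unfolding transpose_mult[OF L Y]
      using assoc_mult_mat[OF L Y W] assoc_mult_mat[OF L YW, of "Y\<^sup>T * L\<^sup>T" n] assoc_mult_mat[OF YW YT LT]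
        assoc_mult_mat[OF L YWY LT] YT LT by simp
    then have "det ((L * Y) * Wmat K e N * (L * Y)\<^sup>T) = (det R)\<^sup>2 * det (Y * Wmat K e N * Y\<^sup>T)"
      using det_congruence[OF L YWY] detL by simp
    moreover have "?V1\<^sup>T * ?V1 = R\<^sup>T * R"
    proof -
      have ZT: "?Z\<^sup>T \<in> carrier_mat P n" using Z by simp
      have "?V1\<^sup>T * ?V1 = ?Z\<^sup>T * (?T * (Q * ?Z))"
        unfolding QR transpose_mult[OF Q(1) Z] using assoc_mult_mat[OF ZT T, of "Q * ?Z" P] Q(1) Z by simp
      also have "?T * (Q * ?Z) = ?Z" using assoc_mult_mat[OF T Q(1) Z] Q(2) Z by simp
      also have "?Z\<^sup>T * ?Z = R\<^sup>T * R" by (rule transpose_append_zero_rows_mult[OF R(1)])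
      finally show ?thesis .
    qed
    then have "det (?V1\<^sup>T * ?V1) = (det R)\<^sup>2"
      using det_mult[of "R\<^sup>T" P R] det_transpose[OF R(1)] R(1) by (simp add: power2_eq_square)
    ultimately show ?thesis by simp
  qed
  ultimately show ?thesis by (simp only: detT mult_1)
qed

section \<open>Eigenvalue groups and conclusion\<close>

lemma scalar_prod_Keps:
  assumes "v \<in> carrier_vec n"
  shows "v \<bullet> (Keps K n x \<epsilon> *\<^sub>v v) = kernel_form K n x (\<lambda>i. v $ i) (\<lambda>j. v $ j) \<epsilon>"
  using assms unfolding kernel_form_def
  by (auto simp: scalar_prod_def Keps_def atLeast0LessThan sum_distrib_left mult_ac intro!: sum.cong)

lemma eigenvalue_bound:
  fixes K :: "real^'d::finite \<Rightarrow> real^'d \<Rightarrow> real" and x :: "nat \<Rightarrow> real^'d"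
  assumes \<Omega>: "open \<Omega>" "0 \<in> \<Omega>" and K: "Ckk (Suc k) \<Omega> K"
    and psd: "\<epsilon>0 > 0" "\<And>\<epsilon>. \<epsilon> \<in> {0..\<epsilon>0} \<Longrightarrow> psd_mat (Keps K n x \<epsilon>)"
    and s: "s \<le> k" and i: "i < n" "s = 0 \<or> card (PP (s - 1) :: ('d \<Rightarrow> nat) set) \<le> i"
  shows "(\<lambda>\<epsilon>. eigs_desc (Keps K n x \<epsilon>) ! i) \<in> O[at_right 0](\<lambda>\<epsilon>. \<epsilon> ^ (2 * s))"
proof -
  obtain C \<delta> :: real where C: "C \<ge> 0" "\<delta> > 0" and bound:
    "\<And>\<epsilon> v w s t. \<bar>\<epsilon>\<bar> < \<delta> \<Longrightarrow> s \<le> k \<Longrightarrow> t \<le> k \<Longrightarrow> vanishing_moments n x s v \<Longrightarrow> vanishing_moments n x t w \<Longrightarrow>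
      \<bar>kernel_form K n x v w \<epsilon>\<bar> \<le> C * (\<Sum>i<n. \<bar>v i\<bar>) * (\<Sum>j<n. \<bar>w j\<bar>) * \<bar>\<epsilon>\<bar> ^ (s + t)"
    using kernel_form_expansion[OF \<Omega> K, where n = n and x = x] by metis
  let ?A = "{\<alpha> :: 'd \<Rightarrow> nat. mi_deg \<alpha> < s}"
  \<comment> \<open>The case \<open>s = 0\<close> is separate because \<open>s - 1\<close> would be
    0 as well, and \<open>PP 0\<close> contains the zero multi-index.\<close>
  have A: "?A = (if s = 0 then {} else PP (s - 1))" by (auto simp: PP_def)
  have "finite ?A" unfolding A by (simp add: finite_PP)
  then obtain h where h: "bij_betw h {0..<card ?A} ?A" using ex_bij_betw_nat_finite by blast
  have card: "card ?A \<le> i" using i(2) unfolding A by auto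
  have eig: "0 \<le> eigs_desc (Keps K n x \<epsilon>) ! i \<and> eigs_desc (Keps K n x \<epsilon>) ! i \<le> C * real n * \<epsilon> ^ (2 * s)"
    if \<epsilon>: "0 < \<epsilon>" "\<epsilon> < min \<delta> \<epsilon>0" for \<epsilon>
  proof
    let ?K = "Keps K n x \<epsilon>"
    have KA: "?K \<in> carrier_mat n n" by (simp add: Keps_def)
    have P: "psd_mat ?K" using psd(2)[of \<epsilon>] \<epsilon> by simp
    \<comment> \<open>Courant-Fischer is used for the bound from above only; semidefiniteness
      supplies the one from below.\<close>
    show "0 \<le> eigs_desc ?K ! i" by (rule eigs_desc_nonneg[OF KA P i(1)])
    have sym: "?K\<^sup>T = ?K" using P by (simp add: psd_mat_def)
    show "eigs_desc ?K ! i \<le> C * real n * \<epsilon> ^ (2 * s)"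
    proof (rule eigs_desc_le_on_subspace[OF KA sym i(1) card, of "\<lambda>l j. mono_pow (x j) (h l)"])
      fix v :: "real Matrix.vec"
      assume v: "v \<in> carrier_vec n" and 0: "\<And>l. l < card ?A \<Longrightarrow> (\<Sum>j = 0..<n. mono_pow (x j) (h l) * v $ j) = 0"
      have vm: "vanishing_moments n x s (\<lambda>i. v $ i)"
        unfolding vanishing_moments_def
      proof (intro allI impI)
        fix \<alpha> :: "'d \<Rightarrow> nat" assume "mi_deg \<alpha> < s"
        then have "\<alpha> \<in> h ` {0..<card ?A}" using h by (simp add: bij_betw_def)
        then obtain l where "l < card ?A" "\<alpha> = h l" by auto
        with 0 show "(\<Sum>i<n. v $ i * mono_pow (x i) \<alpha>) = 0" by (simp add: atLeast0LessThan mult.commute)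
      qed
      have "v \<bullet> (?K *\<^sub>v v) \<le> \<bar>kernel_form K n x (\<lambda>i. v $ i) (\<lambda>j. v $ j) \<epsilon>\<bar>"
        unfolding scalar_prod_Keps[OF v] by simp
      also have "\<dots> \<le> C * (\<Sum>i<n. \<bar>v $ i\<bar>) * (\<Sum>j<n. \<bar>v $ j\<bar>) * \<bar>\<epsilon>\<bar> ^ (s + s)"
        by (rule bound[OF _ s s vm vm]) (use \<epsilon> in auto)
      also have "\<dots> = C * (\<Sum>i<n. \<bar>v $ i\<bar>)\<^sup>2 * \<epsilon> ^ (2 * s)"
        using \<epsilon> by (simp add: power2_eq_square mult_2)
      \<comment> \<open>Cauchy-Schwarz passes from the sum of absolute values to the Euclidean norm,
        at the cost of the factor \<open>n\<close>.\<close>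
      also have "\<dots> \<le> C * ((v \<bullet> v) * real n) * \<epsilon> ^ (2 * s)"
      proof -
        have "(\<Sum>i<n. \<bar>v $ i\<bar>)\<^sup>2 \<le> (\<Sum>i<n. \<bar>v $ i\<bar>\<^sup>2) * real (card {..<n})"
          by (rule sum_squared_le_sum_of_squares)
        also have "(\<Sum>i<n. \<bar>v $ i\<bar>\<^sup>2) = v \<bullet> v"
          using v by (simp add: scalar_prod_def power2_eq_square atLeast0LessThan)
        finally have "(\<Sum>i<n. \<bar>v $ i\<bar>)\<^sup>2 \<le> (v \<bullet> v) * real n" by simp
        then show ?thesis using C \<epsilon> by (intro mult_right_mono mult_left_mono) auto
      qed
      finally show "v \<bullet> (?K *\<^sub>v v) \<le> C * real n * \<epsilon> ^ (2 * s) * (v \<bullet> v)" by (simp add: mult_ac)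
    qed
  qed
  show ?thesis
  proof (rule bigoI)
    show "\<forall>\<^sub>F \<epsilon> in at_right 0. norm (eigs_desc (Keps K n x \<epsilon>) ! i) \<le> C * real n * norm (\<epsilon> ^ (2 * s))"
      unfolding eventually_at_right_field
      using eig C psd(1) by (intro exI[of _ "min \<delta> \<epsilon>0"]) auto
  qed
qed

text \<open>A relative error O(\<epsilon>) becomes, after multiplication by the power in front, an
  absolute error of one order more; both determinants are stated in this form. An eigenvalue's group
  is read off its position: group \<open>s\<close> starts at the number of multi-indices of degree
  below \<open>s\<close>, and the last group is cut off at \<open>n\<close>.\<close>

theorem theorem6p1:
  fixes \<Omega> :: "(real^'d::finite) set" and K :: "real^'d \<Rightarrow> real^'d \<Rightarrow> real"
    and k n :: nat and x :: "nat \<Rightarrow> real^'d" and e :: "nat \<Rightarrow> ('d \<Rightarrow> nat)"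
  assumes "open \<Omega>" and "0 \<in> \<Omega>" and "k \<ge> 1" and "Ckk (k + 1) \<Omega> K"
    and "card (PP (k - 1) :: ('d \<Rightarrow> nat) set) < n"
    and "n \<le> card (PP k :: ('d \<Rightarrow> nat) set)"
    and "graded_enum k e"
  shows "let N = card (PP k :: ('d \<Rightarrow> nat) set);
             P = card (PP (k - 1) :: ('d \<Rightarrow> nat) set);
             M = Mkd k TYPE('d);
             l = N - n
         in (n = N \<longrightarrow>
               (\<lambda>\<epsilon>. det (Keps K n x \<epsilon>)
                    - \<epsilon> ^ (2 * M) * (det (Wmat K e N) * (det (Vmat n x e 0 N))\<^sup>2))
               \<in> O[at 0](\<lambda>\<epsilon>. \<epsilon> ^ (2 * M + 1)))
          \<and> (n < N \<longrightarrow>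
               (\<forall>Q R. Q \<in> carrier_mat n n \<and> Q\<^sup>T * Q = 1\<^sub>m n \<and>
                  R \<in> carrier_mat P P \<and> upper_triangular R \<and>
                  Vmat n x e 0 P = Q * (R @\<^sub>r 0\<^sub>m (n - P) P) \<longrightarrow>
                  (let Qp = mat n (n - P) (\<lambda>(i, j). Q $$ (i, P + j));
                       Y = four_block_mat (1\<^sub>m P) (0\<^sub>m P (N - P)) (0\<^sub>m (n - P) P)
                             (Qp\<^sup>T * Vmat n x e P N);
                       V1 = Vmat n x e 0 P
                   in (\<lambda>\<epsilon>. det (Keps K n x \<epsilon>)
                         - \<epsilon> ^ (2 * (M - k * l)) * (det (Y * Wmat K e N * Y\<^sup>T) * det (V1\<^sup>T * V1)))
                      \<in> O[at 0](\<lambda>\<epsilon>. \<epsilon> ^ (2 * (M - k * l) + 1)))))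
          \<and> ((\<exists>\<epsilon>0>0. \<forall>\<epsilon>\<in>{0..\<epsilon>0}. psd_mat (Keps K n x \<epsilon>)) \<longrightarrow>
               (\<forall>s\<le>k. \<forall>i. i < n \<and> i < card (PP s :: ('d \<Rightarrow> nat) set) \<and>
                   (s = 0 \<or> card (PP (s - 1) :: ('d \<Rightarrow> nat) set) \<le> i) \<longrightarrow>
                   (\<lambda>\<epsilon>. eigs_desc (Keps K n x \<epsilon>) ! i) \<in> O[at_right 0](\<lambda>\<epsilon>. \<epsilon> ^ (2 * s))))"
proof -
  have K: "Ckk (Suc k) \<Omega> K" using assms(4) by simp
  show ?thesis
    unfolding Let_def
  proof (intro conjI impI allI, goal_cases)
    case 1
    show ?case unfolding 1 by (rule det_expansion_square[OF assms(1,2) K assms(7)])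
  next
    case (2 Q R)
    then show ?case
      by (intro det_expansion_rectangular[OF assms(1-3) K assms(7)]) (use assms(5,6) in auto)
  next
    case (3 s i)
    then obtain \<epsilon>0 where "\<epsilon>0 > 0" "\<And>\<epsilon>. \<epsilon> \<in> {0..\<epsilon>0} \<Longrightarrow> psd_mat (Keps K n x \<epsilon>)" by blast
    from eigenvalue_bound[OF assms(1,2) K this] 3 show ?case by blast
  qed
qed

end
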